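(* Let $(M,g,\lambda)$ be a thermostat. If $\kappa_p\leq 0$ on $SM$ for some function $p:SM\to\mathbb{R}$ that is $\mathcal{C}^1$ along the flow, then $(M,g,\lambda)$ has no conjugate points.
   Context: A thermostat $(M,g,\lambda)$ consists of a closed oriented Riemannian surface $(M,g)$ and a function $\lambda\in\mathcal{C}^\infty(SM,\mathbb{R})$, where $\pi:SM\to M$ is the unit tangent bundle. Let $X$ be the geodesic vector field on $SM$, $V$ the vertical vector field (generator of the rotations of the fibers), and $H:=[V,X]$. The thermostat flow $\varphi_t$ on $SM$ is the flow of $F:=X+\lambda V$; its orbits are $(\gamma,\dot\gamma)$ with $\nabla_{\dot\gamma}\dot\gamma=\lambda(\gamma,\dot\gamma)J\dot\gamma$, where $\nabla$ is the Levi-Civita connection and $J$ is rotation by $\pi/2$. A function $p:SM\to\mathbb{R}$ is $\mathcal{C}^1$ along the flow if $t\mapsto p(\varphi_t(v))$ is $\mathcal{C}^1$ for every $v\in SM$; then $Fp(v)=\frac{d}{dt}|_{t=0}p(\varphi_t(v))$. For such $p$, $$\kappa_p:=\pi^*K_g-H\lambda+\lambda^2+Fp+p(p-V\lambda),$$ where $K_g$ is the Gaussian curvature of $g$. The exponential map is $\exp^\lambda_x(tv):=\pi(\varphi_t(x,v))$ for $x\in M$, $t\ge 0$, $v\in S_xM$ (it is $\mathcal{C}^\infty$ on $T_xM\setminus\{0\}$ and $\mathcal{C}^1$ at $0$). The thermostat has no conjugate points if $\exp_x^\lambda:T_xM\to M$ is a local diffeomorphism for all $x\in M$. *)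

theory Defs
  imports "HOL-Analysis.Analysis"
begin

section \<open>Functions of class \<open>C\<^sup>k\<close> on open sets\<close>

fun Ck_on :: "nat \<Rightarrow> 'a::euclidean_space set \<Rightarrow> ('a \<Rightarrow> 'b::real_normed_vector) \<Rightarrow> bool" where
  "Ck_on 0 S f \<longleftrightarrow> continuous_on S f"
| "Ck_on (Suc k) S f \<longleftrightarrow> (\<forall>x\<in>S. f differentiable (at x)) \<and>
     (\<forall>v. Ck_on k S (\<lambda>x. frechet_derivative f (at x) v))"

definition smooth_on :: "'a::euclidean_space set \<Rightarrow> ('a \<Rightarrow> 'b::real_normed_vector) \<Rightarrow> bool" where
  "smooth_on S f \<longleftrightarrow> (\<forall>k. Ck_on k S f)"

definition partial_deriv :: "2 \<Rightarrow> (real^2 \<Rightarrow> real) \<Rightarrow> real^2 \<Rightarrow> real" where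
  "partial_deriv i f y = frechet_derivative f (at y) (axis i 1)"


section \<open>Closed oriented surfaces\<close>

text \<open>The underlying space of the surface \<open>M\<close> is the type \<open>'m\<close>. A chart is a pair of its domain
  and its coordinate map, whose values outside the domain are irrelevant.\<close>

type_synonym 'm chart = "'m set \<times> ('m \<Rightarrow> real^2)"

abbreviation chart_dom :: "'m chart \<Rightarrow> 'm set" where
  "chart_dom c \<equiv> fst c"

abbreviation chart_map :: "'m chart \<Rightarrow> 'm \<Rightarrow> real^2" where
  "chart_map c \<equiv> snd c"

abbreviation chart_codom :: "'m chart \<Rightarrow> (real^2) set" where
  "chart_codom c \<equiv> chart_map c ` chart_dom c"

definition chart_inv :: "'m chart \<Rightarrow> real^2 \<Rightarrow> 'm" where
  "chart_inv c = inv_into (chart_dom c) (chart_map c)"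

definition transition :: "'m chart \<Rightarrow> 'm chart \<Rightarrow> real^2 \<Rightarrow> real^2" where
  "transition c d = chart_map d \<circ> chart_inv c"

definition oriented_atlas :: "'m::topological_space chart set \<Rightarrow> bool" where
  "oriented_atlas A \<longleftrightarrow>
     (\<Union>c\<in>A. chart_dom c) = UNIV \<and>
     (\<forall>c\<in>A. open (chart_dom c) \<and> open (chart_codom c) \<and>
        homeomorphism (chart_dom c) (chart_codom c) (chart_map c) (chart_inv c)) \<and>
     (\<forall>c\<in>A. \<forall>d\<in>A.
        smooth_on (chart_map c ` (chart_dom c \<inter> chart_dom d)) (transition c d) \<and>
        (\<forall>y\<in>chart_map c ` (chart_dom c \<inter> chart_dom d).
           det (matrix (frechet_derivative (transition c d) (at y))) > 0))"

text \<open>Second countability follows from compactness. Connectedness is not required.\<close>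

definition closed_oriented_surface :: "'m::t2_space chart set \<Rightarrow> bool" where
  "closed_oriented_surface A \<longleftrightarrow> compact (UNIV :: 'm set) \<and> oriented_atlas A"


section \<open>The tangent bundle\<close>

text \<open>Every point \<open>x\<close> has a preferred chart, and the tangent space \<open>T\<^sub>xM\<close> is \<open>real^2\<close>: the vector
  \<open>\<xi>\<close> stands for the tangent vector with components \<open>\<xi>\<close> in the preferred chart at \<open>x\<close>. The
  preferred chart does not vary continuously with \<open>x\<close>, so the smooth structure of \<open>TM\<close> is not the
  one of the product; it is given by the bundle charts \<open>tangent_coord A c\<close>, which map the part of
  \<open>TM\<close> over the domain of \<open>c\<close> bijectively onto \<open>chart_codom c \<times> UNIV\<close>, with inverse
  \<open>tangent_point A c\<close>.\<close>

definition chart_at :: "'m chart set \<Rightarrow> 'm \<Rightarrow> 'm chart" where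
  "chart_at A x = (SOME c. c \<in> A \<and> x \<in> chart_dom c)"

definition tangent_coord :: "'m chart set \<Rightarrow> 'm chart \<Rightarrow> 'm \<times> (real^2) \<Rightarrow> (real^2) \<times> (real^2)" where
  "tangent_coord A c = (\<lambda>(x, \<xi>).
     (chart_map c x,
      frechet_derivative (transition (chart_at A x) c) (at (chart_map (chart_at A x) x)) \<xi>))"

definition tangent_point :: "'m chart set \<Rightarrow> 'm chart \<Rightarrow> (real^2) \<times> (real^2) \<Rightarrow> 'm \<times> (real^2)" where
  "tangent_point A c = (\<lambda>(y, w).
     (chart_inv c y,
      frechet_derivative (transition c (chart_at A (chart_inv c y))) (at y) w))"


section \<open>Riemannian metrics\<close>

text \<open>\<open>g x\<close> is the inner product on \<open>T\<^sub>xM\<close>.\<close>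

type_synonym 'm metric = "'m \<Rightarrow> real^2 \<Rightarrow> real^2 \<Rightarrow> real"

definition metric_coeff :: "'m chart set \<Rightarrow> 'm metric \<Rightarrow> 'm chart \<Rightarrow> real^2 \<Rightarrow> real^2^2" where
  "metric_coeff A g c y =
     (\<chi> i j. g (chart_inv c y) (snd (tangent_point A c (y, axis i 1)))
                             (snd (tangent_point A c (y, axis j 1))))"

definition riemannian_metric :: "'m chart set \<Rightarrow> 'm metric \<Rightarrow> bool" where
  "riemannian_metric A g \<longleftrightarrow>
     (\<forall>x. bilinear (g x) \<and> (\<forall>\<xi> \<eta>. g x \<xi> \<eta> = g x \<eta> \<xi>) \<and> (\<forall>\<xi>. \<xi> \<noteq> 0 \<longrightarrow> g x \<xi> \<xi> > 0)) \<and>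
     (\<forall>c\<in>A. smooth_on (chart_codom c) (metric_coeff A g c))"

definition christoffel ::
  "'m chart set \<Rightarrow> 'm metric \<Rightarrow> 'm chart \<Rightarrow> real^2 \<Rightarrow> 2 \<Rightarrow> 2 \<Rightarrow> 2 \<Rightarrow> real" where
  "christoffel A g c y k i j =
     (1/2) * (\<Sum>l\<in>UNIV. matrix_inv (metric_coeff A g c y) $ k $ l *
        (partial_deriv i (\<lambda>z. metric_coeff A g c z $ j $ l) y
       + partial_deriv j (\<lambda>z. metric_coeff A g c z $ i $ l) y
       - partial_deriv l (\<lambda>z. metric_coeff A g c z $ i $ j) y))"

text \<open>The component along \<open>\<partial>\<^sub>l\<close> of
  \<open>R(\<partial>\<^sub>1,\<partial>\<^sub>2)\<partial>\<^sub>2 = \<nabla>\<^sub>1\<nabla>\<^sub>2\<partial>\<^sub>2 - \<nabla>\<^sub>2\<nabla>\<^sub>1\<partial>\<^sub>2\<close>.\<close>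

definition curvature_122 :: "'m chart set \<Rightarrow> 'm metric \<Rightarrow> 'm chart \<Rightarrow> real^2 \<Rightarrow> 2 \<Rightarrow> real" where
  "curvature_122 A g c y l =
     partial_deriv 1 (\<lambda>z. christoffel A g c z l 2 2) y
   - partial_deriv 2 (\<lambda>z. christoffel A g c z l 1 2) y
   + (\<Sum>m\<in>UNIV. christoffel A g c y m 2 2 * christoffel A g c y l 1 m
              - christoffel A g c y m 1 2 * christoffel A g c y l 2 m)"

text \<open>\<open>K\<^sub>g = g(R(\<partial>\<^sub>1,\<partial>\<^sub>2)\<partial>\<^sub>2, \<partial>\<^sub>1) / (g\<^sub>1\<^sub>1 g\<^sub>2\<^sub>2 - g\<^sub>1\<^sub>2 g\<^sub>1\<^sub>2)\<close>, positive on the round sphere.\<close>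

definition gauss_curvature :: "'m chart set \<Rightarrow> 'm metric \<Rightarrow> 'm \<Rightarrow> real" where
  "gauss_curvature A g x = (let c = chart_at A x; y = chart_map c x in
     (\<Sum>l\<in>UNIV. metric_coeff A g c y $ l $ 1 * curvature_122 A g c y l) / det (metric_coeff A g c y))"

text \<open>Rotation by \<open>\<pi>/2\<close> in the coordinates of \<open>c\<close>: the vector \<open>u\<close> with \<open>g(u,w) = 0\<close>,
  \<open>g(u,u) = g(w,w)\<close> and \<open>(w,u)\<close> positively oriented if \<open>w \<noteq> 0\<close>.\<close>

definition rot :: "'m chart set \<Rightarrow> 'm metric \<Rightarrow> 'm chart \<Rightarrow> real^2 \<Rightarrow> real^2 \<Rightarrow> real^2" where
  "rot A g c y w = (let G = metric_coeff A g c y in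
     (1 / sqrt (det G)) *\<^sub>R vector [- ((G *v w) $ 2), (G *v w) $ 1])"


section \<open>The unit tangent bundle\<close>

definition unit_tangent :: "'m metric \<Rightarrow> ('m \<times> (real^2)) set" where
  "unit_tangent g = {(x, \<xi>). g x \<xi> \<xi> = 1}"

definition normalize_tangent :: "'m metric \<Rightarrow> 'm \<times> (real^2) \<Rightarrow> 'm \<times> (real^2)" where
  "normalize_tangent g = (\<lambda>(x, \<xi>). (x, (1 / sqrt (g x \<xi> \<xi>)) *\<^sub>R \<xi>))"

text \<open>A function \<open>f\<close> on \<open>SM\<close> is given by a function on all pairs; only its values on \<open>SM\<close> matter.
  Since normalization is a smooth retraction of \<open>TM\<close> without its zero section onto the
  hypersurface \<open>SM\<close>, the function \<open>f\<close> is smooth on \<open>SM\<close> iff its extension to nonzero vectors that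
  is constant along rays is smooth. The latter, read in the bundle chart of \<open>c\<close>, is
  \<open>local_rep A g c f\<close>.\<close>

definition local_rep ::
  "'m chart set \<Rightarrow> 'm metric \<Rightarrow> 'm chart \<Rightarrow> ('m \<times> (real^2) \<Rightarrow> real) \<Rightarrow> (real^2) \<times> (real^2) \<Rightarrow> real" where
  "local_rep A g c f u = f (normalize_tangent g (tangent_point A c u))"

definition smooth_on_unit_tangent ::
  "'m chart set \<Rightarrow> 'm metric \<Rightarrow> ('m \<times> (real^2) \<Rightarrow> real) \<Rightarrow> bool" where
  "smooth_on_unit_tangent A g f \<longleftrightarrow>
     (\<forall>c\<in>A. smooth_on (chart_codom c \<times> (- {0})) (local_rep A g c f))"

text \<open>A vector field on \<open>SM\<close> is given by its components in the bundle chart of each chart of \<open>M\<close>,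
  at the points of the image of \<open>SM\<close>, to which it is tangent.\<close>

type_synonym 'm bundle_field = "'m chart \<Rightarrow> (real^2) \<times> (real^2) \<Rightarrow> (real^2) \<times> (real^2)"

text \<open>The derivative of \<open>f\<close> along \<open>W\<close>. As \<open>W\<close> is tangent to \<open>SM\<close>, the way \<open>f\<close> is extended off \<open>SM\<close>
  is immaterial.\<close>

definition field_deriv ::
  "'m chart set \<Rightarrow> 'm metric \<Rightarrow> 'm bundle_field \<Rightarrow> ('m \<times> (real^2) \<Rightarrow> real) \<Rightarrow> 'm \<times> (real^2) \<Rightarrow> real" where
  "field_deriv A g W f v = (let c = chart_at A (fst v); u = tangent_coord A c v in
     frechet_derivative (local_rep A g c f) (at u) (W c u))"

definition geodesic_field :: "'m chart set \<Rightarrow> 'm metric \<Rightarrow> 'm bundle_field" where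
  "geodesic_field A g c = (\<lambda>(y, w).
     (w, \<chi> k. - (\<Sum>i\<in>UNIV. \<Sum>j\<in>UNIV. christoffel A g c y k i j * w $ i * w $ j)))"

definition vertical_field :: "'m chart set \<Rightarrow> 'm metric \<Rightarrow> 'm bundle_field" where
  "vertical_field A g c = (\<lambda>(y, w). (0, rot A g c y w))"

abbreviation geodesic_deriv where
  "geodesic_deriv A g \<equiv> field_deriv A g (geodesic_field A g)"

abbreviation vertical_deriv where
  "vertical_deriv A g \<equiv> field_deriv A g (vertical_field A g)"

text \<open>The derivative along \<open>H = [V,X]\<close>.\<close>

definition horizontal_deriv ::
  "'m chart set \<Rightarrow> 'm metric \<Rightarrow> ('m \<times> (real^2) \<Rightarrow> real) \<Rightarrow> 'm \<times> (real^2) \<Rightarrow> real" where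
  "horizontal_deriv A g f v =
     vertical_deriv A g (geodesic_deriv A g f) v - geodesic_deriv A g (vertical_deriv A g f) v"


section \<open>Thermostats\<close>

definition thermostat ::
  "'m::t2_space chart set \<Rightarrow> 'm metric \<Rightarrow> ('m \<times> (real^2) \<Rightarrow> real) \<Rightarrow> bool" where
  "thermostat A g lam \<longleftrightarrow>
     closed_oriented_surface A \<and> riemannian_metric A g \<and> smooth_on_unit_tangent A g lam"

definition thermostat_field ::
  "'m chart set \<Rightarrow> 'm metric \<Rightarrow> ('m \<times> (real^2) \<Rightarrow> real) \<Rightarrow> 'm bundle_field" where
  "thermostat_field A g lam c u =
     geodesic_field A g c u + local_rep A g c lam u *\<^sub>R vertical_field A g c u"

text \<open>Continuity of the footpoint is required so that the curve stays in the domain of \<open>c\<close> for a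
  short time, where the bundle chart is meaningful.\<close>

definition integral_curve ::
  "'m::topological_space chart set \<Rightarrow> 'm metric \<Rightarrow> 'm bundle_field \<Rightarrow> (real \<Rightarrow> 'm \<times> (real^2)) \<Rightarrow> bool" where
  "integral_curve A g W \<gamma> \<longleftrightarrow>
     range \<gamma> \<subseteq> unit_tangent g \<and> continuous_on UNIV (fst \<circ> \<gamma>) \<and>
     (\<forall>t. \<forall>c\<in>A. fst (\<gamma> t) \<in> chart_dom c \<longrightarrow>
        ((\<lambda>s. tangent_coord A c (\<gamma> s)) has_vector_derivative W c (tangent_coord A c (\<gamma> t))) (at t))"

definition thermostat_flow ::
  "'m::topological_space chart set \<Rightarrow> 'm metric \<Rightarrow> ('m \<times> (real^2) \<Rightarrow> real) \<Rightarrow>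
     real \<Rightarrow> 'm \<times> (real^2) \<Rightarrow> 'm \<times> (real^2)" where
  "thermostat_flow A g lam t v =
     (THE \<gamma>. integral_curve A g (thermostat_field A g lam) \<gamma> \<and> \<gamma> 0 = v) t"

definition C1_along_flow ::
  "'m::topological_space chart set \<Rightarrow> 'm metric \<Rightarrow> ('m \<times> (real^2) \<Rightarrow> real) \<Rightarrow> ('m \<times> (real^2) \<Rightarrow> real) \<Rightarrow> bool" where
  "C1_along_flow A g lam p \<longleftrightarrow>
     (\<forall>v\<in>unit_tangent g. (\<lambda>t. p (thermostat_flow A g lam t v)) C1_differentiable_on UNIV)"

definition flow_deriv ::
  "'m::topological_space chart set \<Rightarrow> 'm metric \<Rightarrow> ('m \<times> (real^2) \<Rightarrow> real) \<Rightarrow> ('m \<times> (real^2) \<Rightarrow> real) \<Rightarrow>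
     'm \<times> (real^2) \<Rightarrow> real" where
  "flow_deriv A g lam p v = deriv (\<lambda>t. p (thermostat_flow A g lam t v)) 0"

definition kappa ::
  "'m::topological_space chart set \<Rightarrow> 'm metric \<Rightarrow> ('m \<times> (real^2) \<Rightarrow> real) \<Rightarrow> ('m \<times> (real^2) \<Rightarrow> real) \<Rightarrow>
     'm \<times> (real^2) \<Rightarrow> real" where
  "kappa A g lam p v =
     gauss_curvature A g (fst v) - horizontal_deriv A g lam v + (lam v)\<^sup>2
     + flow_deriv A g lam p v + p v * (p v - vertical_deriv A g lam v)"

definition thermostat_exp ::
  "'m::topological_space chart set \<Rightarrow> 'm metric \<Rightarrow> ('m \<times> (real^2) \<Rightarrow> real) \<Rightarrow> 'm \<Rightarrow> real^2 \<Rightarrow> 'm" where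
  "thermostat_exp A g lam x \<xi> =
     (if \<xi> = 0 then x
      else fst (thermostat_flow A g lam (sqrt (g x \<xi> \<xi>)) (normalize_tangent g (x, \<xi>))))"

text \<open>The exponential map is in general only \<open>C\<^sup>1\<close> at \<open>0\<close>, so local diffeomorphisms are understood in
  the category of \<open>C\<^sup>1\<close> maps. Where the map is smooth, its local inverses are then smooth
  as well, by the inverse function theorem.\<close>

definition local_diffeomorphism ::
  "'m::topological_space chart set \<Rightarrow> (real^2 \<Rightarrow> 'm) \<Rightarrow> bool" where
  "local_diffeomorphism A f \<longleftrightarrow>
     (\<forall>\<xi>. \<exists>U h. open U \<and> \<xi> \<in> U \<and> open (f ` U) \<and> homeomorphism U (f ` U) f h \<and>
        (\<forall>c\<in>A. Ck_on 1 (U \<inter> f -` chart_dom c) (chart_map c \<circ> f) \<and>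
               Ck_on 1 (chart_map c ` (chart_dom c \<inter> f ` U)) (h \<circ> chart_inv c)))"

definition no_conjugate_points ::
  "'m::topological_space chart set \<Rightarrow> 'm metric \<Rightarrow> ('m \<times> (real^2) \<Rightarrow> real) \<Rightarrow> bool" where
  "no_conjugate_points A g lam \<longleftrightarrow> (\<forall>x. local_diffeomorphism A (thermostat_exp A g lam x))"

end

theory Submission
  imports Defs
begin

text \<open>Let \<open>\<gamma>\<close> be an orbit of the flow and vary its initial velocity within a fibre. By the Jacobi
  equation the normal component \<open>x\<close> of the variation field satisfies
  \<open>x'' = V\<lambda> x' - (K - H\<lambda> + \<lambda>\<^sup>2) x\<close>, \<open>x 0 = 0\<close>, \<open>x' 0 = 1\<close>. For \<open>z = x' - p x\<close> this reads
  \<open>z' = (V\<lambda> - p) z - \<kappa>\<^sub>p x\<close>, \<open>z 0 = 1\<close>. As \<open>\<kappa>\<^sub>p \<le> 0\<close>, \<open>z\<close> stays positive as long as \<open>x\<close> does not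
  become negative, and \<open>x' = p x + z\<close> then keeps \<open>x\<close> positive for all positive times. Since \<open>x\<close> is the
  angular derivative of the exponential map up to a positive factor and the radial derivative is
  \<open>\<gamma>'\<close>, the exponential map has invertible derivative away from the origin. At the origin its
  derivative is the identity. The inverse function theorem does the rest.\<close>

section \<open>Continuously differentiable maps\<close>

definition Df :: "('a::real_normed_vector \<Rightarrow> 'b::real_normed_vector) \<Rightarrow> 'a \<Rightarrow> 'a \<Rightarrow>\<^sub>L 'b" where
  "Df f x = Blinfun (frechet_derivative f (at x))"

definition C1_on :: "'a::real_normed_vector set \<Rightarrow> ('a \<Rightarrow> 'b::real_normed_vector) \<Rightarrow> bool" where
  "C1_on S f \<longleftrightarrow> (\<forall>x\<in>S. f differentiable (at x)) \<and> continuous_on S (Df f)"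

lemma Df_apply: "f differentiable (at x) \<Longrightarrow> blinfun_apply (Df f x) = frechet_derivative f (at x)"
  unfolding Df_def
  by (simp add: bounded_linear_Blinfun_apply frechet_derivative_works has_derivative_bounded_linear)

lemma has_derivative_Df: "f differentiable (at x) \<Longrightarrow> (f has_derivative Df f x) (at x)"
  by (simp add: Df_apply frechet_derivative_works)

lemma Df_eqI: "(f has_derivative blinfun_apply f') (at x) \<Longrightarrow> Df f x = f'"
  using Df_apply[of f x] frechet_derivative_at[of f f' x] differentiableI[of f f' "at x"]
  by (metis blinfun_apply_inject)

lemma Df_apply_eq: "(f has_derivative f') (at x) \<Longrightarrow> blinfun_apply (Df f x) = f'"
  using Df_apply[of f x] frechet_derivative_at[of f f' x] differentiableI[of f f' "at x"]
  by metis

lemma C1_on_D: "C1_on S f \<Longrightarrow> x \<in> S \<Longrightarrow> (f has_derivative Df f x) (at x)"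
  by (simp add: C1_on_def has_derivative_Df)

lemma C1_on_frechet: "C1_on S f \<Longrightarrow> x \<in> S \<Longrightarrow> (f has_derivative frechet_derivative f (at x)) (at x)"
  by (simp add: C1_on_def frechet_derivative_works)

lemma C1_on_cont_Df: "C1_on S f \<Longrightarrow> continuous_on S (Df f)"
  by (simp add: C1_on_def)

lemma C1_on_continuous: "C1_on S f \<Longrightarrow> continuous_on S f"
  by (meson C1_on_D continuous_at_imp_continuous_on has_derivative_continuous)

lemma C1_onI:
  assumes "\<And>x. x \<in> S \<Longrightarrow> (f has_derivative blinfun_apply (f' x)) (at x)" "continuous_on S f'"
  shows "C1_on S f"
proof -
  have "Df f x = f' x" if "x \<in> S" for x using assms(1)[OF that] by (rule Df_eqI)
  then show ?thesis unfolding C1_on_def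
    using assms by (metis continuous_on_cong differentiableI)
qed

lemma C1_on_subset: "C1_on S f \<Longrightarrow> T \<subseteq> S \<Longrightarrow> C1_on T f"
  unfolding C1_on_def using continuous_on_subset by blast

lemma C1_on_cong:
  assumes "open S" "\<And>x. x \<in> S \<Longrightarrow> f x = g x" "C1_on S f"
  shows "C1_on S g"
proof (rule C1_onI[where f'="Df f"])
  fix x assume "x \<in> S"
  then show "(g has_derivative Df f x) (at x)"
    using has_derivative_transform_within_open[OF C1_on_D[OF assms(3)] assms(1)] assms(2) by blast
qed (use assms in \<open>simp add: C1_on_def\<close>)

lemma C1_on_const: "C1_on S (\<lambda>x. c)"
  by (rule C1_onI[where f'="\<lambda>x. 0"]) (auto simp: zero_blinfun.rep_eq)

lemma C1_on_linear: "bounded_linear f \<Longrightarrow> C1_on S f"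
  by (rule C1_onI[where f'="\<lambda>x. Blinfun f"])
    (auto simp: bounded_linear_Blinfun_apply bounded_linear_imp_has_derivative)

lemma C1_on_ident: "C1_on S (\<lambda>x. x)"
  by (rule C1_on_linear) (rule bounded_linear_ident)

lemma C1_on_fst: "C1_on S fst" by (rule C1_on_linear) (rule bounded_linear_fst)
lemma C1_on_snd: "C1_on S snd" by (rule C1_on_linear) (rule bounded_linear_snd)

lemma C1_on_compose:
  assumes "C1_on S f" "C1_on T g" "\<And>x. x \<in> S \<Longrightarrow> f x \<in> T"
  shows "C1_on S (\<lambda>x. g (f x))"
proof (rule C1_onI[where f'="\<lambda>x. Df g (f x) o\<^sub>L Df f x"])
  fix x assume "x \<in> S"
  from has_derivative_compose[OF C1_on_D[OF assms(1) this] C1_on_D[OF assms(2) assms(3)[OF this]]]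
  show "((\<lambda>x. g (f x)) has_derivative (Df g (f x) o\<^sub>L Df f x)) (at x)"
    by (simp add: o_def comp_def blinfun_compose.rep_eq)
next
  show "continuous_on S (\<lambda>x. Df g (f x) o\<^sub>L Df f x)"
    by (intro continuous_intros C1_on_cont_Df assms
        continuous_on_compose2[OF C1_on_cont_Df[OF assms(2)] C1_on_continuous[OF assms(1)]])
      (use assms(3) in auto)
qed

lemma C1_on_linear_compose: "bounded_linear g \<Longrightarrow> C1_on S f \<Longrightarrow> C1_on S (\<lambda>x. g (f x))"
  by (rule C1_on_compose[OF _ C1_on_linear[of g UNIV]]) auto

lemma C1_on_add: "C1_on S f \<Longrightarrow> C1_on S g \<Longrightarrow> C1_on S (\<lambda>x. f x + g x)"
  by (rule C1_onI[where f'="\<lambda>x. Df f x + Df g x"])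
    (auto simp: plus_blinfun.rep_eq intro!: continuous_intros has_derivative_add C1_on_D C1_on_cont_Df)

lemma C1_on_minus: "C1_on S f \<Longrightarrow> C1_on S (\<lambda>x. - f x)"
  using C1_on_linear_compose[OF bounded_linear_minus[OF bounded_linear_ident]] by blast

lemma C1_on_diff: "C1_on S f \<Longrightarrow> C1_on S g \<Longrightarrow> C1_on S (\<lambda>x. f x - g x)"
  using C1_on_add[of S f "\<lambda>x. - g x"] C1_on_minus[of S g] by simp

lemma C1_on_sum: "(\<And>i. i \<in> I \<Longrightarrow> C1_on S (f i)) \<Longrightarrow> C1_on S (\<lambda>x. \<Sum>i\<in>I. f i x)"
  by (induction I rule: infinite_finite_induct) (auto intro: C1_on_const C1_on_add)

lemma (in bounded_bilinear) C1_on_bilinear: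
  assumes "C1_on S f" "C1_on S g"
  shows "C1_on S (\<lambda>x. prod (f x) (g x))"
proof (rule C1_onI)
  fix x assume "x \<in> S"
  have "((\<lambda>x. prod (f x) (g x)) has_derivative (\<lambda>h. prod (f x) (Df g x h) + prod (Df f x h) (g x))) (at x)"
    by (rule FDERIV[OF C1_on_D[OF assms(1) \<open>x \<in> S\<close>] C1_on_D[OF assms(2) \<open>x \<in> S\<close>]])
  also have "(\<lambda>h. prod (f x) (Df g x h) + prod (Df f x h) (g x)) =
     blinfun_apply ((prod_right (f x) o\<^sub>L Df g x) + (prod_left (g x) o\<^sub>L Df f x))"
    by (auto simp: fun_eq_iff plus_blinfun.rep_eq blinfun_compose.rep_eq prod_left.rep_eq prod_right.rep_eq)
  finally show "((\<lambda>x. prod (f x) (g x)) has_derivative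
     blinfun_apply ((prod_right (f x) o\<^sub>L Df g x) + (prod_left (g x) o\<^sub>L Df f x))) (at x)" .
next
  show "continuous_on S (\<lambda>x. (prod_right (f x) o\<^sub>L Df g x) + (prod_left (g x) o\<^sub>L Df f x))"
    by (intro continuous_intros C1_on_cont_Df assms
         bounded_linear.continuous_on[OF bounded_linear_prod_right] bounded_linear.continuous_on[OF bounded_linear_prod_left]
        C1_on_continuous)
qed

lemmas C1_on_scaleR = bounded_bilinear.C1_on_bilinear[OF bounded_bilinear_scaleR]
lemmas C1_on_mult = bounded_bilinear.C1_on_bilinear[OF bounded_bilinear_mult]
lemmas C1_on_blinfun_apply = bounded_bilinear.C1_on_bilinear[OF bounded_bilinear_blinfun_apply]

lemma C1_on_real:
  fixes f :: "real \<Rightarrow> real"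
  assumes "\<And>x. x \<in> S \<Longrightarrow> (f has_field_derivative f' x) (at x)" "continuous_on S f'"
  shows "C1_on S f"
proof (rule C1_onI)
  fix x assume "x \<in> S"
  from assms(1)[OF this] show "(f has_derivative blinfun_scaleR_left (f' x)) (at x)"
    by (simp add: has_field_derivative_def blinfun_scaleR_left.rep_eq mult_commute_abs)
next
  show "continuous_on S (\<lambda>x. blinfun_scaleR_left (f' x))"
    by (intro bounded_linear.continuous_on[OF bounded_linear_blinfun_scaleR_left] assms)
qed

lemma C1_on_inverse:
  fixes f :: "'a::real_normed_vector \<Rightarrow> real"
  assumes "C1_on S f" "\<And>x. x \<in> S \<Longrightarrow> f x \<noteq> 0"
  shows "C1_on S (\<lambda>x. inverse (f x))"
  by (rule C1_on_compose[OF assms(1), of "- {0}"])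
    (auto simp: assms(2) intro!: C1_on_real derivative_eq_intros continuous_intros)

lemma C1_on_divide:
  fixes f :: "'a::real_normed_vector \<Rightarrow> real"
  assumes "C1_on S f" "C1_on S g" "\<And>x. x \<in> S \<Longrightarrow> g x \<noteq> 0"
  shows "C1_on S (\<lambda>x. f x / g x)"
  using C1_on_mult[OF assms(1) C1_on_inverse[OF assms(2,3)]] by (simp add: field_class.field_divide_inverse)

lemma C1_on_sqrt:
  fixes f :: "'a::real_normed_vector \<Rightarrow> real"
  assumes "C1_on S f" "\<And>x. x \<in> S \<Longrightarrow> f x > 0"
  shows "C1_on S (\<lambda>x. sqrt (f x))"
  by (rule C1_on_compose[OF assms(1), of "{0<..}"])
    (auto simp: assms(2) intro!: C1_on_real[where f'="\<lambda>x. inverse (sqrt x) / 2"] DERIV_real_sqrt continuous_intros)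

lemma C1_on_Pair:
  assumes "C1_on S f" "C1_on S g"
  shows "C1_on S (\<lambda>x. (f x, g x))"
proof -
  have 1: "bounded_linear (\<lambda>a::'b. (a, 0::'c))" and 2: "bounded_linear (\<lambda>a::'c. (0::'b, a))"
    by (auto intro!: bounded_linear_Pair bounded_linear_ident bounded_linear_zero)
  have "C1_on S (\<lambda>x. (f x, 0) + (0, g x))"
    by (intro C1_on_add C1_on_linear_compose[OF 1] C1_on_linear_compose[OF 2] assms)
  then show ?thesis by simp
qed

lemma C1_on_vec_nth: "C1_on S f \<Longrightarrow> C1_on S (\<lambda>x. f x $ i)"
  by (rule C1_on_linear_compose) (auto intro: bounded_linear_vec_nth)

lemma C1_on_vec:
  fixes f :: "'a::real_normed_vector \<Rightarrow> 'n::finite \<Rightarrow> real"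
  assumes "\<And>i. C1_on S (\<lambda>x. f x i)"
  shows "C1_on S (\<lambda>x. \<chi> i. f x i)"
proof -
  have "(\<chi> i. f x i) = (\<Sum>i\<in>UNIV. f x i *\<^sub>R axis i 1)" for x
    by (simp add: vec_eq_iff axis_def if_distrib[of "(*) _"] cong: if_cong)
  then show ?thesis using assms by (auto intro!: C1_on_sum C1_on_scaleR C1_on_const)
qed

lemma C1_on_blinfunI:
  fixes h :: "'c::real_normed_vector \<Rightarrow> 'a::euclidean_space \<Rightarrow>\<^sub>L 'b::real_normed_vector"
  assumes "\<And>b. b \<in> Basis \<Longrightarrow> C1_on S (\<lambda>x. h x b)"
  shows "C1_on S h"
proof -
  have eq: "h x = (\<Sum>b\<in>Basis. blinfun_scaleR_left (h x b) o\<^sub>L blinfun_inner_left b)" for x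
    by (rule blinfun_euclidean_eqI)
      (simp add: blinfun.sum_left blinfun_compose.rep_eq inner_Basis if_distrib[of "\<lambda>r. r *\<^sub>R _"] cong: if_cong)
  have "C1_on S (\<lambda>x. \<Sum>b\<in>Basis. blinfun_scaleR_left (h x b) o\<^sub>L blinfun_inner_left b)"
    by (intro C1_on_sum C1_on_linear_compose[OF bounded_bilinear.bounded_linear_left[OF bounded_bilinear_blinfun_compose]]
        C1_on_linear_compose[OF bounded_linear_blinfun_scaleR_left] assms)
  then show ?thesis using eq by simp
qed

lemma C1_on_eq_Ck_on_1:
  fixes f :: "'a::euclidean_space \<Rightarrow> 'b::real_normed_vector"
  shows "C1_on S f \<longleftrightarrow> Ck_on 1 S f"
proof
  assume "C1_on S f"
  then have *: "\<forall>x\<in>S. f differentiable (at x)" "continuous_on S (Df f)" by (auto simp: C1_on_def)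
  have "continuous_on S (\<lambda>x. Df f x v)" for v
    by (intro continuous_intros *)
  then have "continuous_on S (\<lambda>x. frechet_derivative f (at x) v)" for v
    by (metis (no_types, lifting) *(1) Df_apply continuous_on_cong)
  then show "Ck_on 1 S f" using * by simp
next
  assume "Ck_on 1 S f"
  then have *: "\<forall>x\<in>S. f differentiable (at x)" "\<And>v. continuous_on S (\<lambda>x. frechet_derivative f (at x) v)" by auto
  have "continuous_on S (\<lambda>x. Df f x v)" for v
    by (metis (no_types, lifting) * Df_apply continuous_on_cong)
  then show "C1_on S f" unfolding C1_on_def using *(1) by (auto intro: continuous_on_blinfun_componentwise)
qed

lemma smooth_on_C1_on: "smooth_on S f \<Longrightarrow> C1_on S f"
  by (simp add: C1_on_eq_Ck_on_1 smooth_on_def del: Ck_on.simps)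

lemma smooth_on_frechet: "smooth_on S f \<Longrightarrow> smooth_on S (\<lambda>x. frechet_derivative f (at x) v)"
  unfolding smooth_on_def using Ck_on.simps(2) by blast

lemma Ck_on_cong:
  assumes "open S" "\<And>x. x \<in> S \<Longrightarrow> f x = g x"
  shows "Ck_on k S f \<Longrightarrow> Ck_on k S g"
  using assms(2)
proof (induction k arbitrary: f g)
  case 0
  then show ?case using continuous_on_cong by force
next
  case (Suc k)
  have hd: "(f has_derivative D) (at x) \<longleftrightarrow> (g has_derivative D) (at x)" if "x \<in> S" for x D
    using has_derivative_transform_within_open[of f D x UNIV S g] has_derivative_transform_within_open[of g D x UNIV S f] assms(1) Suc.prems(2) that
    by auto
  then have fd: "frechet_derivative f (at x) = frechet_derivative g (at x)" if "x \<in> S" for x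
    unfolding frechet_derivative_def using that by auto
  have "Ck_on k S (\<lambda>x. frechet_derivative g (at x) v)" for v
    by (rule Suc.IH[of "\<lambda>x. frechet_derivative f (at x) v"]) (use Suc.prems fd in auto)
  then show ?case using Suc.prems hd unfolding Ck_on.simps differentiable_def by blast
qed

lemma smooth_on_linear:
  assumes "open S" "bounded_linear L" "smooth_on S f"
  shows "smooth_on S (\<lambda>x. L (f x))"
proof -
  have "Ck_on k S f \<Longrightarrow> Ck_on k S (\<lambda>x. L (f x))" for k
  proof (induction k arbitrary: f)
    case 0
    then show ?case using assms(2) by (auto intro: bounded_linear.continuous_on)
  next
    case (Suc k)
    have hd: "((\<lambda>x. L (f x)) has_derivative (\<lambda>v. L (frechet_derivative f (at x) v))) (at x)" if "x \<in> S" for x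
      by (rule bounded_linear.has_derivative[OF assms(2)])
        (use Suc.prems that in \<open>simp add: frechet_derivative_works\<close>)
    have "Ck_on k S (\<lambda>x. frechet_derivative (\<lambda>x. L (f x)) (at x) v)" for v
      by (rule Ck_on_cong[OF assms(1) _ Suc.IH[of "\<lambda>x. frechet_derivative f (at x) v"]])
        (use Suc.prems frechet_derivative_at[OF hd] in \<open>auto dest: fun_cong\<close>)
    then show ?case using hd unfolding Ck_on.simps differentiable_def by blast
  qed
  then show ?thesis using assms(3) by (auto simp: smooth_on_def)
qed

lemma smooth_on_C1_on_frechet: "smooth_on S f \<Longrightarrow> C1_on S (\<lambda>x. frechet_derivative f (at x) v)"
  by (intro smooth_on_C1_on smooth_on_frechet)

lemma smooth_on_C1_on_Df:
  fixes f :: "'a::euclidean_space \<Rightarrow> 'b::real_normed_vector"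
  assumes "open S" "smooth_on S f"
  shows "C1_on S (Df f)"
proof (rule C1_on_blinfunI)
  fix b :: 'a
  show "C1_on S (\<lambda>x. Df f x b)"
    by (rule C1_on_cong[OF assms(1) _ smooth_on_C1_on_frechet[OF assms(2), of b]])
      (use smooth_on_C1_on[OF assms(2)] in \<open>simp add: Df_apply C1_on_def\<close>)
qed

lemma second_difference_estimate:
  fixes f :: "'a::real_normed_vector \<Rightarrow> 'b::real_normed_vector"
  assumes S: "open S" "x \<in> S" and f: "\<And>y. y \<in> S \<Longrightarrow> (f has_derivative f' y) (at y)"
    and g: "((\<lambda>y. f' y u) has_derivative g') (at x)" and e: "e > 0"
  shows "\<exists>d>0. \<forall>s. 0 < s \<and> s < d \<longrightarrow>
    norm (f (x + s *\<^sub>R u + s *\<^sub>R v) - f (x + s *\<^sub>R u) - f (x + s *\<^sub>R v) + f x - s\<^sup>2 *\<^sub>R g' v) \<le> e * s\<^sup>2"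
proof -
  define m where "m = norm u + norm v + 1"
  have m: "m > 0" by (simp add: m_def add_nonneg_pos)
  obtain d0 where d0: "d0 > 0" "ball x d0 \<subseteq> S" using S open_contains_ball by blast
  obtain d1 where d1: "d1 > 0" "\<And>y. norm (y - x) < d1 \<Longrightarrow>
      norm (f' y u - f' x u - g' (y - x)) \<le> e / (2 * m) * norm (y - x)"
    using g e m unfolding has_derivative_at_alt
    by (metis divide_pos_pos mult_pos_pos zero_less_numeral)
  interpret g': bounded_linear g' using g by (rule has_derivative_bounded_linear)
  define d where "d = min d0 d1 / m"
  have "d > 0" using d0 d1 m by (simp add: d_def)
  moreover have "norm (f (x + s *\<^sub>R u + s *\<^sub>R v) - f (x + s *\<^sub>R u) - f (x + s *\<^sub>R v) + f x - s\<^sup>2 *\<^sub>R g' v) \<le> e * s\<^sup>2"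
    if s: "0 < s" "s < d" for s
  proof -
    have sm: "s * m < d0" "s * m < d1" using s m by (auto simp: d_def pos_less_divide_eq)
    have nb: "norm (a *\<^sub>R u + b *\<^sub>R v) \<le> s * m" if "0 \<le> a" "a \<le> s" "0 \<le> b" "b \<le> s" for a b
    proof -
      have "norm (a *\<^sub>R u + b *\<^sub>R v) \<le> a * norm u + b * norm v"
        by (rule order_trans[OF norm_triangle_ineq]) (use that in auto)
      also have "\<dots> \<le> s * norm u + s * norm v" using that by (intro add_mono mult_right_mono) auto
      finally show ?thesis using s by (simp add: m_def algebra_simps)
    qed
    have inS: "x + a *\<^sub>R u + b *\<^sub>R v \<in> S" if "0 \<le> a" "a \<le> s" "0 \<le> b" "b \<le> s" for a b
    proof -
      have "dist x (x + a *\<^sub>R u + b *\<^sub>R v) = norm (a *\<^sub>R u + b *\<^sub>R v)" by (simp add: dist_norm norm_minus_commute add.assoc norm_minus_cancel)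
         (metis add.commute minus_add_distrib norm_minus_cancel uminus_add_conv_diff)
      then show ?thesis using nb[OF that] sm d0 by (auto simp: subset_iff)
    qed
    have est: "norm (f' (x + a *\<^sub>R u + b *\<^sub>R v) u - f' x u - g' (a *\<^sub>R u + b *\<^sub>R v)) \<le> e / 2 * s"
      if "0 \<le> a" "a \<le> s" "0 \<le> b" "b \<le> s" for a b
    proof -
      have "norm (f' (x + a *\<^sub>R u + b *\<^sub>R v) u - f' x u - g' (a *\<^sub>R u + b *\<^sub>R v)) \<le> e / (2 * m) * norm (a *\<^sub>R u + b *\<^sub>R v)"
        using d1(2)[of "x + a *\<^sub>R u + b *\<^sub>R v"] nb[OF that] sm by (simp add: add.assoc)
      also have "\<dots> \<le> e / (2 * m) * (s * m)" using nb[OF that] e m by (intro mult_left_mono) auto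
      finally show ?thesis using m by (simp add: field_simps)
    qed
    define \<phi> where "\<phi> a = f (x + a *\<^sub>R u + s *\<^sub>R v) - f (x + a *\<^sub>R u + 0 *\<^sub>R v) - (a * s) *\<^sub>R g' v" for a
    define \<phi>' where "\<phi>' a h = h *\<^sub>R f' (x + a *\<^sub>R u + s *\<^sub>R v) u - h *\<^sub>R f' (x + a *\<^sub>R u + 0 *\<^sub>R v) u - (h * s) *\<^sub>R g' v" for a h
    have lin: "linear (f' y)" if "y \<in> S" for y using f[OF that] by (simp add: has_derivative_linear)
    have der: "(\<phi> has_derivative \<phi>' a) (at a within {0..s})" if "a \<in> {0..s}" for a
    proof -
      have *: "((\<lambda>a. f (x + a *\<^sub>R u + b *\<^sub>R v)) has_derivative (\<lambda>h. f' (x + a *\<^sub>R u + b *\<^sub>R v) (h *\<^sub>R u))) (at a within {0..s})"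
        if "0 \<le> b" "b \<le> s" for b
        by (rule has_derivative_compose[of "\<lambda>a. x + a *\<^sub>R u + b *\<^sub>R v"])
          (use \<open>a \<in> _\<close> that in \<open>auto intro!: derivative_eq_intros f inS\<close>)
      have *: "((\<lambda>a. f (x + a *\<^sub>R u + b *\<^sub>R v)) has_derivative (\<lambda>h. h *\<^sub>R f' (x + a *\<^sub>R u + b *\<^sub>R v) u)) (at a within {0..s})"
        if "0 \<le> b" "b \<le> s" for b
        using *[OF that] lin[OF inS[of a b]] \<open>a \<in> _\<close> that by (simp add: linear_scale)
      show ?thesis unfolding \<phi>_def \<phi>'_def
        by (intro has_derivative_diff * derivative_eq_intros) (use s in auto)
    qed
    have bd: "onorm (\<phi>' a) \<le> e * s" if "a \<in> {0..s}" for a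
    proof (rule onorm_le)
      fix h
      have "norm (\<phi>' a h) = \<bar>h\<bar> * norm (f' (x + a *\<^sub>R u + s *\<^sub>R v) u - f' (x + a *\<^sub>R u + 0 *\<^sub>R v) u - s *\<^sub>R g' v)"
        unfolding \<phi>'_def by (simp flip: norm_scaleR add: algebra_simps)
      also have "norm (f' (x + a *\<^sub>R u + s *\<^sub>R v) u - f' (x + a *\<^sub>R u + 0 *\<^sub>R v) u - s *\<^sub>R g' v) =
         norm ((f' (x + a *\<^sub>R u + s *\<^sub>R v) u - f' x u - g' (a *\<^sub>R u + s *\<^sub>R v)) - (f' (x + a *\<^sub>R u + 0 *\<^sub>R v) u - f' x u - g' (a *\<^sub>R u + 0 *\<^sub>R v)))"
        by (simp add: g'.add g'.scaleR algebra_simps)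
      also have "\<dots> \<le> e / 2 * s + e / 2 * s"
        by (rule order_trans[OF norm_triangle_ineq4]) (intro add_mono est; use s that in auto)
      finally show "norm (\<phi>' a h) \<le> e * s * norm h" by (simp add: mult.commute[of "e * s"] mult_left_mono)
    qed
    have "norm (\<phi> s - \<phi> 0) \<le> e * s * norm (s - 0)"
      by (rule differentiable_bound[OF _ der bd]) (use s in auto)
    then show ?thesis using s by (simp add: \<phi>_def power2_eq_square algebra_simps)
  qed
  ultimately show ?thesis by blast
qed

lemma mixed_derivatives_eq:
  fixes f :: "'a::real_normed_vector \<Rightarrow> 'b::real_normed_vector"
  assumes S: "open S" "x \<in> S" and f: "\<And>y. y \<in> S \<Longrightarrow> (f has_derivative f' y) (at y)"
    and gu: "((\<lambda>y. f' y u) has_derivative gu) (at x)" and gv: "((\<lambda>y. f' y v) has_derivative gv) (at x)"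
  shows "gu v = gv u"
proof (rule ccontr)
  assume "gu v \<noteq> gv u"
  define e where "e = norm (gu v - gv u) / 3"
  have e: "e > 0" using \<open>gu v \<noteq> gv u\<close> by (simp add: e_def)
  obtain d1 where d1: "d1 > 0" "\<And>s. 0 < s \<Longrightarrow> s < d1 \<Longrightarrow>
    norm (f (x + s *\<^sub>R u + s *\<^sub>R v) - f (x + s *\<^sub>R u) - f (x + s *\<^sub>R v) + f x - s\<^sup>2 *\<^sub>R gu v) \<le> e * s\<^sup>2"
    using second_difference_estimate[OF S f gu e, of v] by blast
  obtain d2 where d2: "d2 > 0" "\<And>s. 0 < s \<Longrightarrow> s < d2 \<Longrightarrow>
    norm (f (x + s *\<^sub>R v + s *\<^sub>R u) - f (x + s *\<^sub>R v) - f (x + s *\<^sub>R u) + f x - s\<^sup>2 *\<^sub>R gv u) \<le> e * s\<^sup>2"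
    using second_difference_estimate[OF S f gv e, of u] by blast
  define s where "s = min d1 d2 / 2"
  have s: "0 < s" "s < d1" "s < d2" using d1 d2 by (auto simp: s_def min_def)
  define D where "D = f (x + s *\<^sub>R u + s *\<^sub>R v) - f (x + s *\<^sub>R u) - f (x + s *\<^sub>R v) + f x"
  have 1: "norm (D - s\<^sup>2 *\<^sub>R gu v) \<le> e * s\<^sup>2" using d1(2) s by (simp add: D_def)
  have "f (x + s *\<^sub>R v + s *\<^sub>R u) - f (x + s *\<^sub>R v) - f (x + s *\<^sub>R u) + f x = D" by (simp add: D_def add.commute add.left_commute add.assoc)
  then have 2: "norm (D - s\<^sup>2 *\<^sub>R gv u) \<le> e * s\<^sup>2" using d2(2)[of s] s by simp
  have "s\<^sup>2 * norm (gu v - gv u) = norm ((D - s\<^sup>2 *\<^sub>R gv u) - (D - s\<^sup>2 *\<^sub>R gu v))"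
    by (simp flip: scaleR_diff_right)
  also have "\<dots> \<le> e * s\<^sup>2 + e * s\<^sup>2" by (rule order_trans[OF norm_triangle_ineq4]) (intro add_mono 1 2)
  finally have "norm (gu v - gv u) \<le> 2 * e" using s by (simp add: mult.commute)
  then show False using e by (simp add: e_def)
qed

section \<open>Ordinary differential equations\<close>

lemma vector_derivative_bound:
  fixes e :: "real \<Rightarrow> 'a::real_normed_vector"
  assumes "convex I" "\<And>t. t \<in> I \<Longrightarrow> (e has_vector_derivative e' t) (at t within I)"
    and "\<And>t. t \<in> I \<Longrightarrow> norm (e' t) \<le> B" and "s \<in> I" "t \<in> I"
  shows "norm (e t - e s) \<le> B * \<bar>t - s\<bar>"
proof -
  have "norm (e t - e s) \<le> B * norm (t - s)"
  proof (rule differentiable_bound[OF assms(1)])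
    fix x assume "x \<in> I"
    show "(e has_derivative (\<lambda>h. h *\<^sub>R e' x)) (at x within I)"
      using assms(2)[OF \<open>x \<in> I\<close>] by (simp add: has_vector_derivative_def)
    show "onorm (\<lambda>h. h *\<^sub>R e' x) \<le> B"
      by (rule onorm_le) (use assms(3)[OF \<open>x \<in> I\<close>] in \<open>simp add: mult.commute[of B] mult_left_mono\<close>)
  qed (use assms in auto)
  then show ?thesis by simp
qed

lemma has_vector_derivative_imp_continuous_on:
  "(\<And>t. t \<in> I \<Longrightarrow> (e has_vector_derivative e' t) (at t within I)) \<Longrightarrow> continuous_on I e"
  by (meson has_vector_derivative_continuous continuous_on_eq_continuous_within)

text \<open>With \<open>d * L \<le> 1/2\<close> this replaces Gronwall's inequality.\<close>

lemma small_time_estimate: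
  fixes e :: "real \<Rightarrow> 'a::real_normed_vector"
  assumes d: "0 \<le> d" "0 \<le> L" "d * L \<le> 1/2"
    and der: "\<And>t. t \<in> {-d..d} \<Longrightarrow> (e has_vector_derivative e' t) (at t within {-d..d})"
    and bd: "\<And>t. t \<in> {-d..d} \<Longrightarrow> norm (e' t) \<le> L * norm (e t) + R"
    and t: "t \<in> {-d..d}"
  shows "norm (e t) \<le> 2 * (norm (e 0) + d * R)"
proof -
  have "continuous_on {-d..d} (\<lambda>t. norm (e t))"
    by (intro continuous_on_norm has_vector_derivative_imp_continuous_on[OF der])
  moreover have "{-d..d} \<noteq> {}" using d by auto
  ultimately obtain m where m: "m \<in> {-d..d}" "\<And>t. t \<in> {-d..d} \<Longrightarrow> norm (e t) \<le> norm (e m)"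
    using continuous_attains_sup[of "{-d..d}" "\<lambda>t. norm (e t)"] by blast
  let ?M = "norm (e m)"
  have nn: "0 \<le> L * ?M + R" using bd[OF m(1)] by (meson norm_ge_zero order_trans)
  have "norm (e m - e 0) \<le> (L * ?M + R) * \<bar>m - 0\<bar>"
    by (rule vector_derivative_bound[of "{-d..d}"], rule convex_real_interval, rule der, assumption)
      (use bd m d in \<open>auto intro!: order_trans[OF bd] mult_left_mono\<close>)
  also have "\<dots> \<le> (L * ?M + R) * d" using nn m(1) by (intro mult_left_mono) auto
  finally have "?M \<le> norm (e 0) + (d * L) * ?M + d * R"
    using norm_triangle_ineq2[of "e m" "e 0"] by (simp add: algebra_simps)
  also have "(d * L) * ?M \<le> 1/2 * ?M" using d by (intro mult_right_mono) auto
  finally have "?M \<le> 2 * (norm (e 0) + d * R)" by simp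
  then show ?thesis using m(2)[OF t] by simp
qed

lemma picard:
  fixes G :: "real \<Rightarrow> 'a::banach \<Rightarrow> 'a"
  assumes d: "0 \<le> d" "0 \<le> L" "d * L \<le> 1/2"
    and cont: "\<And>u. continuous_on {-d..d} u \<Longrightarrow> continuous_on {-d..d} (\<lambda>s. G s (u s))"
    and lip: "\<And>s a b. s \<in> {-d..d} \<Longrightarrow> norm (G s a - G s b) \<le> L * norm (a - b)"
  shows "\<exists>u. u 0 = x0 \<and> (\<forall>t\<in>{-d..d}. (u has_vector_derivative G t (u t)) (at t within {-d..d}))"
proof -
  define cl where "cl t = max (-d) (min d t)" for t
  have cl: "cl t \<in> {-d..d}" "t \<in> {-d..d} \<Longrightarrow> cl t = t" "continuous_on UNIV cl" for t
    using d unfolding cl_def by (auto intro!: continuous_intros)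
  define J where "J u t = x0 + (integral {-d..t} (\<lambda>s. G s (u s)) - integral {-d..0} (\<lambda>s. G s (u s)))" for u t
  have J0: "J u 0 = x0" for u by (simp add: J_def)
  have Jder: "(J v has_vector_derivative G t (v t)) (at t within {-d..d})"
    if "continuous_on {-d..d} v" "t \<in> {-d..d}" for v t
    unfolding J_def
    using integral_has_vector_derivative[OF cont[OF that(1)] that(2)]
    by (auto intro!: derivative_eq_intros)
  define T where "T v = Bcontfun (\<lambda>t. J (apply_bcontfun v) (cl t))" for v :: "real \<Rightarrow>\<^sub>C 'a"
  have T: "apply_bcontfun (T v) = (\<lambda>t. J (apply_bcontfun v) (cl t))" for v
  proof -
    have c: "continuous_on {-d..d} (J v)"
      by (rule has_vector_derivative_imp_continuous_on[OF Jder]) auto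
    have "continuous_on UNIV (\<lambda>t. J v (cl t))"
      by (rule continuous_on_compose2[OF c cl(3)]) (use cl(1) in auto)
    moreover have "bounded (range (\<lambda>t. J v (cl t)))"
      by (rule bounded_subset[OF compact_imp_bounded[OF compact_continuous_image[OF c compact_Icc]]])
        (use cl(1) in auto)
    ultimately show ?thesis unfolding T_def by (intro Bcontfun_inverse) (auto simp: bcontfun_def)
  qed
  have "dist (T v) (T w) \<le> 1/2 * dist v w" for v w
  proof (rule dist_bound)
    fix t
    define D where "D t = J v t - J w t" for t
    have "norm (D (cl t) - D 0) \<le> (L * dist v w) * \<bar>cl t - 0\<bar>"
    proof (rule vector_derivative_bound[of "{-d..d}"])
      fix s assume s: "s \<in> {-d..d}"
      show "(D has_vector_derivative (G s (v s) - G s (w s))) (at s within {-d..d})"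
        unfolding D_def by (intro has_vector_derivative_diff Jder s) auto
      show "norm (G s (v s) - G s (w s)) \<le> L * dist v w"
        by (rule order_trans[OF lip[OF s]]) (use d dist_bounded[of v s w] in \<open>auto simp: dist_norm intro!: mult_left_mono\<close>)
    qed (use cl d in auto)
    also have "\<dots> \<le> (L * dist v w) * d" using d cl(1)[of t] by (intro mult_left_mono) auto
    also have "\<dots> = (d * L) * dist v w" by simp
    also have "\<dots> \<le> 1/2 * dist v w" using d by (intro mult_right_mono) auto
    finally show "dist (T v t) (T w t) \<le> 1/2 * dist v w"
      by (simp add: T D_def J0 dist_norm)
  qed
  then obtain v where v: "T v = v" using banach_fix_type[of "1/2" T] by auto
  have vJ: "v t = J v (cl t)" for t using T[of v] v by metis
  show ?thesis
  proof (intro exI conjI ballI)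
    show "v 0 = x0" using vJ[of 0] cl(2)[of 0] d by (simp add: J0)
    fix t assume t: "t \<in> {-d..d}"
    show "(v has_vector_derivative G t (v t)) (at t within {-d..d})"
    proof (rule has_vector_derivative_transform[OF t])
      show "((\<lambda>s. J v s) has_vector_derivative G t (v t)) (at t within {-d..d})"
        by (rule Jder[OF _ t]) auto
      fix s assume "s \<in> {-d..d}"
      then have "cl s = s" by (rule cl(2))
      then show "v s = J v s" using vJ[of s] \<open>cl s = s\<close> by (simp only:)
    qed
  qed
qed

lemma C1_on_locally_Lipschitz:
  assumes "open S" "C1_on S F" "a \<in> S"
  obtains L r where "0 \<le> L" "r > 0" "cball a r \<subseteq> S"
    "\<And>x y. x \<in> cball a r \<Longrightarrow> y \<in> cball a r \<Longrightarrow> norm (F x - F y) \<le> L * norm (x - y)"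
proof -
  obtain r1 where r1: "r1 > 0" "cball a r1 \<subseteq> S" using assms open_contains_cball by blast
  obtain r2 where r2: "r2 > 0" "\<And>x. x \<in> S \<Longrightarrow> dist x a < r2 \<Longrightarrow> dist (Df F x) (Df F a) < 1"
    using C1_on_cont_Df[OF assms(2), unfolded continuous_on_iff, rule_format, OF assms(3) zero_less_one] by blast
  define r where "r = min r1 r2 / 2"
  have r: "r > 0" "r \<le> r1" "r < r2" using r1 r2 by (auto simp: r_def min_def)
  have sub: "cball a r \<subseteq> S" using r r1 by auto
  show ?thesis
  proof (rule that[of "norm (Df F a) + 1" r])
    fix x y assume xy: "x \<in> cball a r" "y \<in> cball a r"
    show "norm (F x - F y) \<le> (norm (Df F a) + 1) * norm (x - y)"
    proof (rule differentiable_bound[where S="cball a r" and f'="\<lambda>x. blinfun_apply (Df F x)"])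
      fix x assume x: "x \<in> cball a r"
      show "(F has_derivative Df F x) (at x within cball a r)"
        using C1_on_D[OF assms(2)] x sub has_derivative_at_withinI by blast
      have "dist (Df F x) (Df F a) < 1" using x sub r by (intro r2) (auto simp: dist_commute)
      then show "onorm (Df F x) \<le> norm (Df F a) + 1"
        using norm_triangle_sub[of "Df F x" "Df F a"] by (simp add: dist_norm norm_blinfun.rep_eq[symmetric])
    qed (use xy in auto)
  qed (use r sub in auto)
qed

lemma ode_local_unique:
  fixes u1 u2 :: "real \<Rightarrow> 'a::real_normed_vector"
  assumes S: "open S" "C1_on S F" and r: "r > 0"
    and u1: "\<And>t. \<bar>t - t0\<bar> < r \<Longrightarrow> u1 t \<in> S \<and> (u1 has_vector_derivative F (u1 t)) (at t)"
    and u2: "\<And>t. \<bar>t - t0\<bar> < r \<Longrightarrow> u2 t \<in> S \<and> (u2 has_vector_derivative F (u2 t)) (at t)"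
    and eq: "u1 t0 = u2 t0"
  shows "\<exists>r'>0. \<forall>t. \<bar>t - t0\<bar> < r' \<longrightarrow> u1 t = u2 t"
proof -
  define a where "a = u1 t0"
  have "a \<in> S" using u1[of t0] r by (simp add: a_def)
  then obtain L \<rho> where L: "0 \<le> L" "\<rho> > 0" "cball a \<rho> \<subseteq> S"
    "\<And>x y. x \<in> cball a \<rho> \<Longrightarrow> y \<in> cball a \<rho> \<Longrightarrow> norm (F x - F y) \<le> L * norm (x - y)"
    using C1_on_locally_Lipschitz[OF S] by metis
  have near: "\<exists>d>0. \<forall>t. \<bar>t - t0\<bar> < d \<longrightarrow> u t \<in> cball a \<rho>"
    if "(u has_vector_derivative F (u t0)) (at t0)" "u t0 = a" for u
  proof -
    have "isCont u t0" using that(1) has_vector_derivative_continuous by blast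
    then obtain d where "d > 0" "\<And>t. dist t t0 < d \<Longrightarrow> dist (u t) (u t0) < \<rho>"
      unfolding continuous_at_eps_delta using L(2) by blast
    then show ?thesis using that(2) by (intro exI[of _ d]) (auto simp: dist_real_def dist_commute less_imp_le)
  qed
  have "(u1 has_vector_derivative F (u1 t0)) (at t0)" "(u2 has_vector_derivative F (u2 t0)) (at t0)"
    using u1[of t0] u2[of t0] r by simp_all
  with near[of u1] near[of u2] obtain d1 d2 where
    d1: "d1 > 0" "\<And>t. \<bar>t - t0\<bar> < d1 \<Longrightarrow> u1 t \<in> cball a \<rho>" and
    d2: "d2 > 0" "\<And>t. \<bar>t - t0\<bar> < d2 \<Longrightarrow> u2 t \<in> cball a \<rho>"
    unfolding a_def eq by blast
  define d where "d = min (min r (min d1 d2) / 2) (1 / (2 * (L + 1)))"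
  have d: "d > 0" "d < r" "d < d1" "d < d2" "d \<le> 1 / (2 * (L + 1))"
    using r d1 d2 L(1) by (auto simp: d_def min_def)
  have "d * L \<le> 1 / (2 * (L + 1)) * L" using d L by (intro mult_right_mono) auto
  also have "\<dots> \<le> 1/2" using L(1) by (simp add: field_simps)
  finally have dL: "d * L \<le> 1/2" .
  have "u1 t = u2 t" if t: "\<bar>t - t0\<bar> < d" for t
  proof -
    define e where "e s = u1 (t0 + s) - u2 (t0 + s)" for s
    have "norm (e (t - t0)) \<le> 2 * (norm (e 0) + d * 0)"
    proof (rule small_time_estimate[of d L e "\<lambda>s. F (u1 (t0 + s)) - F (u2 (t0 + s))"])
      fix s assume s: "s \<in> {-d..d}"
      have sh: "((\<lambda>s. u (t0 + s)) has_vector_derivative F (u (t0 + s))) (at s within {-d..d})"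
        if "(u has_vector_derivative F (u (t0 + s))) (at (t0 + s))" for u
      proof -
        have "((\<lambda>s. t0 + s) has_vector_derivative 1) (at s within {-d..d})"
          using has_vector_derivative_add[OF has_vector_derivative_const has_vector_derivative_id] by simp
        from vector_diff_chain_within[OF this has_vector_derivative_at_within[OF that]]
        have "(u \<circ> (\<lambda>s. t0 + s) has_vector_derivative 1 *\<^sub>R F (u (t0 + s))) (at s within {-d..d})" .
        then show ?thesis by (simp add: o_def)
      qed
      show "(e has_vector_derivative F (u1 (t0 + s)) - F (u2 (t0 + s))) (at s within {-d..d})"
        unfolding e_def using u1[of "t0 + s"] u2[of "t0 + s"] s d
        by (intro has_vector_derivative_diff sh) auto
      show "norm (F (u1 (t0 + s)) - F (u2 (t0 + s))) \<le> L * norm (e s) + 0"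
        unfolding e_def using L(4)[OF d1(2)[of "t0 + s"] d2(2)[of "t0 + s"]] s d by force
    qed (use t d L dL in auto)
    then show ?thesis by (simp add: e_def eq)
  qed
  then show ?thesis using d(1) by blast
qed

theorem local_flow:
  fixes F :: "'a::euclidean_space \<Rightarrow> 'a"
  assumes S: "open S" and F: "C1_on S F" and u0: "u0 \<in> S"
  shows "\<exists>d>0. \<exists>r>0. \<exists>\<psi> Z. ball u0 r \<subseteq> S \<and>
    (\<forall>u\<in>ball u0 r. \<psi> 0 u = u \<and> Z 0 u = id_blinfun \<and>
      (\<forall>t\<in>{-d<..<d}. \<psi> t u \<in> S \<and> ((\<lambda>t. \<psi> t u) has_vector_derivative F (\<psi> t u)) (at t) \<and>
         (\<forall>h. ((\<lambda>t. Z t u h) has_vector_derivative Df F (\<psi> t u) (Z t u h)) (at t)) \<and>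
         ((\<lambda>(t, u). \<psi> t u) has_derivative (\<lambda>(s, h). s *\<^sub>R F (\<psi> t u) + Z t u h)) (at (t, u)))) \<and>
    continuous_on ({-d<..<d} \<times> ball u0 r) (\<lambda>(t, u). Z t u)"
proof -
  obtain \<rho> where \<rho>: "\<rho> > 0" "cball u0 \<rho> \<subseteq> S" using S u0 open_contains_cball by blast
  define K where "K = cball u0 \<rho>"
  have K: "compact K" "convex K" "closed K" "K \<noteq> {}" "K \<subseteq> S" using \<rho> by (auto simp: K_def)
  have cDF: "continuous_on K (Df F)" and cF: "continuous_on K F"
    using continuous_on_subset[OF C1_on_cont_Df[OF F] K(5)] continuous_on_subset[OF C1_on_continuous[OF F] K(5)] by auto
  obtain L where L: "L > 0" "\<And>x. x \<in> K \<Longrightarrow> norm (Df F x) \<le> L"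
    using compact_imp_bounded[OF compact_continuous_image[OF cDF K(1)]] by (auto simp: bounded_pos)
  obtain C where C: "C > 0" "\<And>x. x \<in> K \<Longrightarrow> norm (F x) \<le> C"
    using compact_imp_bounded[OF compact_continuous_image[OF cF K(1)]] by (auto simp: bounded_pos)
  have FK: "(F has_derivative Df F x) (at x within X)" if "x \<in> K" for x X
    using C1_on_D[OF F] that K(5) has_derivative_at_withinI by blast
  have lipF: "norm (F x - F y) \<le> L * norm (x - y)" if "x \<in> K" "y \<in> K" for x y
    by (rule differentiable_bound[OF K(2) FK _ that]) (use L in \<open>auto simp: norm_blinfun.rep_eq[symmetric]\<close>)
  define P where "P = closest_point K"
  have P: "P x \<in> K" "x \<in> K \<Longrightarrow> P x = x" "norm (P x - P y) \<le> norm (x - y)" "continuous_on X P" for x y X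
    using closest_point_in_set[OF K(3,4)] closest_point_self closest_point_lipschitz[OF K(2,3,4)] continuous_on_closest_point[OF K(2,3,4)]
    by (auto simp: P_def dist_norm)
  define d where "d = min (1 / (2 * L)) (\<rho> / (2 * C))"
  have d: "d > 0" "d * L \<le> 1/2" "d * C \<le> \<rho> / 2"
  proof -
    show "d > 0" using L C \<rho> by (simp add: d_def)
    have "d * L \<le> 1 / (2 * L) * L" using L by (intro mult_right_mono) (auto simp: d_def)
    then show "d * L \<le> 1/2" using L by simp
    have "d * C \<le> \<rho> / (2 * C) * C" using C by (intro mult_right_mono) (auto simp: d_def)
    then show "d * C \<le> \<rho> / 2" using C by simp
  qed
  have "\<exists>w. w 0 = u \<and> (\<forall>t\<in>{-d..d}. (w has_vector_derivative F (P (w t))) (at t within {-d..d}))" for u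
  proof (rule picard[where G="\<lambda>t x. F (P x)" and L=L])
    fix w :: "real \<Rightarrow> 'a" assume w: "continuous_on {-d..d} w"
    show "continuous_on {-d..d} (\<lambda>s. F (P (w s)))"
      by (rule continuous_on_compose2[OF cF continuous_on_compose2[OF P(4)[of UNIV] w]]) (use P in auto)
  next
    show "norm (F (P a) - F (P b)) \<le> L * norm (a - b)" for a b
      by (rule order_trans[OF lipF[OF P(1) P(1)]]) (use L P(3) in auto)
  qed (use d L in auto)
  then obtain \<psi>' where \<psi>': "\<And>u. \<psi>' u 0 = u"
    "\<And>u t. t \<in> {-d..d} \<Longrightarrow> (\<psi>' u has_vector_derivative F (P (\<psi>' u t))) (at t within {-d..d})"
    by metis
  define \<psi> where "\<psi> t u = \<psi>' u t" for t u
  have \<psi>0: "\<psi> 0 u = u" for u by (simp add: \<psi>_def \<psi>')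
  have \<psi>d: "((\<lambda>t. \<psi> t u) has_vector_derivative F (P (\<psi> t u))) (at t within {-d..d})" if "t \<in> {-d..d}" for u t
    using \<psi>'(2)[OF that, of u] by (simp add: \<psi>_def)
  define r where "r = \<rho> / 2"
  have r: "r > 0" using \<rho> by (simp add: r_def)
  have \<psi>K: "\<psi> t u \<in> K" if "u \<in> ball u0 r" "t \<in> {-d..d}" for t u
  proof -
    have "norm (\<psi> t u - \<psi> 0 u) \<le> C * \<bar>t - 0\<bar>"
      by (rule vector_derivative_bound[OF _ \<psi>d]) (use P C that d in auto)
    also have "\<dots> \<le> C * d" using that C by (intro mult_left_mono) auto
    finally have "norm (\<psi> t u - u) \<le> \<rho> / 2" using d by (simp add: \<psi>0 mult.commute)
    moreover have "dist u0 u < \<rho> / 2" using that by (simp add: r_def)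
    ultimately have "dist u0 (\<psi> t u) \<le> \<rho>"
      using dist_triangle[of u0 "\<psi> t u" u] by (simp add: dist_norm norm_minus_commute)
    then show ?thesis by (simp add: K_def)
  qed
  have \<psi>F: "((\<lambda>t. \<psi> t u) has_vector_derivative F (\<psi> t u)) (at t within {-d..d})"
    if "u \<in> ball u0 r" "t \<in> {-d..d}" for u t
    using \<psi>d[OF that(2), of u] \<psi>K[OF that] P(2) by simp
  have \<psi>lip: "norm (\<psi> t u - \<psi> t v) \<le> 2 * norm (u - v)" if "t \<in> {-d..d}" for t u v
  proof -
    have "norm (\<psi> t u - \<psi> t v) \<le> 2 * (norm (\<psi> 0 u - \<psi> 0 v) + d * 0)"
      by (rule small_time_estimate[of d L _ "\<lambda>t. F (P (\<psi> t u)) - F (P (\<psi> t v))"])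
        (use d L that in \<open>auto intro!: has_vector_derivative_diff \<psi>d order_trans[OF lipF[OF P(1) P(1)]] P(3)\<close>)
    then show ?thesis by (simp add: \<psi>0)
  qed
  define A where "A t u = Df F (P (\<psi> t u))" for t u
  have A: "norm (A t u) \<le> L" for t u using L(2)[OF P(1)] by (simp add: A_def)
  have cA: "continuous_on {-d..d} (\<lambda>t. A t u)" for u
    unfolding A_def
    by (rule continuous_on_compose2[OF cDF continuous_on_compose2[OF P(4)[of UNIV] has_vector_derivative_imp_continuous_on[OF \<psi>d]]])
       (use P in auto)
  have AZ: "norm (A t u o\<^sub>L M) \<le> L * norm M" for t u and M :: "'a \<Rightarrow>\<^sub>L 'a"
    by (rule order_trans[OF norm_blinfun_compose]) (use A in \<open>auto intro!: mult_right_mono\<close>)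
  have "\<exists>w. w 0 = id_blinfun \<and> (\<forall>t\<in>{-d..d}. (w has_vector_derivative (A t u o\<^sub>L w t)) (at t within {-d..d}))" for u
  proof (rule picard[where G="\<lambda>t M. A t u o\<^sub>L M" and L=L])
    show "norm ((A s u o\<^sub>L a) - (A s u o\<^sub>L b)) \<le> L * norm (a - b)" for s and a b :: "'a \<Rightarrow>\<^sub>L 'a"
      using AZ[of s u "a - b"] by (simp add: bounded_bilinear.diff_right[OF bounded_bilinear_blinfun_compose])
  qed (use d L cA in \<open>auto intro!: continuous_intros\<close>)
  then obtain Z' where Z': "\<And>u. Z' u 0 = id_blinfun"
    "\<And>u t. t \<in> {-d..d} \<Longrightarrow> (Z' u has_vector_derivative (A t u o\<^sub>L Z' u t)) (at t within {-d..d})"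
    by metis
  define Z where "Z t u = Z' u t" for t u
  have Z0: "Z 0 u = id_blinfun" for u by (simp add: Z_def Z')
  have Zd: "((\<lambda>t. Z t u) has_vector_derivative (A t u o\<^sub>L Z t u)) (at t within {-d..d})" if "t \<in> {-d..d}" for u t
    using Z'(2)[OF that, of u] by (simp add: Z_def)
  have Zb: "norm (Z t u) \<le> 2" if "t \<in> {-d..d}" for t u
  proof -
    have "norm (Z t u) \<le> 2 * (norm (Z 0 u) + d * 0)"
      by (rule small_time_estimate[OF _ _ d(2) Zd _ that]) (use d L AZ in auto)
    moreover have "norm (Z 0 u) \<le> 1" by (simp add: Z0 norm_blinfun_id_le)
    ultimately show ?thesis by simp
  qed
  have uc: "\<exists>\<delta>>0. \<forall>x\<in>K. \<forall>y\<in>K. norm (x - y) < \<delta> \<longrightarrow> norm (Df F x - Df F y) < \<eta>" if "\<eta> > 0" for \<eta>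
    using compact_uniformly_continuous[OF cDF K(1)] that unfolding uniformly_continuous_on_def
    by (simp add: dist_norm norm_minus_commute)
  have Zuc: "\<exists>\<delta>>0. \<forall>u v. \<forall>t\<in>{-d..d}. norm (u - v) < \<delta> \<longrightarrow> norm (Z t u - Z t v) \<le> \<eta>" if \<eta>: "\<eta> > 0" for \<eta>
  proof -
    have "\<eta> / (4 * d) > 0" using \<eta> d by simp
    then obtain \<delta> where \<delta>: "\<delta> > 0" "\<And>x y. x \<in> K \<Longrightarrow> y \<in> K \<Longrightarrow> norm (x - y) < \<delta> \<Longrightarrow> norm (Df F x - Df F y) < \<eta> / (4 * d)"
      using uc by meson
    have "norm (Z t u - Z t v) \<le> \<eta>" if uv: "norm (u - v) < \<delta> / 2" and t: "t \<in> {-d..d}" for u v t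
    proof -
      have "norm (Z t u - Z t v) \<le> 2 * (norm (Z 0 u - Z 0 v) + d * (\<eta> / (4 * d) * 2))"
      proof (rule small_time_estimate[OF _ _ d(2) has_vector_derivative_diff[OF Zd Zd] _ t])
        fix s assume s: "s \<in> {-d..d}"
        have "norm (P (\<psi> s u) - P (\<psi> s v)) < \<delta>"
          using P(3)[of "\<psi> s u" "\<psi> s v"] \<psi>lip[OF s, of u v] uv by linarith
        then have "norm (A s u - A s v) \<le> \<eta> / (4 * d)" unfolding A_def by (intro less_imp_le \<delta>(2) P)
        then have z2: "norm ((A s u - A s v) o\<^sub>L Z s v) \<le> \<eta> / (4 * d) * 2"
          using \<eta> d by (intro order_trans[OF norm_blinfun_compose] mult_mono Zb s) auto
        have eq: "(A s u o\<^sub>L Z s u) - (A s v o\<^sub>L Z s v) = (A s u o\<^sub>L (Z s u - Z s v)) + ((A s u - A s v) o\<^sub>L Z s v)"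
          by (rule blinfun_eqI) (simp add: blinfun.bilinear_simps)
        show "norm ((A s u o\<^sub>L Z s u) - (A s v o\<^sub>L Z s v)) \<le> L * norm (Z s u - Z s v) + \<eta> / (4 * d) * 2"
          unfolding eq by (rule norm_triangle_mono[OF AZ z2])
      qed (use d L in auto)
      then show ?thesis using d by (simp add: Z0)
    qed
    then show ?thesis using \<delta>(1) by (intro exI[of _ "\<delta> / 2"]) auto
  qed
  have cZ: "continuous_on ({-d<..<d} \<times> ball u0 r) (\<lambda>(t, u). Z t u)"
    unfolding continuous_on_iff
  proof (intro ballI allI impI)
    fix p and \<eta> :: real assume p: "p \<in> {-d<..<d} \<times> ball u0 r" and \<eta>: "\<eta> > 0"
    obtain t u where [simp]: "p = (t, u)" by force
    obtain \<delta> where \<delta>: "\<delta> > 0" "\<And>u v t. t \<in> {-d..d} \<Longrightarrow> norm (u - v) < \<delta> \<Longrightarrow> norm (Z t u - Z t v) \<le> \<eta> / 2"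
      using Zuc[of "\<eta> / 2"] \<eta> by auto
    define \<delta>' where "\<delta>' = min \<delta> (\<eta> / (8 * L))"
    have "\<delta>' > 0" using \<delta> \<eta> L by (simp add: \<delta>'_def)
    moreover have "dist (case q of (t, u) \<Rightarrow> Z t u) (case p of (t, u) \<Rightarrow> Z t u) < \<eta>"
      if q: "q \<in> {-d<..<d} \<times> ball u0 r" "dist q p < \<delta>'" for q
    proof -
      obtain s v where [simp]: "q = (s, v)" by force
      have 1: "norm (v - u) < \<delta>" and 2: "\<bar>s - t\<bar> \<le> \<eta> / (8 * L)"
        using dist_snd_le[of q p] dist_fst_le[of q p] q(2) by (auto simp: \<delta>'_def dist_norm)
      have "norm (Z s v - Z t v) \<le> (L * 2) * \<bar>s - t\<bar>"
        by (rule vector_derivative_bound[of "{-d..d}", OF _ Zd])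
          (use p q L Zb in \<open>auto intro!: order_trans[OF AZ] mult_left_mono\<close>)
      also have "\<dots> \<le> (L * 2) * (\<eta> / (8 * L))" using 2 L by (intro mult_left_mono) auto
      also have "\<dots> < \<eta> / 2" using L \<eta> by simp
      finally have "norm (Z s v - Z t v) < \<eta> / 2" .
      moreover have "norm (Z t v - Z t u) \<le> \<eta> / 2" using 1 p by (intro \<delta>) auto
      ultimately show ?thesis using norm_triangle_ineq[of "Z s v - Z t v" "Z t v - Z t u"] by (simp add: dist_norm)
    qed
    ultimately show "\<exists>\<delta>>0. \<forall>q\<in>{-d<..<d} \<times> ball u0 r. dist q p < \<delta> \<longrightarrow>
      dist (case q of (t, u) \<Rightarrow> Z t u) (case p of (t, u) \<Rightarrow> Z t u) < \<eta>" by blast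
  qed
  have \<psi>u: "((\<lambda>u. \<psi> t u) has_derivative Z t u) (at u)" if t: "t \<in> {-d..d}" and u: "u \<in> ball u0 r" for t u
    unfolding has_derivative_at_alt
  proof (intro conjI allI impI)
    fix \<eta> :: real assume \<eta>: "\<eta> > 0"
    have "\<eta> / (4 * d) > 0" using \<eta> d by simp
    then obtain \<delta> where \<delta>: "\<delta> > 0" "\<And>x y. x \<in> K \<Longrightarrow> y \<in> K \<Longrightarrow> norm (x - y) < \<delta> \<Longrightarrow> norm (Df F x - Df F y) < \<eta> / (4 * d)"
      using uc by meson
    obtain \<delta>2 where \<delta>2: "\<delta>2 > 0" "ball u \<delta>2 \<subseteq> ball u0 r" using u open_ball open_contains_ball[of "ball u0 r"] by meson
    have "norm (\<psi> t v - \<psi> t u - Z t u (v - u)) \<le> \<eta> * norm (v - u)" if v: "norm (v - u) < min (\<delta> / 2) \<delta>2" for v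
    proof -
      have vb: "v \<in> ball u0 r" using \<delta>2(2) v by (auto simp: subset_iff dist_norm norm_minus_commute)
      have "norm (\<psi> t v - \<psi> t u - Z t u (v - u)) \<le>
        2 * (norm (\<psi> 0 v - \<psi> 0 u - Z 0 u (v - u)) + d * (2 * norm (v - u) * (\<eta> / (4 * d))))"
      proof (rule small_time_estimate[where e'="\<lambda>s. F (\<psi> s v) - F (\<psi> s u) - A s u (Z s u (v - u))", OF _ _ d(2) _ _ t])
        fix s assume s: "s \<in> {-d..d}"
        have "((\<lambda>t. Z t u (v - u)) has_vector_derivative A s u (Z s u (v - u))) (at s within {-d..d})"
          using bounded_linear.has_vector_derivative[OF blinfun.bounded_linear_left Zd[OF s, of u]] by simp
        then show "((\<lambda>t. \<psi> t v - \<psi> t u - Z t u (v - u)) has_vector_derivative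
             F (\<psi> s v) - F (\<psi> s u) - A s u (Z s u (v - u))) (at s within {-d..d})"
          by (intro has_vector_derivative_diff \<psi>F s u vb)
        define a b where "a = \<psi> s u" and "b = \<psi> s v"
        have ab: "a \<in> K" "b \<in> K" and nab: "norm (b - a) \<le> 2 * norm (v - u)"
          using \<psi>K u vb s \<psi>lip by (auto simp: a_def b_def)
        have "norm (F b - F a - Df F a (b - a)) \<le> norm (b - a) * (\<eta> / (4 * d))"
        proof (rule differentiable_bound_linearization[where S="K \<inter> ball a \<delta>" and f'="\<lambda>x. blinfun_apply (Df F x)"])
          fix \<tau> :: real assume \<tau>: "\<tau> \<in> {0..1}"
          have "(1 - \<tau>) *\<^sub>R a + \<tau> *\<^sub>R b \<in> K" by (rule convexD[OF K(2) ab]) (use \<tau> in auto)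
          moreover have "\<tau> * norm (b - a) \<le> 1 * norm (b - a)" using \<tau> by (intro mult_right_mono) auto
          moreover have "a + \<tau> *\<^sub>R (b - a) = (1 - \<tau>) *\<^sub>R a + \<tau> *\<^sub>R b" by (simp add: algebra_simps)
          moreover have "dist a (a + \<tau> *\<^sub>R (b - a)) = \<tau> * norm (b - a)" using \<tau> by (simp add: dist_norm)
          ultimately show "a + \<tau> *\<^sub>R (b - a) \<in> K \<inter> ball a \<delta>"
            using nab v by simp
        next
          fix x assume x: "x \<in> K \<inter> ball a \<delta>"
          then show "(F has_derivative Df F x) (at x within K \<inter> ball a \<delta>)" by (intro FK) auto
          have "norm (Df F x - Df F a) < \<eta> / (4 * d)" using x ab by (intro \<delta>) (auto simp: dist_norm norm_minus_commute)
          then show "onorm (blinfun_apply (Df F x) - blinfun_apply (Df F a)) \<le> \<eta> / (4 * d)"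
            by (simp add: norm_blinfun.rep_eq minus_blinfun.rep_eq fun_diff_def)
        qed (use ab \<delta> in auto)
        also have "\<dots> \<le> 2 * norm (v - u) * (\<eta> / (4 * d))" using nab \<eta> d by (intro mult_right_mono) auto
        finally have 1: "norm (F b - F a - Df F a (b - a)) \<le> 2 * norm (v - u) * (\<eta> / (4 * d))" .
        have Aa: "A s u = Df F a" using ab P(2) by (simp add: A_def a_def)
        have 2: "norm (Df F a (b - a - Z s u (v - u))) \<le> L * norm (b - a - Z s u (v - u))"
          by (rule order_trans[OF norm_blinfun]) (use L ab in \<open>auto intro!: mult_right_mono\<close>)
        have eq: "F b - F a - A s u (Z s u (v - u)) = Df F a (b - a - Z s u (v - u)) + (F b - F a - Df F a (b - a))"
          by (simp add: Aa blinfun.bilinear_simps)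
        show "norm (F (\<psi> s v) - F (\<psi> s u) - A s u (Z s u (v - u))) \<le>
           L * norm (\<psi> s v - \<psi> s u - Z s u (v - u)) + 2 * norm (v - u) * (\<eta> / (4 * d))"
          unfolding a_def[symmetric] b_def[symmetric] eq by (rule norm_triangle_mono[OF 2 1])
      qed (use d L in auto)
      then show ?thesis using d by (simp add: \<psi>0 Z0 mult.commute)
    qed
    then show "\<exists>d>0. \<forall>y. norm (y - u) < d \<longrightarrow> norm (\<psi> t y - \<psi> t u - Z t u (y - u)) \<le> \<eta> * norm (y - u)"
      using \<delta> \<delta>2 by (intro exI[of _ "min (\<delta> / 2) \<delta>2"]) auto
  qed (simp add: blinfun.bounded_linear_right)
  have inner: "at t within {-d..d} = at t" if "t \<in> {-d<..<d}" for t
    using that by (intro at_within_interior) (auto simp: interior_atLeastAtMost_real)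
  show ?thesis
  proof (intro exI conjI ballI allI)
    fix u t assume u: "u \<in> ball u0 r" and t: "t \<in> {-d<..<d}"
    then have t': "t \<in> {-d..d}" by auto
    show hd: "((\<lambda>t. \<psi> t u) has_vector_derivative F (\<psi> t u)) (at t)" using \<psi>F[OF u t'] inner[OF t] by simp
    show "\<psi> t u \<in> S" using \<psi>K[OF u t'] K by auto
    have "((\<lambda>t. Z t u h) has_vector_derivative A t u (Z t u h)) (at t)" for h
      using bounded_linear.has_vector_derivative[OF blinfun.bounded_linear_left Zd[OF t', of u]] inner[OF t] by simp
    then show "((\<lambda>t. Z t u h) has_vector_derivative Df F (\<psi> t u) (Z t u h)) (at t)" for h
      using \<psi>K[OF u t'] P(2) by (simp add: A_def)
    have "((\<lambda>(t, u). \<psi> t u) has_derivative (\<lambda>(s, h). s *\<^sub>R F (\<psi> t u) + Z t u h)) (at (t, u) within {-d<..<d} \<times> ball u0 r)"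
    proof (rule has_derivative_partialsI)
      show "((\<lambda>t. \<psi> t u) has_derivative (\<lambda>s. s *\<^sub>R F (\<psi> t u))) (at t within {-d<..<d})"
        using hd by (simp add: has_vector_derivative_def has_derivative_at_withinI)
      show "((\<lambda>u. \<psi> t u) has_derivative Z t u) (at u within ball u0 r)" if "t \<in> {-d<..<d}" "u \<in> ball u0 r" for t u
        using \<psi>u[of t u] that by (auto intro: has_derivative_at_withinI)
      show "continuous (at (t, u) within {-d<..<d} \<times> ball u0 r) (\<lambda>(t, u). Z t u)"
        using cZ u t by (auto simp: continuous_on_eq_continuous_within)
    qed (use u in auto)
    then show "((\<lambda>(t, u). \<psi> t u) has_derivative (\<lambda>(s, h). s *\<^sub>R F (\<psi> t u) + Z t u h)) (at (t, u))"
      using at_within_open[of "(t, u)" "{-d<..<d} \<times> ball u0 r"] u t by (auto simp: open_Times)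
  next
    show "ball u0 r \<subseteq> S" using \<rho> by (auto simp: r_def)
  qed (use d r cZ \<psi>0 Z0 in auto)
qed

section \<open>Charts and the tangent bundle\<close>

locale surface =
  fixes A :: "'m::t2_space chart set" and g :: "'m metric"
  assumes surf: "closed_oriented_surface A" and met: "riemannian_metric A g"
begin

definition overlap :: "'m chart \<Rightarrow> 'm chart \<Rightarrow> (real^2) set" where
  "overlap c d = chart_map c ` (chart_dom c \<inter> chart_dom d)"

definition dtrans :: "'m chart \<Rightarrow> 'm chart \<Rightarrow> real^2 \<Rightarrow> real^2 \<Rightarrow> real^2" where
  "dtrans c d y = frechet_derivative (transition c d) (at y)"

definition btrans :: "'m chart \<Rightarrow> 'm chart \<Rightarrow> (real^2) \<times> (real^2) \<Rightarrow> (real^2) \<times> (real^2)" where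
  "btrans c d u = (transition c d (fst u), dtrans c d (fst u) (snd u))"

definition B :: "'m chart \<Rightarrow> real^2 \<Rightarrow> real^2 \<Rightarrow> real^2 \<Rightarrow> real" where
  "B c y u v = inner u (metric_coeff A g c y *v v)"

lemma atlas: "oriented_atlas A" and compact_UNIV_surface: "compact (UNIV :: 'm set)"
  using surf by (auto simp: closed_oriented_surface_def)

lemma chart:
  assumes "c \<in> A"
  shows open_chart_dom: "open (chart_dom c)" and open_chart_codom: "open (chart_codom c)"
    and chart_homeo: "homeomorphism (chart_dom c) (chart_codom c) (chart_map c) (chart_inv c)"
  using atlas assms by (auto simp: oriented_atlas_def)

lemma chart_inv_map: "c \<in> A \<Longrightarrow> x \<in> chart_dom c \<Longrightarrow> chart_inv c (chart_map c x) = x"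
  using chart_homeo by (simp add: homeomorphism_def)

lemma chart_map_inv: "c \<in> A \<Longrightarrow> y \<in> chart_codom c \<Longrightarrow> chart_map c (chart_inv c y) = y"
  by (erule imageE) (simp add: chart_inv_map)

lemma chart_inv_in: "c \<in> A \<Longrightarrow> y \<in> chart_codom c \<Longrightarrow> chart_inv c y \<in> chart_dom c"
  by (erule imageE) (simp add: chart_inv_map)

lemma chart_map_cont: "c \<in> A \<Longrightarrow> continuous_on (chart_dom c) (chart_map c)"
  and chart_inv_cont: "c \<in> A \<Longrightarrow> continuous_on (chart_codom c) (chart_inv c)"
  using chart_homeo by (auto simp: homeomorphism_def)

lemma chart_at: "chart_at A x \<in> A" "x \<in> chart_dom (chart_at A x)"
proof -
  have "x \<in> (\<Union>c\<in>A. chart_dom c)" using atlas by (simp add: oriented_atlas_def)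
  then have "\<exists>c. c \<in> A \<and> x \<in> chart_dom c" by blast
  then have "chart_at A x \<in> A \<and> x \<in> chart_dom (chart_at A x)"
    unfolding chart_at_def by (rule someI_ex)
  then show "chart_at A x \<in> A" "x \<in> chart_dom (chart_at A x)" by auto
qed

lemma mem_overlap: "c \<in> A \<Longrightarrow> y \<in> overlap c d \<longleftrightarrow> y \<in> chart_codom c \<and> chart_inv c y \<in> chart_dom d"
  unfolding overlap_def by (auto simp: chart_inv_map)

lemma overlapI: "x \<in> chart_dom c \<Longrightarrow> x \<in> chart_dom d \<Longrightarrow> chart_map c x \<in> overlap c d"
  by (auto simp: overlap_def)

lemma overlap_codom: "c \<in> A \<Longrightarrow> y \<in> overlap c d \<Longrightarrow> y \<in> chart_codom c"
  by (simp add: mem_overlap)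

lemma open_overlap:
  assumes "c \<in> A" "d \<in> A" shows "open (overlap c d)"
proof -
  have "overlap c d = chart_codom c \<inter> chart_inv c -` chart_dom d"
    using mem_overlap[OF assms(1)] by blast
  then show ?thesis
    using continuous_open_preimage[OF chart_inv_cont[OF assms(1)] open_chart_codom[OF assms(1)] open_chart_dom[OF assms(2)]]
    by simp
qed

lemma transition_smooth: "c \<in> A \<Longrightarrow> d \<in> A \<Longrightarrow> smooth_on (overlap c d) (transition c d)"
  and det_dtrans_pos: "c \<in> A \<Longrightarrow> d \<in> A \<Longrightarrow> y \<in> overlap c d \<Longrightarrow> det (matrix (dtrans c d y)) > 0"
  using atlas by (auto simp: oriented_atlas_def overlap_def dtrans_def)

lemma transition_eq: "transition c d y = chart_map d (chart_inv c y)"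
  by (simp add: transition_def)

lemma transition_map: "c \<in> A \<Longrightarrow> x \<in> chart_dom c \<Longrightarrow> transition c d (chart_map c x) = chart_map d x"
  by (simp add: transition_eq chart_inv_map)

lemma chart_inv_transition:
  "c \<in> A \<Longrightarrow> d \<in> A \<Longrightarrow> y \<in> overlap c d \<Longrightarrow> chart_inv d (transition c d y) = chart_inv c y"
  by (simp add: transition_eq mem_overlap chart_inv_map)

lemma transition_overlap:
  "c \<in> A \<Longrightarrow> d \<in> A \<Longrightarrow> y \<in> overlap c d \<Longrightarrow> transition c d y \<in> overlap d c"
  by (simp add: mem_overlap chart_inv_transition chart_inv_in) (simp add: transition_eq)

lemma transition_compose:
  "c \<in> A \<Longrightarrow> d \<in> A \<Longrightarrow> y \<in> overlap c d \<Longrightarrow> transition d e (transition c d y) = transition c e y"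
  by (simp add: transition_eq[of d] chart_inv_transition) (simp add: transition_eq)

lemma transition_self: "c \<in> A \<Longrightarrow> y \<in> chart_codom c \<Longrightarrow> transition c c y = y"
  by (simp add: transition_eq chart_map_inv)

lemma transition_deriv:
  assumes "c \<in> A" "d \<in> A" "y \<in> overlap c d"
  shows "(transition c d has_derivative dtrans c d y) (at y)"
  unfolding dtrans_def using smooth_on_C1_on[OF transition_smooth[OF assms(1,2)]] assms(3)
  by (simp add: C1_on_def frechet_derivative_works)

lemma linear_dtrans: "c \<in> A \<Longrightarrow> d \<in> A \<Longrightarrow> y \<in> overlap c d \<Longrightarrow> linear (dtrans c d y)"
  using transition_deriv has_derivative_linear by blast

lemma dtrans_compose:
  assumes "c \<in> A" "d \<in> A" "e \<in> A" "y \<in> overlap c d" "y \<in> overlap c e"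
  shows "dtrans d e (transition c d y) (dtrans c d y w) = dtrans c e y w"
proof -
  have de: "transition c d y \<in> overlap d e"
    using overlap_codom[OF assms(2) transition_overlap[OF assms(1,2,4)]] assms(5)
    by (simp add: mem_overlap[OF assms(2)] mem_overlap[OF assms(1)] chart_inv_transition[OF assms(1,2,4)])
  have "((\<lambda>y. transition d e (transition c d y)) has_derivative (\<lambda>w. dtrans d e (transition c d y) (dtrans c d y w))) (at y)"
    by (rule has_derivative_compose[OF transition_deriv transition_deriv]) (use assms de in auto)
  then have "(transition c e has_derivative (\<lambda>w. dtrans d e (transition c d y) (dtrans c d y w))) (at y)"
    by (rule has_derivative_transform_within_open[OF _ open_overlap[OF assms(1,2)] assms(4)])
      (use assms transition_compose in auto)
  from has_derivative_unique[OF this transition_deriv[OF assms(1,3,5)]] show ?thesis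
    by (rule fun_cong)
qed

lemma overlap_self: "c \<in> A \<Longrightarrow> overlap c c = chart_codom c" by (auto simp: overlap_def)

lemma dtrans_self:
  assumes "c \<in> A" "y \<in> chart_codom c" shows "dtrans c c y w = w"
proof -
  have "(transition c c has_derivative (\<lambda>w. w)) (at y)"
    by (rule has_derivative_transform_within_open[OF has_derivative_ident open_chart_codom[OF assms(1)] assms(2)])
      (use assms transition_self in auto)
  from has_derivative_unique[OF this transition_deriv[OF assms(1,1)]] show ?thesis
    using assms overlap_self[OF assms(1)] by metis
qed

lemma dtrans_inverse:
  assumes "c \<in> A" "d \<in> A" "y \<in> overlap c d"
  shows "dtrans d c (transition c d y) (dtrans c d y w) = w"
  using dtrans_compose[OF assms(1,2,1,3), of w] dtrans_self[OF assms(1)] assms overlap_codom overlap_self by simp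

lemma dtrans_surj:
  assumes "c \<in> A" "d \<in> A" "y \<in> overlap c d"
  shows "dtrans c d y (dtrans d c (transition c d y) w) = w"
  using dtrans_inverse[OF assms(2,1) transition_overlap[OF assms], of w] transition_compose[OF assms, of c]
    transition_self[OF assms(1) overlap_codom[OF assms(1,3)]] by simp

lemma tangent_point_eq:
  "tangent_point A c (y, w) = (chart_inv c y, dtrans c (chart_at A (chart_inv c y)) y w)"
  by (simp add: tangent_point_def dtrans_def)

lemma tangent_coord_eq:
  "tangent_coord A c (x, \<xi>) = (chart_map c x, dtrans (chart_at A x) c (chart_map (chart_at A x) x) \<xi>)"
  by (simp add: tangent_coord_def dtrans_def)

lemma fst_tangent_point: "fst (tangent_point A c u) = chart_inv c (fst u)"
  by (cases u) (simp add: tangent_point_eq)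

lemma fst_tangent_coord: "fst (tangent_coord A c v) = chart_map c (fst v)"
  by (cases v) (simp add: tangent_coord_eq)

lemma tangent_coord_point:
  assumes "c \<in> A" "fst u \<in> chart_codom c"
  shows "tangent_coord A c (tangent_point A c u) = u"
proof -
  obtain y w where u: "u = (y, w)" by force
  define x where "x = chart_inv c y"
  have x: "x \<in> chart_dom c" "y = chart_map c x" "y \<in> overlap c (chart_at A x)"
    using assms chart_inv_in chart_map_inv chart_at by (auto simp: x_def u mem_overlap)
  have "dtrans (chart_at A x) c (transition c (chart_at A x) y) (dtrans c (chart_at A x) y w) = w"
    by (rule dtrans_inverse) (use assms chart_at x in auto)
  moreover have "transition c (chart_at A x) y = chart_map (chart_at A x) x"
    by (simp add: transition_eq x_def)
  ultimately show ?thesis using x assms chart_inv_map[of c x] by (simp add: u tangent_point_eq tangent_coord_eq)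
qed

lemma tangent_point_coord:
  assumes "c \<in> A" "fst v \<in> chart_dom c"
  shows "tangent_point A c (tangent_coord A c v) = v"
proof -
  obtain x \<xi> where v: "v = (x, \<xi>)" by force
  have x: "x \<in> chart_dom c" using assms v by simp
  define d where "d = chart_at A x"
  have d: "d \<in> A" "x \<in> chart_dom d" using chart_at by (auto simp: d_def)
  have "dtrans c d (transition d c (chart_map d x)) (dtrans d c (chart_map d x) \<xi>) = \<xi>"
    by (rule dtrans_inverse) (use assms d x overlapI in auto)
  then show ?thesis using d x assms by (simp add: v tangent_point_eq tangent_coord_eq chart_inv_map transition_map flip: d_def)
qed

lemma tangent_coord_trans:
  assumes "c \<in> A" "d \<in> A" "fst v \<in> chart_dom c" "fst v \<in> chart_dom d"
  shows "tangent_coord A d v = btrans c d (tangent_coord A c v)"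
proof -
  obtain x \<xi> where v: "v = (x, \<xi>)" by force
  define e where "e = chart_at A x"
  have e: "e \<in> A" "x \<in> chart_dom e" using chart_at by (auto simp: e_def)
  have "dtrans c d (transition e c (chart_map e x)) (dtrans e c (chart_map e x) \<xi>) = dtrans e d (chart_map e x) \<xi>"
    by (rule dtrans_compose) (use assms e v overlapI in auto)
  then show ?thesis using e assms
    by (simp add: v btrans_def tangent_coord_eq transition_map flip: e_def)
qed

lemma tangent_point_trans:
  assumes "c \<in> A" "d \<in> A" "fst u \<in> overlap c d"
  shows "tangent_point A d (btrans c d u) = tangent_point A c u"
proof -
  have 1: "fst u \<in> chart_codom c" "chart_inv c (fst u) \<in> chart_dom d" "chart_inv c (fst u) \<in> chart_dom c"
    using assms mem_overlap chart_inv_in by auto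
  have "btrans c d u = tangent_coord A d (tangent_point A c u)"
    using tangent_coord_trans[OF assms(1,2), of "tangent_point A c u"] tangent_coord_point[OF assms(1)] 1
    by (simp add: fst_tangent_point)
  then show ?thesis using tangent_point_coord[OF assms(2), of "tangent_point A c u"] 1 by (simp add: fst_tangent_point)
qed

section \<open>The metric in coordinates\<close>

lemma g_bilinear: "bilinear (g x)" and g_sym: "g x \<xi> \<eta> = g x \<eta> \<xi>" and g_pos: "\<xi> \<noteq> 0 \<Longrightarrow> g x \<xi> \<xi> > 0"
  and metric_smooth: "c \<in> A \<Longrightarrow> smooth_on (chart_codom c) (metric_coeff A g c)"
  using met by (auto simp: riemannian_metric_def)

lemma vec2_expand: "(v :: real^2) = v $ 1 *\<^sub>R axis 1 1 + v $ 2 *\<^sub>R axis 2 (1::real)"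
  by (simp add: vec_eq_iff forall_2 axis_def)

lemma B_tangent_point:
  assumes "c \<in> A" "y \<in> chart_codom c"
  shows "B c y u v = g (chart_inv c y) (snd (tangent_point A c (y, u))) (snd (tangent_point A c (y, v)))"
proof -
  define T where "T = dtrans c (chart_at A (chart_inv c y)) y"
  have "y \<in> overlap c (chart_at A (chart_inv c y))" using assms chart_at by (auto simp: mem_overlap)
  then have T: "linear T" unfolding T_def using assms chart_at linear_dtrans by blast
  have g: "bilinear (g (chart_inv c y))" by (rule g_bilinear)
  have Te: "T w = w $ 1 *\<^sub>R T (axis 1 1) + w $ 2 *\<^sub>R T (axis 2 1)" for w
    by (subst vec2_expand[of w]) (simp add: linear_add[OF T] linear_scale[OF T])
  have "g (chart_inv c y) (T u) (T v) = B c y u v"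
    by (subst Te[of u], subst Te[of v])
      (simp add: B_def metric_coeff_def tangent_point_eq inner_vec_def matrix_vector_mult_def sum_2
        bilinear_ladd[OF g] bilinear_radd[OF g] bilinear_lmul[OF g] bilinear_rmul[OF g] algebra_simps flip: T_def)
  then show ?thesis by (simp add: tangent_point_eq T_def)
qed

lemma B_trans:
  assumes "c \<in> A" "d \<in> A" "y \<in> overlap c d"
  shows "B d (transition c d y) (dtrans c d y u) (dtrans c d y v) = B c y u v"
  using tangent_point_trans[OF assms(1,2), of "(y, u)"] tangent_point_trans[OF assms(1,2), of "(y, v)"] assms
    overlap_codom transition_overlap[OF assms]
  by (simp add: B_tangent_point chart_inv_transition btrans_def)

lemma B_bilinear: "bilinear (B c y)"
  unfolding B_def bilinear_def
  by (auto intro!: linearI simp: matrix_vector_right_distrib inner_add_right inner_add_left matrix_vector_mult_scaleR)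

lemmas B_simps = bilinear_ladd[OF B_bilinear] bilinear_radd[OF B_bilinear] bilinear_lmul[OF B_bilinear]
  bilinear_rmul[OF B_bilinear] bilinear_lzero[OF B_bilinear] bilinear_rzero[OF B_bilinear] bilinear_lneg[OF B_bilinear]
  bilinear_rneg[OF B_bilinear] bilinear_lsub[OF B_bilinear] bilinear_rsub[OF B_bilinear]

lemma B_sym: "c \<in> A \<Longrightarrow> y \<in> chart_codom c \<Longrightarrow> B c y u v = B c y v u"
  by (simp add: B_tangent_point g_sym)

lemma B_pos:
  assumes "c \<in> A" "y \<in> chart_codom c" "u \<noteq> 0"
  shows "B c y u u > 0"
proof -
  have "snd (tangent_point A c (y, u)) \<noteq> 0"
  proof
    assume 0: "snd (tangent_point A c (y, u)) = 0"
    have l: "linear (dtrans (chart_at A (chart_inv c y)) c (chart_map (chart_at A (chart_inv c y)) (chart_inv c y)))"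
      using assms chart_at chart_inv_in by (intro linear_dtrans overlapI) auto
    have "tangent_coord A c (tangent_point A c (y, u)) = (y, u)" using assms tangent_coord_point by simp
    then have "snd (tangent_coord A c (chart_inv c y, 0)) = u"
      using 0 fst_tangent_point[of c "(y, u)"] by (metis fst_conv prod.collapse snd_conv)
    then show False using assms linear_0[OF l] by (simp add: tangent_coord_eq)
  qed
  then show ?thesis using assms by (simp add: B_tangent_point g_pos)
qed

lemma B_eqI:
  assumes "c \<in> A" "y \<in> chart_codom c" "\<And>v. B c y u v = B c y u' v"
  shows "u = u'"
  using B_pos[OF assms(1,2), of "u - u'"] assms(3)[of "u - u'"] by (auto simp: B_simps)

lemma metric_nth: "metric_coeff A g c y $ i $ j = B c y (axis i 1) (axis j 1)"
  by (simp add: B_def matrix_vector_mul_component inner_axis' inner_axis inner_axis_axis row_def)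

lemma metric_sym: "c \<in> A \<Longrightarrow> y \<in> chart_codom c \<Longrightarrow> metric_coeff A g c y $ i $ j = metric_coeff A g c y $ j $ i"
  by (simp add: metric_nth B_sym)

lemma B_expand: "B c y u v = metric_coeff A g c y $ 1 $ 1 * u $ 1 * v $ 1 + metric_coeff A g c y $ 1 $ 2 * u $ 1 * v $ 2
   + metric_coeff A g c y $ 2 $ 1 * u $ 2 * v $ 1 + metric_coeff A g c y $ 2 $ 2 * u $ 2 * v $ 2"
  by (simp add: B_def inner_vec_def matrix_vector_mult_def sum_2 algebra_simps)

lemma det_metric_pos:
  assumes "c \<in> A" "y \<in> chart_codom c"
  shows "det (metric_coeff A g c y) > 0"
proof -
  define a b d where "a = metric_coeff A g c y $ 1 $ 1" and "b = metric_coeff A g c y $ 1 $ 2" and "d = metric_coeff A g c y $ 2 $ 2"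
  have b: "metric_coeff A g c y $ 2 $ 1 = b" using metric_sym[OF assms] by (simp add: a_def b_def d_def)
  have "(vector [1, 0] :: real^2) \<noteq> 0" by (simp add: vec_eq_iff forall_2)
  from B_pos[OF assms this] have a: "a > 0" by (simp add: B_expand a_def b_def d_def)
  have "(vector [- b, a] :: real^2) \<noteq> 0" using a by (simp add: vec_eq_iff forall_2)
  from B_pos[OF assms this] have "a * (a * d - b * b) > 0" by (simp add: B_expand b flip: a_def b_def d_def) (simp add: algebra_simps)
  then show ?thesis using a by (simp add: det_2 b zero_less_mult_iff flip: a_def b_def d_def)
qed

end

section \<open>The Levi-Civita connection and the complex structure in coordinates\<close>

lemma matrix_inv_2x2:
  fixes M :: "real^2^2"
  assumes "det M \<noteq> 0"
  shows "M ** matrix_inv M = mat 1"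
    and "matrix_inv M $ k $ l = (if k = l then (if k = 1 then M $ 2 $ 2 else M $ 1 $ 1) else - M $ k $ l) / det M"
proof -
  define N :: "real^2^2" where
    "N = (\<chi> k l. (if k = l then (if k = 1 then M $ 2 $ 2 else M $ 1 $ 1) else - M $ k $ l) / det M)"
  have MN: "M ** N = mat 1"
    using assms by (simp add: vec_eq_iff forall_2 matrix_matrix_mult_def mat_def sum_2 N_def det_2 divide_simps)
  have "\<exists>M'. M ** M' = mat 1 \<and> M' ** M = mat 1"
    using assms invertible_det_nz[of M] by (simp add: invertible_def)
  then have "M ** matrix_inv M = mat 1 \<and> matrix_inv M ** M = mat 1"
    unfolding matrix_inv_def by (rule someI_ex)
  then show 1: "M ** matrix_inv M = mat 1" and "matrix_inv M $ k $ l = (if k = l then (if k = 1 then M $ 2 $ 2 else M $ 1 $ 1) else - M $ k $ l) / det M"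
    using MN matrix_mul_assoc[of "matrix_inv M" M N] by (auto simp: N_def)
qed

abbreviation cross :: "real^2 \<Rightarrow> real^2 \<Rightarrow> real" where
  "cross u v \<equiv> u $ 1 * v $ 2 - u $ 2 * v $ 1"

context surface begin

definition Gam :: "'m chart \<Rightarrow> real^2 \<Rightarrow> real^2 \<Rightarrow> real^2 \<Rightarrow> real^2" where
  "Gam c y u v = (\<chi> k. \<Sum>i\<in>UNIV. \<Sum>j\<in>UNIV. christoffel A g c y k i j * u $ i * v $ j)"

definition dGam :: "'m chart \<Rightarrow> real^2 \<Rightarrow> real^2 \<Rightarrow> real^2 \<Rightarrow> real^2 \<Rightarrow> real^2" where
  "dGam c y e u v = (\<chi> k. \<Sum>i\<in>UNIV. \<Sum>j\<in>UNIV.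
     frechet_derivative (\<lambda>z. christoffel A g c z k i j) (at y) e * u $ i * v $ j)"

abbreviation "J c y w \<equiv> rot A g c y w"
abbreviation "sqdet c y \<equiv> sqrt (det (metric_coeff A g c y))"

definition dmet :: "'m chart \<Rightarrow> real^2 \<Rightarrow> 2 \<Rightarrow> 2 \<Rightarrow> 2 \<Rightarrow> real" where
  "dmet c y i j l = partial_deriv i (\<lambda>z. metric_coeff A g c z $ j $ l) y"

lemma metric_nth_smooth: "c \<in> A \<Longrightarrow> smooth_on (chart_codom c) (\<lambda>z. metric_coeff A g c z $ j $ l)"
  by (intro smooth_on_linear[where L="\<lambda>M. M $ j $ l"] metric_smooth open_chart_codom
      bounded_linear_compose[OF bounded_linear_vec_nth bounded_linear_vec_nth])

lemma dmet_sym: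
  assumes "c \<in> A" "y \<in> chart_codom c" shows "dmet c y i j l = dmet c y i l j"
proof -
  have h: "((\<lambda>z. metric_coeff A g c z $ j $ l) has_derivative frechet_derivative (\<lambda>z. metric_coeff A g c z $ j $ l) (at y)) (at y)" for j l
    by (rule C1_on_frechet[OF smooth_on_C1_on[OF metric_nth_smooth[OF assms(1)]] assms(2)])
  have "((\<lambda>z. metric_coeff A g c z $ l $ j) has_derivative frechet_derivative (\<lambda>z. metric_coeff A g c z $ j $ l) (at y)) (at y)"
    by (rule has_derivative_transform_within_open[OF h open_chart_codom[OF assms(1)] assms(2)])
      (use metric_sym[OF assms(1)] in auto)
  from has_derivative_unique[OF this h] show ?thesis by (simp add: dmet_def partial_deriv_def)
qed

lemma christoffel_sym: "c \<in> A \<Longrightarrow> y \<in> chart_codom c \<Longrightarrow> christoffel A g c y k i j = christoffel A g c y k j i"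
  unfolding christoffel_def dmet_def[symmetric] using dmet_sym[of c y _ i j]
  by (simp add: add.commute[of "dmet c y i _ _"])

lemma metric_christoffel:
  assumes "c \<in> A" "y \<in> chart_codom c"
  shows "(\<Sum>k\<in>UNIV. metric_coeff A g c y $ m $ k * christoffel A g c y k i j) = (dmet c y i j m + dmet c y j i m - dmet c y m i j) / 2"
proof -
  define N where "N = matrix_inv (metric_coeff A g c y)"
  define X where "X l = dmet c y i j l + dmet c y j i l - dmet c y l i j" for l
  have "metric_coeff A g c y ** N = mat 1"
    unfolding N_def using det_metric_pos[OF assms] by (intro matrix_inv_2x2) auto
  then have N: "(\<Sum>k\<in>UNIV. metric_coeff A g c y $ m $ k * N $ k $ l) = (if m = l then 1 else 0)" for l
    by (simp add: vec_eq_iff matrix_matrix_mult_def mat_def)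
  have "(\<Sum>k\<in>UNIV. metric_coeff A g c y $ m $ k * christoffel A g c y k i j) =
    (\<Sum>k\<in>UNIV. metric_coeff A g c y $ m $ k * (1/2 * (\<Sum>l\<in>UNIV. N $ k $ l * X l)))"
    by (simp add: christoffel_def N_def X_def dmet_def)
  also have "\<dots> = 1/2 * (\<Sum>l\<in>UNIV. (\<Sum>k\<in>UNIV. metric_coeff A g c y $ m $ k * N $ k $ l) * X l)"
    by (simp add: sum_2 algebra_simps)
  also have "\<dots> = 1/2 * X m" by (simp add: N sum_2) (metis (full_types) exhaust_2)
  finally show ?thesis by (simp add: X_def)
qed

lemma metric_has_derivative:
  assumes "c \<in> A" "y \<in> chart_codom c"
  shows "((\<lambda>z. metric_coeff A g c z $ j $ l) has_derivative (\<lambda>e. \<Sum>i\<in>UNIV. e $ i * dmet c y i j l)) (at y)"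
proof -
  let ?D = "frechet_derivative (\<lambda>z. metric_coeff A g c z $ j $ l) (at y)"
  have h: "((\<lambda>z. metric_coeff A g c z $ j $ l) has_derivative ?D) (at y)"
    by (rule C1_on_frechet[OF smooth_on_C1_on[OF metric_nth_smooth[OF assms(1)]] assms(2)])
  then have l: "linear ?D" by (rule has_derivative_linear)
  have "?D e = (\<Sum>i\<in>UNIV. e $ i * dmet c y i j l)" for e
    by (subst vec2_expand[of e]) (simp add: linear_add[OF l] linear_scale[OF l] dmet_def partial_deriv_def sum_2)
  then show ?thesis using h by (metis (no_types, lifting) ext)
qed

lemma Gam_bilinear: "bilinear (Gam c y)"
  unfolding bilinear_def
  by (auto intro!: linearI simp: Gam_def vec_eq_iff sum_2 algebra_simps)

lemmas Gam_simps = bilinear_ladd[OF Gam_bilinear] bilinear_radd[OF Gam_bilinear] bilinear_lmul[OF Gam_bilinear]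
  bilinear_rmul[OF Gam_bilinear] bilinear_lzero[OF Gam_bilinear] bilinear_rzero[OF Gam_bilinear] bilinear_lneg[OF Gam_bilinear]
  bilinear_rneg[OF Gam_bilinear] bilinear_lsub[OF Gam_bilinear] bilinear_rsub[OF Gam_bilinear]

lemma Gam_sym: "c \<in> A \<Longrightarrow> y \<in> chart_codom c \<Longrightarrow> Gam c y u v = Gam c y v u"
  using christoffel_sym[of c y _ 1 2] by (simp add: Gam_def vec_eq_iff sum_2 algebra_simps)

lemma B_Gam:
  assumes "c \<in> A" "y \<in> chart_codom c"
  shows "B c y (Gam c y e u) v =
    (\<Sum>m\<in>UNIV. \<Sum>i\<in>UNIV. \<Sum>j\<in>UNIV. v $ m * e $ i * u $ j * ((dmet c y i j m + dmet c y j i m - dmet c y m i j) / 2))"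
proof -
  have "B c y (Gam c y e u) v = (\<Sum>m\<in>UNIV. \<Sum>i\<in>UNIV. \<Sum>j\<in>UNIV. v $ m * e $ i * u $ j *
     (\<Sum>k\<in>UNIV. metric_coeff A g c y $ m $ k * christoffel A g c y k i j))"
    using metric_sym[OF assms, of 1 2] by (simp add: B_expand Gam_def sum_2 algebra_simps)
  then show ?thesis by (simp only: metric_christoffel[OF assms])
qed

lemma metric_compatible:
  assumes "c \<in> A" "y \<in> chart_codom c"
  shows "(\<Sum>i\<in>UNIV. \<Sum>j\<in>UNIV. \<Sum>l\<in>UNIV. e $ i * dmet c y i j l * u $ j * v $ l) =
     B c y (Gam c y e u) v + B c y u (Gam c y e v)"
  unfolding B_sym[OF assms, of u] B_Gam[OF assms]
  using dmet_sym[OF assms, of 1 1 2] dmet_sym[OF assms, of 2 1 2] by (simp add: sum_2 algebra_simps add_divide_distrib diff_divide_distrib)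

lemma B_has_derivative:
  assumes c: "c \<in> A" "y x \<in> chart_codom c"
    and y: "(y has_derivative y') (at x within X)"
    and u: "(u has_derivative u') (at x within X)" and v: "(v has_derivative v') (at x within X)"
  shows "((\<lambda>x. B c (y x) (u x) (v x)) has_derivative
    (\<lambda>h. B c (y x) (u' h + Gam c (y x) (y' h) (u x)) (v x) + B c (y x) (u x) (v' h + Gam c (y x) (y' h) (v x)))) (at x within X)"
proof -
  have m: "((\<lambda>x. metric_coeff A g c (y x) $ j $ l) has_derivative (\<lambda>h. \<Sum>i\<in>UNIV. y' h $ i * dmet c (y x) i j l)) (at x within X)" for j l
    by (rule has_derivative_compose[OF y metric_has_derivative[OF c]])
  have uv: "((\<lambda>x. u x $ i) has_derivative (\<lambda>h. u' h $ i)) (at x within X)" "((\<lambda>x. v x $ i) has_derivative (\<lambda>h. v' h $ i)) (at x within X)" for i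
    by (auto intro!: bounded_linear.has_derivative[OF bounded_linear_vec_nth] u v)
  have "((\<lambda>x. \<Sum>j\<in>UNIV. \<Sum>l\<in>UNIV. metric_coeff A g c (y x) $ j $ l * u x $ j * v x $ l) has_derivative
    (\<lambda>h. \<Sum>j\<in>UNIV. \<Sum>l\<in>UNIV. (\<Sum>i\<in>UNIV. y' h $ i * dmet c (y x) i j l) * u x $ j * v x $ l
      + metric_coeff A g c (y x) $ j $ l * u' h $ j * v x $ l + metric_coeff A g c (y x) $ j $ l * u x $ j * v' h $ l)) (at x within X)"
    by (auto intro!: derivative_eq_intros m uv simp: sum_2 algebra_simps)
  moreover have "(\<Sum>j\<in>UNIV. \<Sum>l\<in>UNIV. metric_coeff A g c (y x) $ j $ l * u x $ j * v x $ l) = B c (y x) (u x) (v x)" for x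
    by (simp add: B_expand sum_2)
  moreover have "(\<Sum>j\<in>UNIV. \<Sum>l\<in>UNIV. (\<Sum>i\<in>UNIV. y' h $ i * dmet c (y x) i j l) * u x $ j * v x $ l
      + metric_coeff A g c (y x) $ j $ l * u' h $ j * v x $ l + metric_coeff A g c (y x) $ j $ l * u x $ j * v' h $ l) =
     B c (y x) (u' h + Gam c (y x) (y' h) (u x)) (v x) + B c (y x) (u x) (v' h + Gam c (y x) (y' h) (v x))" for h
  proof -
    have "(\<Sum>j\<in>UNIV. \<Sum>l\<in>UNIV. (\<Sum>i\<in>UNIV. y' h $ i * dmet c (y x) i j l) * u x $ j * v x $ l
      + metric_coeff A g c (y x) $ j $ l * u' h $ j * v x $ l + metric_coeff A g c (y x) $ j $ l * u x $ j * v' h $ l) =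
      (\<Sum>i\<in>UNIV. \<Sum>j\<in>UNIV. \<Sum>l\<in>UNIV. y' h $ i * dmet c (y x) i j l * u x $ j * v x $ l)
      + B c (y x) (u' h) (v x) + B c (y x) (u x) (v' h)"
      by (simp add: sum_2 B_expand algebra_simps)
    then show ?thesis unfolding metric_compatible[OF c] by (simp add: B_simps)
  qed
  ultimately show ?thesis by simp
qed

lemma christoffel_C1: "c \<in> A \<Longrightarrow> C1_on (chart_codom c) (\<lambda>y. christoffel A g c y k i j)"
proof -
  assume c: "c \<in> A"
  have m: "C1_on (chart_codom c) (\<lambda>y. metric_coeff A g c y $ k $ l)" for k l
    by (rule smooth_on_C1_on[OF metric_nth_smooth[OF c]])
  have d: "C1_on (chart_codom c) (\<lambda>y. det (metric_coeff A g c y))"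
    unfolding det_2 by (intro C1_on_diff C1_on_mult m)
  have N: "C1_on (chart_codom c) (\<lambda>y. matrix_inv (metric_coeff A g c y) $ k $ l)" for k l
  proof (rule C1_on_cong[OF open_chart_codom[OF c]])
    show "C1_on (chart_codom c) (\<lambda>y. (if k = l then (if k = 1 then metric_coeff A g c y $ 2 $ 2 else metric_coeff A g c y $ 1 $ 1) else - metric_coeff A g c y $ k $ l) / det (metric_coeff A g c y))"
    proof (intro C1_on_divide d)
      show "det (metric_coeff A g c y) \<noteq> 0" if "y \<in> chart_codom c" for y using det_metric_pos[OF c that] by simp
    qed (cases "k = l"; cases "k = 1"; simp add: m C1_on_minus)
    show "(if k = l then (if k = 1 then metric_coeff A g c y $ 2 $ 2 else metric_coeff A g c y $ 1 $ 1) else - metric_coeff A g c y $ k $ l) / det (metric_coeff A g c y) =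
       matrix_inv (metric_coeff A g c y) $ k $ l" if "y \<in> chart_codom c" for y
      using matrix_inv_2x2(2)[of "metric_coeff A g c y" k l] det_metric_pos[OF c that] by simp
  qed
  have P: "C1_on (chart_codom c) (\<lambda>y. dmet c y i j l)" for i j l
    unfolding dmet_def partial_deriv_def by (rule smooth_on_C1_on_frechet[OF metric_nth_smooth[OF c]])
  show ?thesis
    unfolding christoffel_def dmet_def[symmetric]
    by (intro C1_on_mult C1_on_const C1_on_sum C1_on_add C1_on_diff N P)
qed

lemma Gam_has_derivative:
  assumes c: "c \<in> A" "y x \<in> chart_codom c"
    and y: "(y has_derivative y') (at x within X)"
    and u: "(u has_derivative u') (at x within X)" and v: "(v has_derivative v') (at x within X)"
  shows "((\<lambda>x. Gam c (y x) (u x) (v x)) has_derivative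
    (\<lambda>h. dGam c (y x) (y' h) (u x) (v x) + Gam c (y x) (u' h) (v x) + Gam c (y x) (u x) (v' h))) (at x within X)"
proof -
  let ?D = "\<lambda>k i j. frechet_derivative (\<lambda>z. christoffel A g c z k i j) (at (y x))"
  have m: "((\<lambda>x. christoffel A g c (y x) k i j) has_derivative (\<lambda>h. ?D k i j (y' h))) (at x within X)" for k i j
  proof (rule has_derivative_compose[OF y])
    show "((\<lambda>z. christoffel A g c z k i j) has_derivative ?D k i j) (at (y x))"
      by (rule C1_on_frechet[OF christoffel_C1[OF c(1)] c(2)])
  qed
  have uv: "((\<lambda>x. u x $ i) has_derivative (\<lambda>h. u' h $ i)) (at x within X)" "((\<lambda>x. v x $ i) has_derivative (\<lambda>h. v' h $ i)) (at x within X)" for i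
    by (auto intro!: bounded_linear.has_derivative[OF bounded_linear_vec_nth] u v)
  have "((\<lambda>x. \<Sum>i\<in>UNIV. \<Sum>j\<in>UNIV. christoffel A g c (y x) k i j * u x $ i * v x $ j) has_derivative
    (\<lambda>h. \<Sum>i\<in>UNIV. \<Sum>j\<in>UNIV. ?D k i j (y' h) * u x $ i * v x $ j
      + christoffel A g c (y x) k i j * u' h $ i * v x $ j + christoffel A g c (y x) k i j * u x $ i * v' h $ j)) (at x within X)" for k
    by (auto intro!: derivative_eq_intros m uv simp: sum_2 algebra_simps)
  then have k: "((\<lambda>x. (\<Sum>i\<in>UNIV. \<Sum>j\<in>UNIV. christoffel A g c (y x) k i j * u x $ i * v x $ j) *\<^sub>R axis k (1::real)) has_derivative
    (\<lambda>h. (\<Sum>i\<in>UNIV. \<Sum>j\<in>UNIV. ?D k i j (y' h) * u x $ i * v x $ j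
      + christoffel A g c (y x) k i j * u' h $ i * v x $ j + christoffel A g c (y x) k i j * u x $ i * v' h $ j) *\<^sub>R axis k 1)) (at x within X)" for k
    by (rule has_derivative_scaleR_left)
  have e1: "(\<lambda>x. Gam c (y x) (u x) (v x)) = (\<lambda>x. \<Sum>k\<in>UNIV. (\<Sum>i\<in>UNIV. \<Sum>j\<in>UNIV. christoffel A g c (y x) k i j * u x $ i * v x $ j) *\<^sub>R axis k (1::real))"
    by (auto simp: Gam_def fun_eq_iff vec_eq_iff forall_2 sum_2 axis_def)
  have e2: "(\<lambda>h. dGam c (y x) (y' h) (u x) (v x) + Gam c (y x) (u' h) (v x) + Gam c (y x) (u x) (v' h)) =
    (\<lambda>h. \<Sum>k\<in>UNIV. (\<Sum>i\<in>UNIV. \<Sum>j\<in>UNIV. ?D k i j (y' h) * u x $ i * v x $ j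
      + christoffel A g c (y x) k i j * u' h $ i * v x $ j + christoffel A g c (y x) k i j * u x $ i * v' h $ j) *\<^sub>R axis k 1)"
    by (auto simp: Gam_def dGam_def fun_eq_iff vec_eq_iff forall_2 sum_2 axis_def algebra_simps)
  show ?thesis unfolding e1 e2 by (rule has_derivative_sum[OF k])
qed

lemma Gam_C1:
  assumes c: "c \<in> A" and "C1_on X y" "C1_on X u" "C1_on X v" "\<And>x. x \<in> X \<Longrightarrow> y x \<in> chart_codom c"
  shows "C1_on X (\<lambda>x. Gam c (y x) (u x) (v x))"
  unfolding Gam_def
  by (intro C1_on_vec C1_on_sum C1_on_mult C1_on_vec_nth assms C1_on_compose[OF assms(2) christoffel_C1[OF c] assms(5)])

lemma J_linear: "linear (J c y)"
  by (auto intro!: linearI simp: rot_def Let_def vec_eq_iff forall_2 matrix_vector_mult_def sum_2 algebra_simps add_divide_distrib diff_divide_distrib)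

lemmas J_simps = linear_add[OF J_linear] linear_scale[OF J_linear] linear_0[OF J_linear] linear_neg[OF J_linear] linear_diff[OF J_linear]

lemma sqdet_pos: "c \<in> A \<Longrightarrow> y \<in> chart_codom c \<Longrightarrow> sqdet c y > 0"
  using det_metric_pos by simp

lemma J_C1:
  assumes c: "c \<in> A" and "C1_on X y" "C1_on X w" "\<And>x. x \<in> X \<Longrightarrow> y x \<in> chart_codom c"
  shows "C1_on X (\<lambda>x. J c (y x) (w x))"
proof -
  have m: "C1_on X (\<lambda>x. metric_coeff A g c (y x) $ k $ l)" for k l
    by (rule C1_on_compose[OF assms(2) smooth_on_C1_on[OF metric_nth_smooth[OF c]] assms(4)])
  have d: "C1_on X (\<lambda>x. det (metric_coeff A g c (y x)))"
    unfolding det_2 by (intro C1_on_diff C1_on_mult m)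
  have i: "C1_on X (\<lambda>x. inverse (sqdet c (y x)))"
  proof (intro C1_on_inverse C1_on_sqrt d)
    show "det (metric_coeff A g c (y x)) > 0" if "x \<in> X" for x using det_metric_pos[OF c assms(4)[OF that]] .
    then show "sqdet c (y x) \<noteq> 0" if "x \<in> X" for x using that by force
  qed
  have 1: "(\<lambda>x. J c (y x) (w x) $ 1) = (\<lambda>x. inverse (sqdet c (y x)) *
      - (metric_coeff A g c (y x) $ 2 $ 1 * w x $ 1 + metric_coeff A g c (y x) $ 2 $ 2 * w x $ 2))"
    by (simp add: fun_eq_iff rot_def Let_def matrix_vector_mult_def sum_2 field_class.field_divide_inverse)
  have 2: "(\<lambda>x. J c (y x) (w x) $ 2) = (\<lambda>x. inverse (sqdet c (y x)) *
      (metric_coeff A g c (y x) $ 1 $ 1 * w x $ 1 + metric_coeff A g c (y x) $ 1 $ 2 * w x $ 2))"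
    by (simp add: fun_eq_iff rot_def Let_def matrix_vector_mult_def sum_2 field_class.field_divide_inverse)
  have "C1_on X (\<lambda>x. J c (y x) (w x) $ 1)" "C1_on X (\<lambda>x. J c (y x) (w x) $ 2)"
    unfolding 1 2 by (intro C1_on_mult C1_on_minus C1_on_add i m C1_on_vec_nth assms)+
  then have "C1_on X (\<lambda>x. J c (y x) (w x) $ i)" for i :: 2
    using exhaust_2[of i] by auto
  from C1_on_vec[where f="\<lambda>x i. J c (y x) (w x) $ i", OF this] show ?thesis by (simp only: vec_lambda_eta)
qed

lemma J_nth:
  assumes "c \<in> A" "y \<in> chart_codom c"
  shows "J c y w $ 1 * sqdet c y = - (metric_coeff A g c y $ 1 $ 2 * w $ 1 + metric_coeff A g c y $ 2 $ 2 * w $ 2)"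
    and "J c y w $ 2 * sqdet c y = metric_coeff A g c y $ 1 $ 1 * w $ 1 + metric_coeff A g c y $ 1 $ 2 * w $ 2"
  using sqdet_pos[OF assms] metric_sym[OF assms, of 2 1]
  by (simp_all add: rot_def Let_def matrix_vector_mult_def sum_2 less_imp_neq[THEN not_sym])

lemma B_J:
  assumes "c \<in> A" "y \<in> chart_codom c"
  shows "B c y u (J c y w) = sqdet c y * cross w u"
proof -
  have s: "sqdet c y * sqdet c y = metric_coeff A g c y $ 1 $ 1 * metric_coeff A g c y $ 2 $ 2 - metric_coeff A g c y $ 1 $ 2 * metric_coeff A g c y $ 1 $ 2"
    using det_metric_pos[OF assms] metric_sym[OF assms, of 2 1] by (simp add: det_2)
  have "sqdet c y * B c y u (J c y w) = sqdet c y * (sqdet c y * cross w u)"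
    unfolding B_expand metric_sym[OF assms, of 2 1] using s J_nth[OF assms, of w] by algebra
  then show ?thesis using sqdet_pos[OF assms] by simp
qed

lemma B_J_self: "c \<in> A \<Longrightarrow> y \<in> chart_codom c \<Longrightarrow> B c y w (J c y w) = 0"
  by (simp add: B_J)

lemma B_J_skew: "c \<in> A \<Longrightarrow> y \<in> chart_codom c \<Longrightarrow> B c y (J c y u) w = - B c y u (J c y w)"
  by (simp add: B_sym[of c y "J c y u"] B_J algebra_simps)

lemma B_J_J:
  assumes "c \<in> A" "y \<in> chart_codom c"
  shows "B c y (J c y u) (J c y w) = B c y u w"
proof -
  have "B c y (J c y u) (J c y w) = sqdet c y * cross w (J c y u)" using B_J[OF assms] by simp
  also have "\<dots> = B c y u w"
    unfolding B_expand metric_sym[OF assms, of 2 1] using J_nth[OF assms, of u] by algebra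
  finally show ?thesis .
qed

lemma J_J:
  assumes "c \<in> A" "y \<in> chart_codom c"
  shows "J c y (J c y w) = - w"
proof (rule B_eqI[OF assms])
  fix v show "B c y (J c y (J c y w)) v = B c y (- w) v"
    unfolding B_J_skew[OF assms, of "J c y w"] B_J_J[OF assms] by (simp add: B_simps)
qed

lemma sqdet_has_derivative:
  assumes c: "c \<in> A" "y \<in> chart_codom c"
  shows "((\<lambda>z. sqdet c z) has_derivative (\<lambda>e. (Gam c y e (axis 1 1) $ 1 + Gam c y e (axis 2 1) $ 2) * sqdet c y)) (at y)"
proof -
  have m: "((\<lambda>z. metric_coeff A g c z $ j $ l) has_derivative (\<lambda>e. B c y (Gam c y e (axis j 1)) (axis l 1) + B c y (axis j 1) (Gam c y e (axis l 1)))) (at y)" for j l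
    using B_has_derivative[OF c(1), of "\<lambda>z. z" y "\<lambda>e. e" UNIV "\<lambda>_. axis j 1" "\<lambda>_. 0" "\<lambda>_. axis l 1" "\<lambda>_. 0"] c
    by (simp add: metric_nth)
  have d: "((\<lambda>z. det (metric_coeff A g c z)) has_derivative
     (\<lambda>e. 2 * (Gam c y e (axis 1 1) $ 1 + Gam c y e (axis 2 1) $ 2) * det (metric_coeff A g c y))) (at y)"
    unfolding det_2 using metric_sym[OF c, of 2 1]
    by (auto intro!: derivative_eq_intros m simp: fun_eq_iff B_expand axis_def algebra_simps)
  have s: "sqdet c y * sqdet c y = det (metric_coeff A g c y)" using det_metric_pos[OF c] by simp
  have "((\<lambda>z. sqdet c z) has_derivative (\<lambda>e. 2 * (Gam c y e (axis 1 1) $ 1 + Gam c y e (axis 2 1) $ 2) * det (metric_coeff A g c y) * (inverse (sqdet c y) / 2))) (at y)"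
    by (rule has_derivative_real_sqrt[OF _ d]) (use det_metric_pos[OF c] in auto)
  moreover have "2 * t * D * (inverse r / 2) = t * r" if "r > 0" "r * r = D" for t D r :: real
    using that by (auto simp: field_simps)
  note this[OF sqdet_pos[OF c] s]
  ultimately show ?thesis by (simp only:)
qed

lemma J_const_has_derivative:
  assumes c: "c \<in> A" "y \<in> chart_codom c"
  shows "((\<lambda>z. J c z w) has_derivative (\<lambda>e. J c y (Gam c y e w) - Gam c y e (J c y w))) (at y)"
proof -
  have "C1_on (chart_codom c) (\<lambda>z. J c z w)"
    by (intro J_C1[OF c(1)] C1_on_ident C1_on_const)
  then obtain D where D: "((\<lambda>z. J c z w) has_derivative D) (at y)" using C1_on_D c(2) by blast
  have "D e = J c y (Gam c y e w) - Gam c y e (J c y w)" for e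
  proof (rule B_eqI[OF c])
    fix u
    have 1: "((\<lambda>z. B c z u (J c z w)) has_derivative (\<lambda>h. B c y (0 + Gam c y h u) (J c y w) + B c y u (D h + Gam c y h (J c y w)))) (at y)"
      by (rule B_has_derivative[OF c(1), of "\<lambda>z. z"]) (use c D in \<open>auto intro!: derivative_eq_intros\<close>)
    have "((\<lambda>z. sqdet c z * cross w u) has_derivative (\<lambda>e. (Gam c y e (axis 1 1) $ 1 + Gam c y e (axis 2 1) $ 2) * sqdet c y * cross w u)) (at y)"
      by (rule has_derivative_mult_left[OF sqdet_has_derivative[OF c]])
    then have 2: "((\<lambda>z. B c z u (J c z w)) has_derivative (\<lambda>e. (Gam c y e (axis 1 1) $ 1 + Gam c y e (axis 2 1) $ 2) * sqdet c y * cross w u)) (at y)"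
      by (rule has_derivative_transform_within_open[OF _ open_chart_codom[OF c(1)] c(2)]) (simp add: B_J[OF c(1)])
    have tr: "(Gam c y e (axis 1 1) $ 1 + Gam c y e (axis 2 1) $ 2) * cross w u = cross (Gam c y e w) u + cross w (Gam c y e u)"
      by (simp add: Gam_def sum_2 axis_def algebra_simps)
    have "B c y (Gam c y e u) (J c y w) + B c y u (D e + Gam c y e (J c y w)) = (Gam c y e (axis 1 1) $ 1 + Gam c y e (axis 2 1) $ 2) * sqdet c y * cross w u"
      using fun_cong[OF has_derivative_unique[OF 1 2], of e] by simp
    also have "\<dots> = sqdet c y * (cross (Gam c y e w) u + cross w (Gam c y e u))" unfolding tr[symmetric] by simp
    also have "\<dots> = B c y u (J c y (Gam c y e w)) + B c y (Gam c y e u) (J c y w)"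
      by (simp add: B_J[OF c] distrib_left)
    finally have "B c y u (D e) = B c y u (J c y (Gam c y e w) - Gam c y e (J c y w))"
      by (simp add: B_simps)
    then show "B c y (D e) u = B c y (J c y (Gam c y e w) - Gam c y e (J c y w)) u" by (simp add: B_sym[OF c, of _ u])
  qed
  then show ?thesis using D by (metis (no_types, lifting) ext)
qed

lemma J_has_derivative:
  assumes c: "c \<in> A" "y x \<in> chart_codom c"
    and y: "(y has_derivative y') (at x within X)" and w: "(w has_derivative w') (at x within X)"
  shows "((\<lambda>x. J c (y x) (w x)) has_derivative
    (\<lambda>h. J c (y x) (w' h + Gam c (y x) (y' h) (w x)) - Gam c (y x) (y' h) (J c (y x) (w x)))) (at x within X)"
proof -
  define e1 e2 :: "real^2" where "e1 = axis 1 1" and "e2 = axis 2 1"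
  have ex: "v = v $ 1 *\<^sub>R e1 + v $ 2 *\<^sub>R e2" for v unfolding e1_def e2_def by (rule vec2_expand)
  have wi: "((\<lambda>x. w x $ i) has_derivative (\<lambda>h. w' h $ i)) (at x within X)" for i
    by (auto intro!: bounded_linear.has_derivative[OF bounded_linear_vec_nth] w)
  have "((\<lambda>x. w x $ 1 *\<^sub>R J c (y x) e1 + w x $ 2 *\<^sub>R J c (y x) e2) has_derivative
     (\<lambda>h. (w x $ 1 *\<^sub>R (J c (y x) (Gam c (y x) (y' h) e1) - Gam c (y x) (y' h) (J c (y x) e1)) + w' h $ 1 *\<^sub>R J c (y x) e1)
        + (w x $ 2 *\<^sub>R (J c (y x) (Gam c (y x) (y' h) e2) - Gam c (y x) (y' h) (J c (y x) e2)) + w' h $ 2 *\<^sub>R J c (y x) e2))) (at x within X)"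
    by (intro has_derivative_add has_derivative_scaleR wi has_derivative_compose[OF y J_const_has_derivative[OF c]])
  moreover have "w x $ 1 *\<^sub>R J c (y x) e1 + w x $ 2 *\<^sub>R J c (y x) e2 = J c (y x) (w x)" for x
    using arg_cong[OF ex[of "w x"], of "J c (y x)"] by (simp only: J_simps)
  moreover have "(w x $ 1 *\<^sub>R (J c (y x) (Gam c (y x) (y' h) e1) - Gam c (y x) (y' h) (J c (y x) e1)) + w' h $ 1 *\<^sub>R J c (y x) e1)
        + (w x $ 2 *\<^sub>R (J c (y x) (Gam c (y x) (y' h) e2) - Gam c (y x) (y' h) (J c (y x) e2)) + w' h $ 2 *\<^sub>R J c (y x) e2) =
     J c (y x) (w' h + Gam c (y x) (y' h) (w x)) - Gam c (y x) (y' h) (J c (y x) (w x))" for h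
  proof -
    define a1 a2 b1 b2 where "a1 = w x $ 1" and "a2 = w x $ 2" and "b1 = w' h $ 1" and "b2 = w' h $ 2"
    have ab: "w x = a1 *\<^sub>R e1 + a2 *\<^sub>R e2" "w' h = b1 *\<^sub>R e1 + b2 *\<^sub>R e2"
      unfolding a1_def a2_def b1_def b2_def by (rule ex)+
    show ?thesis
      unfolding a1_def[symmetric] a2_def[symmetric] b1_def[symmetric] b2_def[symmetric] unfolding ab
      by (simp only: J_simps Gam_simps scaleR_diff_right) simp
  qed
  ultimately show ?thesis by simp
qed

end

section \<open>Change of charts\<close>

context surface begin

definition ddtrans :: "'m chart \<Rightarrow> 'm chart \<Rightarrow> real^2 \<Rightarrow> real^2 \<Rightarrow> real^2 \<Rightarrow> real^2" where
  "ddtrans c d y h w = blinfun_apply (blinfun_apply (Df (Df (transition c d)) y) h) w"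

definition dbtrans :: "'m chart \<Rightarrow> 'm chart \<Rightarrow> (real^2) \<times> (real^2) \<Rightarrow> (real^2) \<times> (real^2) \<Rightarrow> (real^2) \<times> (real^2)" where
  "dbtrans c d u h = (dtrans c d (fst u) (fst h), ddtrans c d (fst u) (fst h) (snd u) + dtrans c d (fst u) (snd h))"

lemma dtrans_eq_Df: "c \<in> A \<Longrightarrow> d \<in> A \<Longrightarrow> y \<in> overlap c d \<Longrightarrow> dtrans c d y = blinfun_apply (Df (transition c d) y)"
  using Df_apply_eq[OF transition_deriv] by simp

lemma Df_transition_C1: "c \<in> A \<Longrightarrow> d \<in> A \<Longrightarrow> C1_on (overlap c d) (Df (transition c d))"
  by (rule smooth_on_C1_on_Df[OF open_overlap transition_smooth])

lemma open_overlap_UNIV: "c \<in> A \<Longrightarrow> d \<in> A \<Longrightarrow> open (overlap c d \<times> (UNIV :: (real^2) set))"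
  by (intro open_Times open_overlap) auto

lemma btrans_has_derivative:
  assumes cd: "c \<in> A" "d \<in> A" and u: "fst u \<in> overlap c d"
  shows "(btrans c d has_derivative dbtrans c d u) (at u)"
proof -
  have fst: "((\<lambda>u. transition c d (fst u)) has_derivative (\<lambda>h. dtrans c d (fst u) (fst h))) (at u)"
    by (rule has_derivative_compose[where f=fst and f'=fst, OF _ transition_deriv[OF cd u]]) (auto intro!: derivative_eq_intros)
  have "((\<lambda>u. Df (transition c d) (fst u) (snd u)) has_derivative
     (\<lambda>h. Df (transition c d) (fst u) (snd h) + (Df (Df (transition c d)) (fst u) (fst h)) (snd u))) (at u)"
    by (rule bounded_bilinear.FDERIV[OF bounded_bilinear_blinfun_apply])
      (auto intro!: derivative_eq_intros has_derivative_compose[where f=fst and f'=fst, OF _ C1_on_D[OF Df_transition_C1[OF cd] u]])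
  then have "((\<lambda>u. (transition c d (fst u), Df (transition c d) (fst u) (snd u))) has_derivative
     (\<lambda>h. (dtrans c d (fst u) (fst h), Df (transition c d) (fst u) (snd h) + (Df (Df (transition c d)) (fst u) (fst h)) (snd u)))) (at u)"
    by (rule has_derivative_Pair[OF fst])
  then have "(btrans c d has_derivative
     (\<lambda>h. (dtrans c d (fst u) (fst h), Df (transition c d) (fst u) (snd h) + (Df (Df (transition c d)) (fst u) (fst h)) (snd u)))) (at u)"
    by (rule has_derivative_transform_within_open[OF _ open_overlap_UNIV[OF cd]])
      (use u cd in \<open>auto simp: btrans_def dtrans_eq_Df mem_Times_iff\<close>)
  then show ?thesis
    by (simp add: dbtrans_def[abs_def] ddtrans_def dtrans_eq_Df[OF cd u] add.commute)
qed

lemma btrans_C1: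
  assumes cd: "c \<in> A" "d \<in> A"
  shows "C1_on (overlap c d \<times> UNIV) (btrans c d)"
proof (rule C1_on_cong[OF open_overlap_UNIV[OF cd]])
  show "C1_on (overlap c d \<times> UNIV) (\<lambda>u. (transition c d (fst u), Df (transition c d) (fst u) (snd u)))"
    by (intro C1_on_Pair C1_on_blinfun_apply C1_on_snd
       C1_on_compose[OF C1_on_fst Df_transition_C1[OF cd]] C1_on_compose[OF C1_on_fst smooth_on_C1_on[OF transition_smooth[OF cd]]]) auto
qed (auto simp: btrans_def dtrans_eq_Df[OF cd])

lemma ddtrans_sym:
  assumes cd: "c \<in> A" "d \<in> A" and y: "y \<in> overlap c d"
  shows "ddtrans c d y u v = ddtrans c d y v u"
proof -
  have "((\<lambda>y. Df (transition c d) y u) has_derivative (\<lambda>h. ddtrans c d y h u)) (at y)" for u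
    unfolding ddtrans_def
    by (rule bounded_linear.has_derivative[OF blinfun.bounded_linear_left C1_on_D[OF Df_transition_C1[OF cd] y]])
  from mixed_derivatives_eq[OF open_overlap[OF cd] y C1_on_D[OF smooth_on_C1_on[OF transition_smooth[OF cd]]] this this]
  show ?thesis by simp
qed

text \<open>The difference of the two sides is symmetric in its arguments and, both connections being
  metric, skew with respect to the metric; hence it vanishes.\<close>

lemma Gam_trans:
  assumes cd: "c \<in> A" "d \<in> A" and y: "y \<in> overlap c d"
  shows "Gam d (transition c d y) (dtrans c d y u) (dtrans c d y v) = dtrans c d y (Gam c y u v) - ddtrans c d y u v"
proof -
  define T where "T = dtrans c d y"
  define y' where "y' = transition c d y"
  have yc: "y \<in> chart_codom c" and y'd: "y' \<in> chart_codom d"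
    using overlap_codom cd y transition_overlap[OF cd y] by (auto simp: y'_def)
  define s where "s u v = T (Gam c y u v) - ddtrans c d y u v - Gam d y' (T u) (T v)" for u v
  have s_sym: "s u v = s v u" for u v
    by (simp add: s_def Gam_sym[OF cd(1) yc, of u v] Gam_sym[OF cd(2) y'd, of "T u"] ddtrans_sym[OF cd y, of u v])
  have skew: "B d y' (s e u) (T v) = - B d y' (T u) (s e v)" for e u v
  proof -
    have c: "((\<lambda>z. B c z u v) has_derivative (\<lambda>h. B c y (0 + Gam c y h u) v + B c y u (0 + Gam c y h v))) (at y)"
      by (rule B_has_derivative[OF cd(1), of "\<lambda>z. z"]) (use yc in \<open>auto intro!: derivative_eq_intros\<close>)
    have D: "((\<lambda>z. dtrans c d z u) has_derivative (\<lambda>h. ddtrans c d y h u)) (at y)" for u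
    proof (rule has_derivative_transform_within_open[OF _ open_overlap[OF cd] y])
      show "((\<lambda>z. Df (transition c d) z u) has_derivative (\<lambda>h. ddtrans c d y h u)) (at y)"
        unfolding ddtrans_def
        by (rule bounded_linear.has_derivative[OF blinfun.bounded_linear_left C1_on_D[OF Df_transition_C1[OF cd] y]])
    qed (simp add: dtrans_eq_Df[OF cd])
    have "((\<lambda>z. B d (transition c d z) (dtrans c d z u) (dtrans c d z v)) has_derivative
       (\<lambda>h. B d y' (ddtrans c d y h u + Gam d y' (T h) (T u)) (T v) + B d y' (T u) (ddtrans c d y h v + Gam d y' (T h) (T v)))) (at y)"
      unfolding T_def y'_def
      by (rule B_has_derivative[OF cd(2) _ transition_deriv[OF cd y] D D]) (use y'd y'_def in simp)
    then have "((\<lambda>z. B c z u v) has_derivative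
       (\<lambda>h. B d y' (ddtrans c d y h u + Gam d y' (T h) (T u)) (T v) + B d y' (T u) (ddtrans c d y h v + Gam d y' (T h) (T v)))) (at y)"
      by (rule has_derivative_transform_within_open[OF _ open_overlap[OF cd] y]) (simp add: B_trans[OF cd])
    from fun_cong[OF has_derivative_unique[OF this c], of e]
    have "B d y' (ddtrans c d y e u + Gam d y' (T e) (T u)) (T v) + B d y' (T u) (ddtrans c d y e v + Gam d y' (T e) (T v)) =
      B d y' (T (Gam c y e u)) (T v) + B d y' (T u) (T (Gam c y e v))"
      by (simp add: T_def y'_def B_trans[OF cd y])
    then show ?thesis by (simp add: s_def B_simps algebra_simps)
  qed
  have "B d y' (s u v) (T w) = 0" for u v w
  proof -
    have 1: "B d y' (s a b) (T w) = - B d y' (s a w) (T b)" for a b w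
      using skew[of a b w] B_sym[OF cd(2) y'd, of "T b"] by simp
    have "B d y' (s u v) (T w) = - B d y' (s u w) (T v)" by (rule 1)
    also have "\<dots> = - B d y' (s w u) (T v)" by (simp add: s_sym[of u w])
    also have "\<dots> = B d y' (s w v) (T u)" using 1[of w u v] by simp
    also have "\<dots> = B d y' (s v w) (T u)" by (simp add: s_sym[of v w])
    also have "\<dots> = - B d y' (s v u) (T w)" using 1[of v w u] by simp
    also have "\<dots> = - B d y' (s u v) (T w)" by (simp add: s_sym[of u v])
    finally show ?thesis by simp
  qed
  from this[of u v "dtrans d c y' (s u v)"] have "B d y' (s u v) (s u v) = 0"
    by (simp add: T_def y'_def dtrans_surj[OF cd y])
  then have "s u v = 0" using B_pos[OF cd(2) y'd, of "s u v"] by force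
  then show ?thesis by (simp add: s_def T_def y'_def)
qed

lemma cross_linear:
  assumes "linear T" shows "cross (T u) (T v) = det (matrix T) * cross u v"
proof -
  have e: "T w = w $ 1 *\<^sub>R T (axis 1 1) + w $ 2 *\<^sub>R T (axis 2 1)" for w
    by (subst vec2_expand[of w]) (simp add: linear_add[OF assms] linear_scale[OF assms])
  show ?thesis by (subst (1 2) e[of u], subst (1 2) e[of v]) (simp add: det_2 matrix_def algebra_simps)
qed

lemma sqdet_trans:
  assumes cd: "c \<in> A" "d \<in> A" and y: "y \<in> overlap c d"
  shows "sqdet c y = sqdet d (transition c d y) * det (matrix (dtrans c d y))"
proof -
  define T where "T = dtrans c d y"
  define y' where "y' = transition c d y"
  have "metric_coeff A g c y = transpose (matrix T) ** metric_coeff A g d y' ** matrix T"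
  proof -
    have "metric_coeff A g c y $ i $ j = (transpose (matrix T) ** metric_coeff A g d y' ** matrix T) $ i $ j" for i j
      unfolding metric_nth B_trans[OF cd y, symmetric]
      by (simp add: B_expand T_def[symmetric] y'_def[symmetric] matrix_matrix_mult_def sum_2 transpose_def matrix_def algebra_simps)
    then show ?thesis by (simp add: vec_eq_iff)
  qed
  then have "det (metric_coeff A g c y) = det (metric_coeff A g d y') * (det (matrix T))\<^sup>2"
    by (simp add: det_mul power2_eq_square)
  then show ?thesis using det_dtrans_pos[OF cd y] by (simp add: real_sqrt_mult T_def y'_def)
qed

lemma J_trans:
  assumes cd: "c \<in> A" "d \<in> A" and y: "y \<in> overlap c d"
  shows "J d (transition c d y) (dtrans c d y w) = dtrans c d y (J c y w)"
proof -
  have yc: "y \<in> chart_codom c" and y'd: "transition c d y \<in> chart_codom d"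
    using overlap_codom cd y transition_overlap[OF cd y] by auto
  show ?thesis
  proof (rule B_eqI[OF cd(2) y'd])
    fix v
    define u where "u = dtrans d c (transition c d y) v"
    have v: "v = dtrans c d y u" by (simp add: u_def dtrans_surj[OF cd y])
    show "B d (transition c d y) (J d (transition c d y) (dtrans c d y w)) v = B d (transition c d y) (dtrans c d y (J c y w)) v"
      unfolding B_sym[OF cd(2) y'd, of _ v]
      by (simp add: v B_J[OF cd(2) y'd] B_trans[OF cd y] B_J[OF cd(1) yc] sqdet_trans[OF cd y] cross_linear[OF linear_dtrans[OF cd y]])
  qed
qed

section \<open>Vector fields on the unit tangent bundle\<close>

definition invariant_field :: "'m bundle_field \<Rightarrow> bool" where
  "invariant_field W \<longleftrightarrow> (\<forall>c\<in>A. \<forall>d\<in>A. \<forall>u. fst u \<in> overlap c d \<longrightarrow> snd u \<noteq> 0 \<longrightarrow> dbtrans c d u (W c u) = W d (btrans c d u))"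

abbreviation "X \<equiv> geodesic_field A g"
abbreviation "Ver \<equiv> vertical_field A g"

lemma geodesic_field_eq: "X c u = (snd u, - Gam c (fst u) (snd u) (snd u))"
  by (cases u) (simp add: geodesic_field_def Gam_def vec_eq_iff)

lemma vertical_field_eq: "Ver c u = (0, J c (fst u) (snd u))"
  by (cases u) (simp add: vertical_field_def)

lemma geodesic_field_invariant: "invariant_field X"
  unfolding invariant_field_def geodesic_field_eq dbtrans_def btrans_def
  by (simp add: Gam_trans linear_neg[OF linear_dtrans])

lemma vertical_field_invariant: "invariant_field Ver"
  unfolding invariant_field_def vertical_field_eq dbtrans_def btrans_def
  by (simp add: J_trans linear_0[OF linear_dtrans] ddtrans_def)

lemma local_rep_trans:
  "c \<in> A \<Longrightarrow> d \<in> A \<Longrightarrow> fst u \<in> overlap c d \<Longrightarrow> local_rep A g d f (btrans c d u) = local_rep A g c f u"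
  by (simp add: local_rep_def tangent_point_trans)

lemma linear_dbtrans: "c \<in> A \<Longrightarrow> d \<in> A \<Longrightarrow> fst u \<in> overlap c d \<Longrightarrow> linear (dbtrans c d u)"
  using btrans_has_derivative has_derivative_linear by blast

lemma thermostat_field_invariant: "invariant_field (thermostat_field A g lam)"
  using geodesic_field_invariant vertical_field_invariant unfolding invariant_field_def thermostat_field_def
  by (auto simp: linear_add[OF linear_dbtrans] linear_scale[OF linear_dbtrans] local_rep_trans)

definition nrm :: "'m chart \<Rightarrow> (real^2) \<times> (real^2) \<Rightarrow> (real^2) \<times> (real^2)" where
  "nrm c u = (fst u, (1 / sqrt (B c (fst u) (snd u) (snd u))) *\<^sub>R snd u)"

lemma tangent_point_g:
  "c \<in> A \<Longrightarrow> fst u \<in> chart_codom c \<Longrightarrow>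
    g (fst (tangent_point A c u)) (snd (tangent_point A c u)) (snd (tangent_point A c u)) = B c (fst u) (snd u) (snd u)"
  using B_tangent_point[of c "fst u" "snd u" "snd u"] by (simp add: fst_tangent_point)

lemma unit_tangent_iff:
  "c \<in> A \<Longrightarrow> fst u \<in> chart_codom c \<Longrightarrow> tangent_point A c u \<in> unit_tangent g \<longleftrightarrow> B c (fst u) (snd u) (snd u) = 1"
  using tangent_point_g[of c u] by (cases "tangent_point A c u") (simp add: unit_tangent_def)

lemma tangent_coord_unit:
  assumes "c \<in> A" "fst v \<in> chart_dom c" "v \<in> unit_tangent g" "u = tangent_coord A c v"
  shows "fst u \<in> chart_codom c" "B c (fst u) (snd u) (snd u) = 1" "snd u \<noteq> 0"
proof -
  show 1: "fst u \<in> chart_codom c" using assms by (simp add: fst_tangent_coord)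
  show 2: "B c (fst u) (snd u) (snd u) = 1" using unit_tangent_iff[OF assms(1) 1] assms tangent_point_coord by simp
  then show "snd u \<noteq> 0" by (auto simp: B_simps)
qed

lemma normalize_tangent_point:
  assumes "c \<in> A" "fst u \<in> chart_codom c"
  shows "normalize_tangent g (tangent_point A c u) = tangent_point A c (nrm c u)"
proof -
  obtain y w where u: "u = (y, w)" by force
  have "linear (dtrans c (chart_at A (chart_inv c y)) y)"
    using assms chart_at by (intro linear_dtrans) (auto simp: u mem_overlap)
  then show ?thesis using tangent_point_g[OF assms]
    by (simp add: u tangent_point_eq normalize_tangent_def nrm_def linear_scale)
qed

lemma nrm_unit: "B c (fst u) (snd u) (snd u) = 1 \<Longrightarrow> nrm c u = u"
  by (simp add: nrm_def)

lemma B_nrm: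
  assumes "c \<in> A" "fst u \<in> chart_codom c" "snd u \<noteq> 0"
  shows "B c (fst (nrm c u)) (snd (nrm c u)) (snd (nrm c u)) = 1" "snd (nrm c u) \<noteq> 0" "fst (nrm c u) = fst u"
  using B_pos[OF assms] assms by (simp_all add: nrm_def B_simps real_div_sqrt)

lemma local_rep_eq: "c \<in> A \<Longrightarrow> fst u \<in> chart_codom c \<Longrightarrow> local_rep A g c f u = f (tangent_point A c (nrm c u))"
  by (simp add: local_rep_def normalize_tangent_point)

lemma local_rep_unit:
  assumes "c \<in> A" "fst v \<in> chart_dom c" "v \<in> unit_tangent g"
  shows "local_rep A g c f (tangent_coord A c v) = f v"
  using tangent_coord_unit[OF assms refl] assms by (simp add: local_rep_eq nrm_unit tangent_point_coord)

lemma local_rep_scale: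
  assumes "c \<in> A" "y \<in> chart_codom c" "w \<noteq> 0" "s > 0"
  shows "local_rep A g c f (y, s *\<^sub>R w) = local_rep A g c f (y, w)"
proof -
  have "sqrt (s * (s * B c y w w)) = s * sqrt (B c y w w)"
    using assms(4) by (simp add: real_sqrt_mult flip: mult.assoc)
  then show ?thesis using assms by (simp add: local_rep_eq nrm_def B_simps)
qed

abbreviation "punct c \<equiv> chart_codom c \<times> (- {0 :: real^2})"

lemma open_punct: "c \<in> A \<Longrightarrow> open (punct c)"
  by (intro open_Times open_chart_codom) auto

lemma nrm_has_derivative:
  assumes c: "c \<in> A" "fst u \<in> chart_codom c" and 1: "B c (fst u) (snd u) (snd u) = 1"
  shows "(nrm c has_derivative (\<lambda>h. (fst h, snd h - B c (fst u) (snd u) (snd h + Gam c (fst u) (fst h) (snd u)) *\<^sub>R snd u))) (at u)"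
proof -
  define b where "b u = B c (fst u) (snd u) (snd u)" for u
  have bu: "b u = 1" using 1 by (simp add: b_def)
  have b: "(b has_derivative (\<lambda>h. 2 * B c (fst u) (snd u) (snd h + Gam c (fst u) (fst h) (snd u)))) (at u)"
  proof -
    have "(b has_derivative (\<lambda>h. B c (fst u) (snd h + Gam c (fst u) (fst h) (snd u)) (snd u) + B c (fst u) (snd u) (snd h + Gam c (fst u) (fst h) (snd u)))) (at u)"
      unfolding b_def by (rule B_has_derivative[where y=fst and y'=fst, OF c]) (auto intro!: derivative_eq_intros)
    then show ?thesis by (simp add: B_sym[OF c, of _ "snd u"])
  qed
  have s: "((\<lambda>u. sqrt (b u)) has_derivative (\<lambda>h. B c (fst u) (snd u) (snd h + Gam c (fst u) (fst h) (snd u)))) (at u)"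
    using has_derivative_real_sqrt[OF _ b] bu by simp
  have "((\<lambda>u. 1 / sqrt (b u)) has_derivative (\<lambda>h. - B c (fst u) (snd u) (snd h + Gam c (fst u) (fst h) (snd u)))) (at u)"
    using has_derivative_divide[OF has_derivative_const s, of 1] bu by simp
  then have "((\<lambda>u. (fst u, (1 / sqrt (b u)) *\<^sub>R snd u)) has_derivative
     (\<lambda>h. (fst h, (1 / sqrt (b u)) *\<^sub>R snd h + (- B c (fst u) (snd u) (snd h + Gam c (fst u) (fst h) (snd u))) *\<^sub>R snd u))) (at u)"
    by (intro has_derivative_Pair has_derivative_scaleR) (auto intro!: derivative_eq_intros)
  then show ?thesis by (simp add: nrm_def[abs_def] b_def 1)
qed

definition tangential :: "'m bundle_field \<Rightarrow> bool" where
  "tangential W \<longleftrightarrow> (\<forall>c\<in>A. \<forall>u. fst u \<in> chart_codom c \<longrightarrow>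
     B c (fst u) (snd u) (snd (W c u) + Gam c (fst u) (fst (W c u)) (snd u)) = 0)"

lemma geodesic_field_tangential: "tangential X"
  by (simp add: tangential_def geodesic_field_eq B_simps)

lemma vertical_field_tangential: "tangential Ver"
  by (simp add: tangential_def vertical_field_eq B_J Gam_simps)

lemma local_rep_smooth:
  "smooth_on_unit_tangent A g f \<Longrightarrow> c \<in> A \<Longrightarrow> smooth_on (punct c) (local_rep A g c f)"
  by (simp add: smooth_on_unit_tangent_def)

lemma local_rep_Df:
  "smooth_on_unit_tangent A g f \<Longrightarrow> c \<in> A \<Longrightarrow> u \<in> punct c \<Longrightarrow>
    (local_rep A g c f has_derivative Df (local_rep A g c f) u) (at u)"
  using C1_on_D smooth_on_C1_on local_rep_smooth by blast

lemma field_deriv_eq: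
  assumes f: "smooth_on_unit_tangent A g f" and W: "invariant_field W"
    and c: "c \<in> A" "fst v \<in> chart_dom c" and v: "v \<in> unit_tangent g"
  shows "field_deriv A g W f v = Df (local_rep A g c f) (tangent_coord A c v) (W c (tangent_coord A c v))"
proof -
  define d where "d = chart_at A (fst v)"
  have d: "d \<in> A" "fst v \<in> chart_dom d" using chart_at by (auto simp: d_def)
  define u where "u = tangent_coord A c v"
  have u: "u \<in> punct c" using tangent_coord_unit[OF c v] by (cases u) (auto simp: u_def)
  have uo: "fst u \<in> overlap c d" using c d by (simp add: u_def fst_tangent_coord overlapI)
  have du: "tangent_coord A d v = btrans c d u" unfolding u_def by (rule tangent_coord_trans) (use c d in auto)
  have dp: "btrans c d u \<in> punct d" using tangent_coord_unit[OF d v] by (cases "btrans c d u") (auto simp flip: du)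
  have "((\<lambda>u. local_rep A g d f (btrans c d u)) has_derivative (\<lambda>h. Df (local_rep A g d f) (btrans c d u) (dbtrans c d u h))) (at u)"
    by (rule has_derivative_compose[OF btrans_has_derivative[OF c(1) d(1) uo] local_rep_Df[OF f d(1) dp]])
  then have "(local_rep A g c f has_derivative (\<lambda>h. Df (local_rep A g d f) (btrans c d u) (dbtrans c d u h))) (at u)"
    by (rule has_derivative_transform_within_open[OF _ open_overlap_UNIV[OF c(1) d(1)]])
      (use uo c d in \<open>auto simp: local_rep_trans mem_Times_iff\<close>)
  then have e: "Df (local_rep A g c f) u h = Df (local_rep A g d f) (btrans c d u) (dbtrans c d u h)" for h
    by (simp add: Df_apply_eq)
  have Wd: "dbtrans c d u (W c u) = W d (btrans c d u)"
    using W c(1) d(1) uo u unfolding invariant_field_def mem_Times_iff by blast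
  have "field_deriv A g W f v = frechet_derivative (local_rep A g d f) (at (btrans c d u)) (W d (btrans c d u))"
    by (simp add: field_deriv_def Let_def du flip: d_def)
  also have "\<dots> = Df (local_rep A g d f) (btrans c d u) (dbtrans c d u (W c u))"
    using local_rep_Df[OF f d(1) dp] by (simp add: Wd Df_apply differentiableI)
  finally show ?thesis by (simp add: e flip: u_def)
qed

lemma field_deriv_local_rep_has_derivative:
  assumes f: "smooth_on_unit_tangent A g f" and W: "invariant_field W"
    and c: "c \<in> A" and u: "fst u \<in> chart_codom c" "B c (fst u) (snd u) (snd u) = 1"
    and WD: "(W c has_derivative DW) (at u)"
    and h: "B c (fst u) (snd u) (snd h + Gam c (fst u) (fst h) (snd u)) = 0"
  shows "frechet_derivative (local_rep A g c (field_deriv A g W f)) (at u) h =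
     Df (Df (local_rep A g c f)) u h (W c u) + Df (local_rep A g c f) u (DW h)"
proof -
  have un: "snd u \<noteq> 0" using u by (auto simp: B_simps)
  have up: "u \<in> punct c" using u un by (simp add: mem_Times_iff)
  let ?f = "local_rep A g c f"
  have eq: "local_rep A g c (field_deriv A g W f) v = Df ?f (nrm c v) (W c (nrm c v))" if "v \<in> punct c" for v
  proof -
    have v: "fst v \<in> chart_codom c" "snd v \<noteq> 0" using that by (auto simp: mem_Times_iff)
    note n = B_nrm[OF c v]
    have nc: "fst (nrm c v) \<in> chart_codom c" using n v by simp
    have "tangent_point A c (nrm c v) \<in> unit_tangent g" using unit_tangent_iff[OF c nc] n by simp
    moreover have "fst (tangent_point A c (nrm c v)) \<in> chart_dom c" using nc chart_inv_in[OF c] by (simp add: fst_tangent_point)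
    ultimately show ?thesis
      by (simp add: local_rep_eq[OF c v(1)] field_deriv_eq[OF f W c] tangent_coord_point[OF c nc])
  qed
  have fD: "((\<lambda>u. Df ?f u) has_derivative Df (Df ?f) u) (at u)"
    by (rule C1_on_D[OF smooth_on_C1_on_Df[OF open_punct[OF c] local_rep_smooth[OF f c]] up])
  have k: "((\<lambda>u. Df ?f u (W c u)) has_derivative (\<lambda>h. Df ?f u (DW h) + Df (Df ?f) u h (W c u))) (at u)"
    by (rule bounded_bilinear.FDERIV[OF bounded_bilinear_blinfun_apply fD WD])
  have nu: "nrm c u = u" using u by (simp add: nrm_unit)
  have "((\<lambda>v. Df ?f (nrm c v) (W c (nrm c v))) has_derivative
    (\<lambda>h. Df ?f u (DW (fst h, snd h - B c (fst u) (snd u) (snd h + Gam c (fst u) (fst h) (snd u)) *\<^sub>R snd u)) +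
      Df (Df ?f) u (fst h, snd h - B c (fst u) (snd u) (snd h + Gam c (fst u) (fst h) (snd u)) *\<^sub>R snd u) (W c u))) (at u)"
    by (rule has_derivative_compose[OF nrm_has_derivative[OF c u]]) (simp add: nu k)
  then have "(local_rep A g c (field_deriv A g W f) has_derivative
    (\<lambda>h. Df ?f u (DW (fst h, snd h - B c (fst u) (snd u) (snd h + Gam c (fst u) (fst h) (snd u)) *\<^sub>R snd u)) +
      Df (Df ?f) u (fst h, snd h - B c (fst u) (snd u) (snd h + Gam c (fst u) (fst h) (snd u)) *\<^sub>R snd u) (W c u))) (at u)"
    by (rule has_derivative_transform_within_open[OF _ open_punct[OF c] up]) (simp add: eq)
  from frechet_derivative_at[OF this, symmetric] h show ?thesis by simp
qed

lemma dGam_linear: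
  assumes "c \<in> A" "y \<in> chart_codom c"
  shows "linear (\<lambda>e. dGam c y e u v)"
proof -
  have "linear (frechet_derivative (\<lambda>z. christoffel A g c z k i j) (at y))" for k i j
    using C1_on_frechet[OF christoffel_C1[OF assms(1)] assms(2)] by (rule has_derivative_linear)
  note l = linear_add[OF this] linear_scale[OF this]
  show ?thesis by (rule linearI) (simp_all add: dGam_def vec_eq_iff l sum_2 algebra_simps)
qed

lemma dGam_bilinear: "bilinear (dGam c y e)"
  unfolding bilinear_def
  by (auto intro!: linearI simp: dGam_def vec_eq_iff sum_2 algebra_simps)

text \<open>\<open>H = [V,X]\<close> is the horizontal lift of \<open>J w\<close>.\<close>

lemma horizontal_deriv_eq:
  assumes f: "smooth_on_unit_tangent A g f" and v: "v \<in> unit_tangent g"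
    and c: "c = chart_at A (fst v)" and u: "tangent_coord A c v = (y, w)"
  shows "horizontal_deriv A g f v = Df (local_rep A g c f) (y, w) (J c y w, - Gam c y w (J c y w))"
proof -
  have cA: "c \<in> A" "fst v \<in> chart_dom c" using chart_at c by auto
  note tu = tangent_coord_unit[OF cA v refl, unfolded u fst_conv snd_conv]
  let ?f = "local_rep A g c f"
  have up: "(y, w) \<in> punct c" using tu by auto
  have D2: "Df (Df ?f) (y, w) a b = Df (Df ?f) (y, w) b a" for a b
  proof -
    have "((\<lambda>u. Df ?f u a) has_derivative (\<lambda>h. Df (Df ?f) (y, w) h a)) (at (y, w))" for a
      by (rule bounded_linear.has_derivative[OF blinfun.bounded_linear_left
            C1_on_D[OF smooth_on_C1_on_Df[OF open_punct[OF cA(1)] local_rep_smooth[OF f cA(1)]] up]])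
    from mixed_derivatives_eq[OF open_punct[OF cA(1)] up C1_on_D[OF smooth_on_C1_on[OF local_rep_smooth[OF f cA(1)]]] this this]
    show ?thesis by simp
  qed
  define DX where "DX h = (snd h, - (dGam c y (fst h) w w + Gam c y (snd h) w + Gam c y w (snd h)))" for h :: "(real^2) \<times> (real^2)"
  define DV where "DV h = (0 :: real^2, J c y (snd h + Gam c y (fst h) w) - Gam c y (fst h) (J c y w))" for h :: "(real^2) \<times> (real^2)"
  have DX: "(X c has_derivative DX) (at (y, w))"
  proof -
    have "((\<lambda>u. Gam c (fst u) (snd u) (snd u)) has_derivative
       (\<lambda>h. dGam c (fst (y, w)) (fst h) (snd (y, w)) (snd (y, w)) + Gam c (fst (y, w)) (snd h) (snd (y, w)) + Gam c (fst (y, w)) (snd (y, w)) (snd h))) (at (y, w))"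
      by (rule Gam_has_derivative[OF cA(1)]) (use tu in \<open>auto intro!: derivative_eq_intros simp del: image_eqI\<close>)
    then have "((\<lambda>u. (snd u, - Gam c (fst u) (snd u) (snd u))) has_derivative DX) (at (y, w))"
      unfolding DX_def[abs_def] by (intro has_derivative_Pair has_derivative_minus) (auto intro!: derivative_eq_intros)
    then show ?thesis by (simp add: geodesic_field_eq[abs_def])
  qed
  have DV: "(Ver c has_derivative DV) (at (y, w))"
  proof -
    have "((\<lambda>u. J c (fst u) (snd u)) has_derivative
       (\<lambda>h. J c (fst (y, w)) (snd h + Gam c (fst (y, w)) (fst h) (snd (y, w))) - Gam c (fst (y, w)) (fst h) (J c (fst (y, w)) (snd (y, w))))) (at (y, w))"
      by (rule J_has_derivative[OF cA(1)]) (use tu in \<open>auto intro!: derivative_eq_intros simp del: image_eqI\<close>)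
    then have "((\<lambda>u. (0 :: real^2, J c (fst u) (snd u))) has_derivative DV) (at (y, w))"
      unfolding DV_def[abs_def] by (intro has_derivative_Pair has_derivative_const) simp
    then show ?thesis by (simp add: vertical_field_eq[abs_def])
  qed
  have Xt: "B c y w (snd (X c (y, w)) + Gam c y (fst (X c (y, w))) w) = 0"
    and Vt: "B c y w (snd (Ver c (y, w)) + Gam c y (fst (Ver c (y, w))) w) = 0"
    using geodesic_field_tangential vertical_field_tangential cA(1) tu(1) unfolding tangential_def by (metis fst_conv snd_conv)+
  have 1: "vertical_deriv A g (geodesic_deriv A g f) v =
      Df (Df ?f) (y, w) (Ver c (y, w)) (X c (y, w)) + Df ?f (y, w) (DX (Ver c (y, w)))"
    unfolding field_deriv_def[of A g "Ver"] Let_def c[symmetric] u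
    by (rule field_deriv_local_rep_has_derivative[OF f geodesic_field_invariant cA(1) _ _ DX]) (use tu Vt in simp_all)
  have 2: "geodesic_deriv A g (vertical_deriv A g f) v =
      Df (Df ?f) (y, w) (X c (y, w)) (Ver c (y, w)) + Df ?f (y, w) (DV (X c (y, w)))"
    unfolding field_deriv_def[of A g "X"] Let_def c[symmetric] u
    by (rule field_deriv_local_rep_has_derivative[OF f vertical_field_invariant cA(1) _ _ DV]) (use tu Xt in simp_all)
  have "DX (Ver c (y, w)) - DV (X c (y, w)) = (J c y w, - Gam c y w (J c y w))"
    using linear_0[OF dGam_linear[OF cA(1) tu(1)]] Gam_sym[OF cA(1) tu(1), of "J c y w" w]
    by (simp add: DX_def DV_def vertical_field_eq geodesic_field_eq J_simps)
  then show ?thesis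
    unfolding horizontal_deriv_def 1 2 D2[of "Ver c (y, w)"] by (simp flip: blinfun.diff_right)
qed

end

section \<open>Curvature and the Jacobi equation\<close>

context surface begin

definition Rm :: "'m chart \<Rightarrow> real^2 \<Rightarrow> real^2 \<Rightarrow> real^2 \<Rightarrow> real^2 \<Rightarrow> real^2" where
  "Rm c y u v w = dGam c y u v w - dGam c y v u w + Gam c y u (Gam c y v w) - Gam c y v (Gam c y u w)"

abbreviation "R12 c y \<equiv> Rm c y (axis 1 1) (axis 2 1)"

lemma dGam_sym:
  assumes "c \<in> A" "y \<in> chart_codom c" shows "dGam c y e u v = dGam c y e v u"
proof -
  have G: "((\<lambda>z. Gam c z a b) has_derivative (\<lambda>h. dGam c y h a b + Gam c y 0 b + Gam c y a 0)) (at y)" for a b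
    by (rule Gam_has_derivative[where y="\<lambda>z. z" and y'="\<lambda>z. z", OF assms]) (auto intro!: derivative_eq_intros)
  have "((\<lambda>z. Gam c z v u) has_derivative (\<lambda>h. dGam c y h u v + Gam c y 0 v + Gam c y u 0)) (at y)"
    by (rule has_derivative_transform_within_open[OF G open_chart_codom[OF assms(1)] assms(2)]) (rule Gam_sym[OF assms(1)])
  from fun_cong[OF has_derivative_unique[OF this G], of e] show ?thesis by (simp add: Gam_simps)
qed

lemma Rm_cross:
  assumes "c \<in> A" "y \<in> chart_codom c"
  shows "Rm c y u v w = cross u v *\<^sub>R R12 c y w"
proof -
  define e1 e2 :: "real^2" where "e1 = axis 1 1" and "e2 = axis 2 1"
  note l = linear_add[OF dGam_linear[OF assms]] linear_scale[OF dGam_linear[OF assms]]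
    bilinear_ladd[OF dGam_bilinear] bilinear_lmul[OF dGam_bilinear] Gam_simps
  have uv: "u = u $ 1 *\<^sub>R e1 + u $ 2 *\<^sub>R e2" "v = v $ 1 *\<^sub>R e1 + v $ 2 *\<^sub>R e2"
    unfolding e1_def e2_def by (rule vec2_expand)+
  have "Rm c y (a *\<^sub>R e1 + b *\<^sub>R e2) (a' *\<^sub>R e1 + b' *\<^sub>R e2) w = (a * b' - b * a') *\<^sub>R Rm c y e1 e2 w" for a b a' b'
    unfolding Rm_def l by (simp add: algebra_simps)
  from this[of "u $ 1" "u $ 2" "v $ 1" "v $ 2"] show ?thesis
    using uv by (simp add: e1_def e2_def)
qed

lemma Rm_skew:
  assumes c: "c \<in> A" "y \<in> chart_codom c"
  shows "B c y (Rm c y u v a) b + B c y a (Rm c y u v b) = 0"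
proof -
  define \<phi> where "\<phi> z e = B c z (Gam c z e a) b + B c z a (Gam c z e b)" for z e
  have f: "((\<lambda>z. B c z a b) has_derivative \<phi> z) (at z)" if "z \<in> chart_codom c" for z
  proof -
    have "((\<lambda>z. B c z a b) has_derivative (\<lambda>h. B c z (0 + Gam c z h a) b + B c z a (0 + Gam c z h b))) (at z)"
      by (rule B_has_derivative[where y="\<lambda>z. z" and y'="\<lambda>z. z", OF c(1) that]) (auto intro!: derivative_eq_intros)
    then show ?thesis by (simp add: \<phi>_def[abs_def])
  qed
  define \<phi>' where "\<phi>' e h = (B c y (dGam c y h e a + Gam c y h (Gam c y e a)) b + B c y (Gam c y e a) (Gam c y h b))
     + (B c y (Gam c y h a) (Gam c y e b) + B c y a (dGam c y h e b + Gam c y h (Gam c y e b)))" for e h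
  have G: "((\<lambda>z. Gam c z e a) has_derivative (\<lambda>h. dGam c y h e a)) (at y)" for e a
  proof -
    have "((\<lambda>z. Gam c z e a) has_derivative (\<lambda>h. dGam c y h e a + Gam c y 0 a + Gam c y e 0)) (at y)"
      by (rule Gam_has_derivative[where y="\<lambda>z. z" and y'="\<lambda>z. z", OF c]) (auto intro!: derivative_eq_intros)
    then show ?thesis by (simp add: Gam_simps)
  qed
  have g: "((\<lambda>z. \<phi> z e) has_derivative \<phi>' e) (at y)" for e
  proof -
    have 1: "((\<lambda>z. B c z (Gam c z e a) b) has_derivative
      (\<lambda>h. B c y (dGam c y h e a + Gam c y h (Gam c y e a)) b + B c y (Gam c y e a) (0 + Gam c y h b))) (at y)"
      by (rule B_has_derivative[where y="\<lambda>z. z" and y'="\<lambda>z. z", OF c _ G]) (auto intro!: derivative_eq_intros)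
    have 2: "((\<lambda>z. B c z a (Gam c z e b)) has_derivative
      (\<lambda>h. B c y (0 + Gam c y h a) (Gam c y e b) + B c y a (dGam c y h e b + Gam c y h (Gam c y e b)))) (at y)"
      by (rule B_has_derivative[where y="\<lambda>z. z" and y'="\<lambda>z. z", OF c _ _ G]) (auto intro!: derivative_eq_intros)
    show ?thesis using has_derivative_add[OF 1 2] by (simp add: \<phi>_def \<phi>'_def[abs_def])
  qed
  have "\<phi>' u v = \<phi>' v u"
    by (rule mixed_derivatives_eq[OF open_chart_codom[OF c(1)] c(2) f g g])
  then show ?thesis by (simp add: \<phi>'_def Rm_def B_simps)
qed

definition curv :: "'m chart \<Rightarrow> real^2 \<Rightarrow> real" where
  "curv c y = B c y (R12 c y (axis 2 1)) (axis 1 1) / det (metric_coeff A g c y)"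

lemma gauss_curvature_eq: "gauss_curvature A g x = curv (chart_at A x) (chart_map (chart_at A x) x)"
proof -
  define c y where "c = chart_at A x" and "y = chart_map c x"
  have "curvature_122 A g c y l = R12 c y (axis 2 1) $ l" for l
    by (simp add: curvature_122_def Rm_def dGam_def Gam_def partial_deriv_def sum_2 axis_def)
  then show ?thesis
    by (simp add: gauss_curvature_def Let_def sum_2 curv_def B_expand axis_def flip: c_def y_def)
qed

lemma B_Rm_J:
  assumes cy: "c \<in> A" "y \<in> chart_codom c" and w: "B c y w w = 1"
  shows "B c y (Rm c y w \<eta> w) (J c y w) = - curv c y * B c y \<eta> (J c y w)"
proof -
  define \<alpha> where "\<alpha> a b = B c y (R12 c y a) b" for a b
  have R12b: "R12 c y (s *\<^sub>R a + t *\<^sub>R b) = s *\<^sub>R R12 c y a + t *\<^sub>R R12 c y b" for s t a b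
    unfolding Rm_def bilinear_radd[OF dGam_bilinear] bilinear_rmul[OF dGam_bilinear] Gam_simps by (simp add: algebra_simps)
  have skew: "\<alpha> a b = - \<alpha> b a" for a b
    using Rm_skew[OF cy, of "axis 1 1" "axis 2 1" a b] B_sym[OF cy, of a] by (simp add: \<alpha>_def)
  have \<alpha>: "\<alpha> a b = cross a b * \<alpha> (axis 1 1) (axis 2 1)" for a b
  proof -
    define e1 e2 :: "real^2" where "e1 = axis 1 1" and "e2 = axis 2 1"
    have "\<alpha> (s *\<^sub>R e1 + t *\<^sub>R e2) (s' *\<^sub>R e1 + t' *\<^sub>R e2) = (s * t' - t * s') * \<alpha> e1 e2" for s t s' t'
      using skew[of e1 e1] skew[of e2 e2] skew[of e2 e1] unfolding \<alpha>_def R12b B_simps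
      by (simp add: algebra_simps)
    from this[of "a $ 1" "a $ 2" "b $ 1" "b $ 2"] show ?thesis
      using vec2_expand[of a] vec2_expand[of b] by (simp add: e1_def e2_def)
  qed
  have K: "\<alpha> (axis 1 1) (axis 2 1) = - curv c y * (sqdet c y * sqdet c y)"
    using det_metric_pos[OF cy] skew[of "axis 1 1" "axis 2 1"] by (simp add: \<alpha>_def curv_def)
  have 1: "sqdet c y * cross w (J c y w) = 1" using B_J_J[OF cy, of w w] w B_J[OF cy, of "J c y w" w] by simp
  have "B c y (Rm c y w \<eta> w) (J c y w) = cross w \<eta> * \<alpha> w (J c y w)"
    by (simp add: Rm_cross[OF cy, of w \<eta>] B_simps \<alpha>_def)
  also have "\<dots> = - curv c y * (sqdet c y * cross w \<eta>) * (sqdet c y * cross w (J c y w))"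
    unfolding \<alpha>[of w] K by simp
  also have "\<dots> = - curv c y * B c y \<eta> (J c y w)" unfolding 1 by (simp add: B_J[OF cy])
  finally show ?thesis .
qed

lemma orthonormal_expand:
  assumes cy: "c \<in> A" "y \<in> chart_codom c" and w: "B c y w w = 1"
  shows "v = B c y v w *\<^sub>R w + B c y v (J c y w) *\<^sub>R J c y w"
proof -
  define r where "r = v - (B c y v w *\<^sub>R w + B c y v (J c y w) *\<^sub>R J c y w)"
  have JJ: "B c y (J c y w) (J c y w) = 1" using B_J_J[OF cy, of w w] w by simp
  have Jw: "B c y (J c y w) w = 0" "B c y w (J c y w) = 0" using B_J_self[OF cy, of w] B_sym[OF cy] by auto
  have "B c y r w = 0" using w Jw by (simp add: r_def B_simps)
  moreover have "B c y r (J c y w) = 0" using Jw JJ by (simp add: r_def B_simps)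
  then have "cross w r = 0" using B_J[OF cy, of r w] sqdet_pos[OF cy] by simp
  have "r = 0"
  proof (rule ccontr)
    assume "r \<noteq> 0"
    have "w \<noteq> 0" using w by (auto simp: B_simps)
    have wr: "w $ 1 * r $ 2 = w $ 2 * r $ 1" using \<open>cross w r = 0\<close> by simp
    have "\<exists>k. r = k *\<^sub>R w"
    proof (cases "w $ 1 = 0")
      case True
      then have "w $ 2 \<noteq> 0" using \<open>w \<noteq> 0\<close> by (auto simp: vec_eq_iff forall_2)
      then have "r = (r $ 2 / w $ 2) *\<^sub>R w" using wr True by (auto simp: vec_eq_iff forall_2)
      then show ?thesis ..
    next
      case False
      then have "r = (r $ 1 / w $ 1) *\<^sub>R w" using wr by (auto simp: vec_eq_iff forall_2 field_simps)
      then show ?thesis ..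
    qed
    then obtain k where k: "r = k *\<^sub>R w" ..
    then have "k = 0" using \<open>B c y r w = 0\<close> w by (simp add: B_simps)
    then show False using k \<open>r \<noteq> 0\<close> by simp
  qed
  then show ?thesis by (simp add: r_def)
qed

lemma jacobi_derivatives:
  fixes y w \<eta> \<zeta> :: "real \<Rightarrow> real^2"
  assumes cy: "c \<in> A" "y t \<in> chart_codom c"
    and w1: "B c (y t) (w t) (w t) = 1" and w\<sigma>: "B c (y t) (w t) (\<zeta> t + Gam c (y t) (w t) (\<eta> t)) = 0"
    and yd: "(y has_vector_derivative w t) (at t)"
    and wd: "(w has_vector_derivative - Gam c (y t) (w t) (w t) + l *\<^sub>R J c (y t) (w t)) (at t)"
    and \<eta>d: "(\<eta> has_vector_derivative \<zeta> t) (at t)"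
    and \<zeta>d: "(\<zeta> has_vector_derivative
       - (dGam c (y t) (\<eta> t) (w t) (w t) + Gam c (y t) (\<zeta> t) (w t) + Gam c (y t) (w t) (\<zeta> t))
       + l' *\<^sub>R J c (y t) (w t)
       + l *\<^sub>R (J c (y t) (\<zeta> t + Gam c (y t) (\<eta> t) (w t)) - Gam c (y t) (\<eta> t) (J c (y t) (w t)))) (at t)"
  shows "((\<lambda>t. B c (y t) (\<eta> t) (J c (y t) (w t))) has_real_derivative
      B c (y t) (\<zeta> t + Gam c (y t) (w t) (\<eta> t)) (J c (y t) (w t)) - l * B c (y t) (\<eta> t) (w t)) (at t)"
    and "((\<lambda>t. B c (y t) (\<eta> t) (w t)) has_real_derivative l * B c (y t) (\<eta> t) (J c (y t) (w t))) (at t)"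
    and "((\<lambda>t. B c (y t) (\<zeta> t + Gam c (y t) (w t) (\<eta> t)) (J c (y t) (w t))) has_real_derivative
      - curv c (y t) * B c (y t) (\<eta> t) (J c (y t) (w t)) + l') (at t)"
proof -
  let ?y = "y t" let ?w = "w t" let ?\<eta> = "\<eta> t" let ?\<zeta> = "\<zeta> t"
  let ?\<Gamma> = "Gam c ?y" let ?J = "J c ?y"
  define w' where "w' = - ?\<Gamma> ?w ?w + l *\<^sub>R ?J ?w"
  define \<zeta>' where "\<zeta>' = - (dGam c ?y ?\<eta> ?w ?w + ?\<Gamma> ?\<zeta> ?w + ?\<Gamma> ?w ?\<zeta>) + l' *\<^sub>R ?J ?w
       + l *\<^sub>R (?J (?\<zeta> + ?\<Gamma> ?\<eta> ?w) - ?\<Gamma> ?\<eta> (?J ?w))"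
  define \<sigma> where "\<sigma> = ?\<zeta> + ?\<Gamma> ?w ?\<eta>"
  define \<sigma>' where "\<sigma>' = \<zeta>' + (dGam c ?y ?w ?w ?\<eta> + ?\<Gamma> w' ?\<eta> + ?\<Gamma> ?w ?\<zeta>)"
  note d = yd[unfolded has_vector_derivative_def] wd[folded w'_def, unfolded has_vector_derivative_def]
    \<eta>d[unfolded has_vector_derivative_def] \<zeta>d[folded \<zeta>'_def, unfolded has_vector_derivative_def]
  note G = Gam_sym[OF cy]
  have real: "(f has_real_derivative r) (at t)" if "(f has_derivative f') (at t)" "\<And>h. f' h = h * r" for f f' r
    using that by (simp add: has_field_derivative_def mult_commute_abs[of r] fun_eq_iff ext[of f' "\<lambda>h. h * r"] mult.commute)
  have Jd: "((\<lambda>t. J c (y t) (w t)) has_derivative (\<lambda>h. h *\<^sub>R (- l *\<^sub>R ?w - ?\<Gamma> ?w (?J ?w)))) (at t)"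
  proof -
    have "((\<lambda>t. J c (y t) (w t)) has_derivative (\<lambda>h. ?J (h *\<^sub>R w' + ?\<Gamma> (h *\<^sub>R ?w) ?w) - ?\<Gamma> (h *\<^sub>R ?w) (?J ?w))) (at t)"
      by (rule J_has_derivative[OF cy d(1,2)])
    moreover have "?J (h *\<^sub>R w' + ?\<Gamma> (h *\<^sub>R ?w) ?w) - ?\<Gamma> (h *\<^sub>R ?w) (?J ?w) = h *\<^sub>R (- l *\<^sub>R ?w - ?\<Gamma> ?w (?J ?w))" for h
    proof -
      have "h *\<^sub>R w' + ?\<Gamma> (h *\<^sub>R ?w) ?w = (h * l) *\<^sub>R ?J ?w" by (simp add: w'_def Gam_simps algebra_simps)
      then show ?thesis by (simp add: J_simps J_J[OF cy] Gam_simps algebra_simps)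
    qed
    ultimately show ?thesis by simp
  qed
  have \<sigma>d: "((\<lambda>t. \<zeta> t + Gam c (y t) (w t) (\<eta> t)) has_derivative (\<lambda>h. h *\<^sub>R \<sigma>')) (at t)"
  proof -
    have "((\<lambda>t. \<zeta> t + Gam c (y t) (w t) (\<eta> t)) has_derivative
       (\<lambda>h. h *\<^sub>R \<zeta>' + (dGam c ?y (h *\<^sub>R ?w) ?w ?\<eta> + ?\<Gamma> (h *\<^sub>R w') ?\<eta> + ?\<Gamma> ?w (h *\<^sub>R ?\<zeta>)))) (at t)"
      by (intro has_derivative_add d Gam_has_derivative[where y=y and x=t, OF cy])
    then show ?thesis by (simp add: \<sigma>'_def linear_scale[OF dGam_linear[OF cy]] Gam_simps algebra_simps)
  qed
  have w\<sigma>: "B c ?y ?w \<sigma> = 0" "B c ?y \<sigma> ?w = 0" using w\<sigma> B_sym[OF cy] by (auto simp: \<sigma>_def)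
  show "((\<lambda>t. B c (y t) (\<eta> t) (J c (y t) (w t))) has_real_derivative
      B c ?y (?\<zeta> + ?\<Gamma> ?w ?\<eta>) (?J ?w) - l * B c ?y ?\<eta> ?w) (at t)"
    by (rule real[OF B_has_derivative[OF cy d(1) d(3) Jd]]) (simp add: Gam_simps B_simps algebra_simps)
  have "h *\<^sub>R w' + ?\<Gamma> (h *\<^sub>R ?w) ?w = (h * l) *\<^sub>R ?J ?w" for h by (simp add: w'_def Gam_simps algebra_simps)
  moreover have "h *\<^sub>R ?\<zeta> + ?\<Gamma> (h *\<^sub>R ?w) ?\<eta> = h *\<^sub>R \<sigma>" for h by (simp add: \<sigma>_def Gam_simps algebra_simps)
  ultimately show "((\<lambda>t. B c (y t) (\<eta> t) (w t)) has_real_derivative l * B c ?y ?\<eta> (?J ?w)) (at t)"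
    by (intro real[OF B_has_derivative[OF cy d(1) d(3) d(2)]]) (simp add: B_simps w\<sigma>)
  have \<sigma>R: "\<sigma>' + ?\<Gamma> ?w \<sigma> = Rm c ?y ?w ?\<eta> ?w + l' *\<^sub>R ?J ?w + l *\<^sub>R ?J \<sigma>"
    using G[of ?\<eta> ?w] G[of ?\<zeta> ?w] G[of "?J ?w" ?\<eta>] G[of "?\<Gamma> ?w ?w" ?\<eta>] dGam_sym[OF cy, of ?w ?w ?\<eta>]
    by (simp add: \<sigma>'_def \<zeta>'_def w'_def \<sigma>_def Rm_def Gam_simps J_simps algebra_simps)
  have "B c ?y (h *\<^sub>R \<sigma>' + ?\<Gamma> (h *\<^sub>R ?w) \<sigma>) (?J ?w) + B c ?y \<sigma> (h *\<^sub>R (- l *\<^sub>R ?w - ?\<Gamma> ?w (?J ?w)) + ?\<Gamma> (h *\<^sub>R ?w) (?J ?w)) =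
    h * (- curv c (y t) * B c ?y ?\<eta> (?J ?w) + l')" for h
  proof -
    have "h *\<^sub>R \<sigma>' + ?\<Gamma> (h *\<^sub>R ?w) \<sigma> = h *\<^sub>R (\<sigma>' + ?\<Gamma> ?w \<sigma>)" by (simp add: Gam_simps algebra_simps)
    then have "B c ?y (h *\<^sub>R \<sigma>' + ?\<Gamma> (h *\<^sub>R ?w) \<sigma>) (?J ?w) = h * (B c ?y (Rm c ?y ?w ?\<eta> ?w) (?J ?w) + l')"
      using w1 w\<sigma> by (simp add: \<sigma>R B_simps B_J_J[OF cy])
    moreover have "h *\<^sub>R (- l *\<^sub>R ?w - ?\<Gamma> ?w (?J ?w)) + ?\<Gamma> (h *\<^sub>R ?w) (?J ?w) = - (h * l) *\<^sub>R ?w"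
      by (simp add: Gam_simps algebra_simps)
    ultimately show ?thesis using B_Rm_J[OF cy w1, of ?\<eta>] by (simp add: B_simps w\<sigma>)
  qed
  then show "((\<lambda>t. B c (y t) (\<zeta> t + Gam c (y t) (w t) (\<eta> t)) (J c (y t) (w t))) has_real_derivative
      - curv c (y t) * B c ?y ?\<eta> (?J ?w) + l') (at t)"
    by (intro real[OF B_has_derivative[OF cy d(1) \<sigma>d Jd]]) (simp add: \<sigma>_def)
qed

end

section \<open>Thermostats\<close>

locale thermo = surface A g for A :: "'m::t2_space chart set" and g :: "'m metric" +
  fixes lam :: "'m \<times> (real^2) \<Rightarrow> real"
  assumes lam: "smooth_on_unit_tangent A g lam"
begin

abbreviation "F \<equiv> thermostat_field A g lam"
abbreviation "L c \<equiv> local_rep A g c lam"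

lemma field_eq: "F c u = (snd u, - Gam c (fst u) (snd u) (snd u) + L c u *\<^sub>R J c (fst u) (snd u))"
  by (simp add: thermostat_field_def geodesic_field_eq vertical_field_eq)

lemma L_C1: "c \<in> A \<Longrightarrow> C1_on (punct c) (L c)"
  by (rule smooth_on_C1_on[OF local_rep_smooth[OF lam]])

lemma field_C1:
  assumes "c \<in> A" shows "C1_on (punct c) (F c)"
  unfolding field_eq[abs_def]
  by (intro C1_on_Pair C1_on_add C1_on_minus C1_on_scaleR L_C1[OF assms] C1_on_snd Gam_C1[OF assms] J_C1[OF assms] C1_on_fst)
    (auto simp: mem_Times_iff)

lemma field_Df:
  assumes c: "c \<in> A" and u: "(y, w) \<in> punct c"
  shows "Df (F c) (y, w) (\<eta>, \<zeta>) = (\<zeta>, - (dGam c y \<eta> w w + Gam c y \<zeta> w + Gam c y w \<zeta>)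
     + Df (L c) (y, w) (\<eta>, \<zeta>) *\<^sub>R J c y w + L c (y, w) *\<^sub>R (J c y (\<zeta> + Gam c y \<eta> w) - Gam c y \<eta> (J c y w)))"
proof -
  have y: "fst (y, w) \<in> chart_codom c" using u by (simp add: mem_Times_iff)
  have f: "(fst has_derivative fst) (at (y, w))" and s: "(snd has_derivative snd) (at (y, w))"
    by (auto intro!: derivative_eq_intros)
  have "((\<lambda>u. (snd u, - Gam c (fst u) (snd u) (snd u) + L c u *\<^sub>R J c (fst u) (snd u))) has_derivative
    (\<lambda>h. (snd h, - (dGam c (fst (y, w)) (fst h) (snd (y, w)) (snd (y, w)) + Gam c (fst (y, w)) (snd h) (snd (y, w)) + Gam c (fst (y, w)) (snd (y, w)) (snd h))
      + (L c (y, w) *\<^sub>R (J c (fst (y, w)) (snd h + Gam c (fst (y, w)) (fst h) (snd (y, w))) - Gam c (fst (y, w)) (fst h) (J c (fst (y, w)) (snd (y, w))))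
      + Df (L c) (y, w) h *\<^sub>R J c (fst (y, w)) (snd (y, w)))))) (at (y, w))"
    by (intro has_derivative_Pair has_derivative_add has_derivative_minus has_derivative_scaleR s
        Gam_has_derivative[OF c y f s s] J_has_derivative[OF c y f s] C1_on_D[OF L_C1[OF c] u])
  from Df_apply_eq[OF this] show ?thesis unfolding field_eq[abs_def] by (simp add: algebra_simps)
qed

end

section \<open>The thermostat flow\<close>

lemma compact_uniform_existence:
  fixes F :: "'a::euclidean_space \<Rightarrow> 'a"
  assumes S: "open S" and F: "C1_on S F" and K: "compact K" "K \<subseteq> S"
  shows "\<exists>e>0. \<forall>u\<in>K. \<exists>\<psi>. \<psi> 0 = u \<and> (\<forall>t\<in>{-e<..<e}. \<psi> t \<in> S \<and> (\<psi> has_vector_derivative F (\<psi> t)) (at t))"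
proof -
  have "\<exists>d>0. \<exists>r>0. \<forall>u\<in>ball v r. \<exists>\<psi>. \<psi> 0 = u \<and> (\<forall>t\<in>{-d<..<d}. \<psi> t \<in> S \<and> (\<psi> has_vector_derivative F (\<psi> t)) (at t))"
    if v: "v \<in> K" for v
  proof -
    obtain d r \<psi> where "d > 0" "r > 0" and *: "\<forall>u\<in>ball v r. \<psi> 0 u = u \<and>
      (\<forall>t\<in>{-d<..<d}. \<psi> t u \<in> S \<and> ((\<lambda>t. \<psi> t u) has_vector_derivative F (\<psi> t u)) (at t))"
      using local_flow[OF S F subsetD[OF K(2) v]] by metis
    have "\<exists>\<psi>. \<psi> 0 = u \<and> (\<forall>t\<in>{-d<..<d}. \<psi> t \<in> S \<and> (\<psi> has_vector_derivative F (\<psi> t)) (at t))" if "u \<in> ball v r" for u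
      by (rule exI[of _ "\<lambda>t. \<psi> t u"]) (use * that in blast)
    then show ?thesis using \<open>d > 0\<close> \<open>r > 0\<close> by blast
  qed
  then obtain d r where dr: "\<And>v. v \<in> K \<Longrightarrow> d v > 0" "\<And>v. v \<in> K \<Longrightarrow> r v > 0"
    "\<And>v u. v \<in> K \<Longrightarrow> u \<in> ball v (r v) \<Longrightarrow> \<exists>\<psi>. \<psi> 0 = u \<and> (\<forall>t\<in>{-d v<..<d v}. \<psi> t \<in> S \<and> (\<psi> has_vector_derivative F (\<psi> t)) (at t))"
    by metis
  have "K \<subseteq> (\<Union>v\<in>K. ball v (r v))" using dr(2) by force
  from compactE_image[OF K(1) open_ball this]
  obtain D where D: "D \<subseteq> K" "finite D" "K \<subseteq> (\<Union>v\<in>D. ball v (r v))" by blast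
  define e where "e = Min (insert 1 (d ` D))"
  have e: "e > 0" "\<And>v. v \<in> D \<Longrightarrow> e \<le> d v" using D dr(1) by (auto simp: e_def subset_iff)
  have "\<exists>\<psi>. \<psi> 0 = u \<and> (\<forall>t\<in>{-e<..<e}. \<psi> t \<in> S \<and> (\<psi> has_vector_derivative F (\<psi> t)) (at t))" if "u \<in> K" for u
  proof -
    obtain v where v: "v \<in> D" "u \<in> ball v (r v)" using D(3) \<open>u \<in> K\<close> by blast
    then obtain \<psi> where "\<psi> 0 = u" "\<forall>t\<in>{-d v<..<d v}. \<psi> t \<in> S \<and> (\<psi> has_vector_derivative F (\<psi> t)) (at t)"
      using dr(3) D(1) by (meson subsetD)
    then show ?thesis using e(2)[OF v(1)] by (intro exI[of _ \<psi>]) auto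
  qed
  then show ?thesis using e(1) by blast
qed

lemma isCont_eventually_in_open:
  "isCont f t \<Longrightarrow> open U \<Longrightarrow> f t \<in> U \<Longrightarrow> \<forall>\<^sub>F s in nhds t. f s \<in> U"
  unfolding eventually_nhds using continuous_at_open by blast

lemma isCont_eventually_neq:
  fixes f h :: "'a::t2_space \<Rightarrow> 'b::t2_space"
  assumes "isCont f t" "isCont h t" "f t \<noteq> h t"
  shows "\<forall>\<^sub>F s in nhds t. f s \<noteq> h s"
proof -
  obtain U V where UV: "open U" "open V" "f t \<in> U" "h t \<in> V" "U \<inter> V = {}" using hausdorff[OF assms(3)] by blast
  show ?thesis
    using isCont_eventually_in_open[OF assms(1) UV(1,3)] isCont_eventually_in_open[OF assms(2) UV(2,4)]
    by (rule eventually_elim2) (use UV(5) in auto)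
qed

context thermo begin

definition ic :: "real set \<Rightarrow> (real \<Rightarrow> 'm \<times> (real^2)) \<Rightarrow> bool" where
  "ic I \<gamma> \<longleftrightarrow> (\<forall>t\<in>I. \<gamma> t \<in> unit_tangent g \<and> isCont (\<lambda>t. fst (\<gamma> t)) t \<and>
     (\<forall>c\<in>A. fst (\<gamma> t) \<in> chart_dom c \<longrightarrow>
        ((\<lambda>s. tangent_coord A c (\<gamma> s)) has_vector_derivative F c (tangent_coord A c (\<gamma> t))) (at t)))"

lemma integral_curve_iff: "integral_curve A g F \<gamma> \<longleftrightarrow> ic UNIV \<gamma>"
  by (auto simp: integral_curve_def ic_def continuous_on_eq_continuous_at o_def)

lemma ic_subset: "ic I \<gamma> \<Longrightarrow> K \<subseteq> I \<Longrightarrow> ic K \<gamma>"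
  by (auto simp: ic_def)

lemma ic_Un: "ic I \<gamma> \<Longrightarrow> ic K \<gamma> \<Longrightarrow> ic (I \<union> K) \<gamma>"
  by (auto simp: ic_def)

lemma ic_cong:
  assumes I: "open I" and eq: "\<And>t. t \<in> I \<Longrightarrow> \<gamma> t = \<gamma>' t" and \<gamma>: "ic I \<gamma>"
  shows "ic I \<gamma>'"
  unfolding ic_def
proof (intro ballI conjI impI)
  fix t assume t: "t \<in> I"
  show "\<gamma>' t \<in> unit_tangent g" using \<gamma> t eq by (metis ic_def)
  have ev: "\<forall>\<^sub>F s in nhds t. \<gamma> s = \<gamma>' s" unfolding eventually_nhds using I t eq by blast
  have "isCont (\<lambda>t. fst (\<gamma> t)) t" using \<gamma> t by (simp add: ic_def)
  then show "isCont (\<lambda>t. fst (\<gamma>' t)) t"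
    by (rule isCont_cong[THEN iffD1, rotated]) (use ev in \<open>auto elim: eventually_mono\<close>)
  fix c assume c: "c \<in> A" "fst (\<gamma>' t) \<in> chart_dom c"
  then have "((\<lambda>s. tangent_coord A c (\<gamma> s)) has_vector_derivative F c (tangent_coord A c (\<gamma>' t))) (at t)"
    using \<gamma> t eq[OF t] unfolding ic_def by metis
  then show "((\<lambda>s. tangent_coord A c (\<gamma>' s)) has_vector_derivative F c (tangent_coord A c (\<gamma>' t))) (at t)"
    by (rule has_vector_derivative_transform_within_open[OF _ I t]) (simp add: eq)
qed

lemma ic_shift:
  assumes "ic I \<gamma>" and K: "\<And>t. t \<in> K \<Longrightarrow> t - s \<in> I"
  shows "ic K (\<lambda>t. \<gamma> (t - s))"
  unfolding ic_def
proof (intro ballI conjI impI)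
  fix t assume "t \<in> K"
  then have t: "t - s \<in> I" by (rule K)
  show "\<gamma> (t - s) \<in> unit_tangent g" using assms t by (simp add: ic_def)
  have "isCont (\<lambda>t. fst (\<gamma> t)) (t - s)" using assms t by (simp add: ic_def)
  moreover have "isCont (\<lambda>t. t - s) t" by simp
  ultimately show "isCont (\<lambda>t. fst (\<gamma> (t - s))) t"
    using isCont_o2[of t "\<lambda>t. t - s" "\<lambda>t. fst (\<gamma> t)"] by blast
  fix c assume c: "c \<in> A" "fst (\<gamma> (t - s)) \<in> chart_dom c"
  then have d: "((\<lambda>s. tangent_coord A c (\<gamma> s)) has_vector_derivative F c (tangent_coord A c (\<gamma> (t - s)))) (at (t - s))"
    using assms t by (simp add: ic_def)
  have "((\<lambda>t. t - s) has_vector_derivative 1) (at t)"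
    using has_vector_derivative_diff[OF has_vector_derivative_id has_vector_derivative_const] by simp
  from vector_diff_chain_at[OF this d]
  show "((\<lambda>t. tangent_coord A c (\<gamma> (t - s))) has_vector_derivative F c (tangent_coord A c (\<gamma> (t - s)))) (at t)"
    by (simp add: o_def)
qed

lemma ic_coord:
  assumes \<gamma>: "ic I \<gamma>" and t: "t \<in> I" and c: "c \<in> A" "fst (\<gamma> t) \<in> chart_dom c"
  shows "tangent_coord A c (\<gamma> t) \<in> punct c"
    and "((\<lambda>s. tangent_coord A c (\<gamma> s)) has_vector_derivative F c (tangent_coord A c (\<gamma> t))) (at t)"
    and "B c (fst (tangent_coord A c (\<gamma> t))) (snd (tangent_coord A c (\<gamma> t))) (snd (tangent_coord A c (\<gamma> t))) = 1"
  using \<gamma> t c tangent_coord_unit[OF c _ refl] by (auto simp: ic_def mem_Times_iff)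

lemma ic_near:
  assumes I: "open I" and \<gamma>: "ic I \<gamma>" and t: "t \<in> I" and c: "c \<in> A" "fst (\<gamma> t) \<in> chart_dom c"
  shows "\<exists>r>0. \<forall>s. \<bar>s - t\<bar> < r \<longrightarrow> s \<in> I \<and> fst (\<gamma> s) \<in> chart_dom c"
proof -
  have "isCont (\<lambda>t. fst (\<gamma> t)) t" using \<gamma> t by (simp add: ic_def)
  then have "\<forall>\<^sub>F s in nhds t. fst (\<gamma> s) \<in> chart_dom c"
    by (rule isCont_eventually_in_open[where f="\<lambda>t. fst (\<gamma> t)", OF _ open_chart_dom[OF c(1)] c(2)])
  moreover have "\<forall>\<^sub>F s in nhds t. s \<in> I" using I t by (rule eventually_nhds_in_open)
  ultimately have "\<forall>\<^sub>F s in nhds t. s \<in> I \<and> fst (\<gamma> s) \<in> chart_dom c" by (simp add: eventually_conj_iff)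
  then show ?thesis unfolding eventually_nhds_metric dist_real_def by blast
qed

lemma chart_curve_ic:
  assumes I: "open I" and c: "c \<in> A"
    and u: "\<And>t. t \<in> I \<Longrightarrow> u t \<in> punct c \<and> B c (fst (u t)) (snd (u t)) (snd (u t)) = 1 \<and> (u has_vector_derivative F c (u t)) (at t)"
  shows "ic I (\<lambda>t. tangent_point A c (u t))"
  unfolding ic_def
proof (intro ballI conjI impI)
  fix t assume t: "t \<in> I"
  have ut: "fst (u t) \<in> chart_codom c" "snd (u t) \<noteq> 0" using u[OF t] by (auto simp: mem_Times_iff)
  show "tangent_point A c (u t) \<in> unit_tangent g" using unit_tangent_iff[OF c ut(1)] u[OF t] by simp
  have cu: "isCont u t" using u[OF t] has_vector_derivative_continuous by blast
  have "isCont (\<lambda>t. fst (u t)) t" using cu by (intro continuous_intros)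
  then show "isCont (\<lambda>t. fst (tangent_point A c (u t))) t"
    unfolding fst_tangent_point
    by (rule isCont_o2) (use continuous_on_interior[OF chart_inv_cont[OF c]] ut(1) open_chart_codom[OF c] in \<open>simp add: interior_open\<close>)
  fix d assume d: "d \<in> A" "fst (tangent_point A c (u t)) \<in> chart_dom d"
  have o: "fst (u t) \<in> overlap c d" using d ut by (simp add: mem_overlap[OF c] fst_tangent_point)
  have dt: "tangent_coord A d (tangent_point A c (u s)) = btrans c d (u s)" if "u s \<in> overlap c d \<times> UNIV" for s
  proof -
    have s: "fst (u s) \<in> overlap c d" using that by (simp add: mem_Times_iff)
    have "fst (btrans c d (u s)) \<in> chart_codom d"
      using overlap_codom[OF d(1) transition_overlap[OF c d(1) s]] by (simp add: btrans_def)
    then show ?thesis using tangent_coord_point[OF d(1)] tangent_point_trans[OF c d(1) s] by metis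
  qed
  have "(btrans c d \<circ> u has_vector_derivative dbtrans c d (u t) (F c (u t))) (at t)"
    by (rule vector_derivative_diff_chain_within[where f=u and x=t, OF _ has_derivative_at_withinI[OF btrans_has_derivative[OF c d(1) o]]])
      (use u[OF t] in blast)
  moreover have Fd: "dbtrans c d (u t) (F c (u t)) = F d (btrans c d (u t))"
    using thermostat_field_invariant c d(1) o ut(2) unfolding invariant_field_def by blast
  ultimately have D: "((\<lambda>s. btrans c d (u s)) has_vector_derivative F d (btrans c d (u t))) (at t)"
    by (simp add: o_def)
  have ot: "u t \<in> overlap c d \<times> UNIV" using o by (simp add: mem_Times_iff)
  have "\<forall>\<^sub>F s in nhds t. u s \<in> overlap c d \<times> UNIV"
    by (rule isCont_eventually_in_open[OF cu open_overlap_UNIV[OF c d(1)] ot])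
  then obtain N where N: "open N" "t \<in> N" "\<And>s. s \<in> N \<Longrightarrow> u s \<in> overlap c d \<times> UNIV" unfolding eventually_nhds by blast
  show "((\<lambda>s. tangent_coord A d (tangent_point A c (u s))) has_vector_derivative F d (tangent_coord A d (tangent_point A c (u t)))) (at t)"
    unfolding dt[OF ot] by (rule has_vector_derivative_transform_within_open[OF D N(1,2)]) (simp add: dt N(3))
qed

lemma speed_constant:
  fixes u :: "real \<Rightarrow> (real^2) \<times> (real^2)"
  assumes c: "c \<in> A" and u: "\<And>t. t \<in> {a<..<b} \<Longrightarrow> fst (u t) \<in> chart_codom c"
    and d: "\<And>t. t \<in> {a<..<b} \<Longrightarrow> (u has_vector_derivative (snd (u t), - Gam c (fst (u t)) (snd (u t)) (snd (u t)) + l t *\<^sub>R J c (fst (u t)) (snd (u t)))) (at t)"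
    and st: "s \<in> {a<..<b}" "t \<in> {a<..<b}"
  shows "B c (fst (u t)) (snd (u t)) (snd (u t)) = B c (fst (u s)) (snd (u s)) (snd (u s))"
proof -
  have "((\<lambda>t. B c (fst (u t)) (snd (u t)) (snd (u t))) has_field_derivative 0) (at t within {a<..<b})" if t: "t \<in> {a<..<b}" for t
  proof -
    note ud = d[OF t, unfolded has_vector_derivative_def]
    let ?y = "fst (u t)" let ?w = "snd (u t)"
    have f: "((\<lambda>t. fst (u t)) has_derivative (\<lambda>h. h *\<^sub>R ?w)) (at t)"
      using has_derivative_fst[OF ud] by simp
    have s: "((\<lambda>t. snd (u t)) has_derivative (\<lambda>h. h *\<^sub>R (- Gam c ?y ?w ?w + l t *\<^sub>R J c ?y ?w))) (at t)"
      using has_derivative_snd[OF ud] by simp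
    have "((\<lambda>t. B c (fst (u t)) (snd (u t)) (snd (u t))) has_derivative
       (\<lambda>h. B c ?y (h *\<^sub>R (- Gam c ?y ?w ?w + l t *\<^sub>R J c ?y ?w) + Gam c ?y (h *\<^sub>R ?w) ?w) ?w
         + B c ?y ?w (h *\<^sub>R (- Gam c ?y ?w ?w + l t *\<^sub>R J c ?y ?w) + Gam c ?y (h *\<^sub>R ?w) ?w))) (at t)"
      by (rule B_has_derivative[where y="\<lambda>t. fst (u t)" and x=t, OF c u[OF t] f s s])
    moreover have e: "h *\<^sub>R (- Gam c ?y ?w ?w + l t *\<^sub>R J c ?y ?w) + Gam c ?y (h *\<^sub>R ?w) ?w = (h * l t) *\<^sub>R J c ?y ?w" for h
      by (simp add: Gam_simps algebra_simps)
    ultimately have "((\<lambda>t. B c (fst (u t)) (snd (u t)) (snd (u t))) has_derivative (\<lambda>h. 0)) (at t)"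
      unfolding e B_simps B_J_skew[OF c u[OF t]] B_J_self[OF c u[OF t]] by simp
    then show ?thesis by (simp add: has_field_derivative_def has_derivative_at_withinI lambda_zero)
  qed
  from has_field_derivative_zero_constant[OF convex_real_interval(8) this] st show ?thesis by auto
qed

lemma solution_unit:
  assumes c: "c \<in> A" and u: "\<And>t. t \<in> {a<..<b} \<Longrightarrow> u t \<in> punct c \<and> (u has_vector_derivative F c (u t)) (at t)"
    and s: "s \<in> {a<..<b}" "B c (fst (u s)) (snd (u s)) (snd (u s)) = 1"
  shows "ic {a<..<b} (\<lambda>t. tangent_point A c (u t))"
proof (rule chart_curve_ic[OF _ c])
  fix t assume t: "t \<in> {a<..<b}"
  have "B c (fst (u t)) (snd (u t)) (snd (u t)) = B c (fst (u s)) (snd (u s)) (snd (u s))"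
    by (rule speed_constant[OF c _ _ s(1) t, where l="\<lambda>t. L c (u t)"]) (use u in \<open>auto simp: mem_Times_iff field_eq\<close>)
  then show "u t \<in> punct c \<and> B c (fst (u t)) (snd (u t)) (snd (u t)) = 1 \<and> (u has_vector_derivative F c (u t)) (at t)"
    using u[OF t] s by simp
qed simp

lemma ic_unique:
  assumes I: "I = {a<..<b} \<or> I = UNIV" and \<gamma>: "ic I \<gamma>1" "ic I \<gamma>2" and t0: "t0 \<in> I" "\<gamma>1 t0 = \<gamma>2 t0" and t: "t \<in> I"
  shows "\<gamma>1 t = \<gamma>2 t"
proof (rule connected_induction_simple[where S=I and a=t0 and P="\<lambda>t. \<gamma>1 t = \<gamma>2 t"])
  have oI: "open I" using I by auto
  show "connected I" using I by (auto simp: convex_connected)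
  fix s assume s: "s \<in> I"
  define c where "c = chart_at A (fst (\<gamma>1 s))"
  have c: "c \<in> A" "fst (\<gamma>1 s) \<in> chart_dom c" using chart_at by (auto simp: c_def)
  have "\<exists>T. open T \<and> s \<in> T \<and> T \<subseteq> I \<and> (\<forall>x\<in>T. \<forall>y\<in>T. \<gamma>1 x = \<gamma>2 x \<longrightarrow> \<gamma>1 y = \<gamma>2 y)"
  proof (cases "\<gamma>1 s = \<gamma>2 s")
    case True
    then have c2: "fst (\<gamma>2 s) \<in> chart_dom c" using c by simp
    obtain r1 where r1: "r1 > 0" "\<And>t. \<bar>t - s\<bar> < r1 \<Longrightarrow> t \<in> I \<and> fst (\<gamma>1 t) \<in> chart_dom c"
      using ic_near[OF oI \<gamma>(1) s c] by blast
    obtain r2 where r2: "r2 > 0" "\<And>t. \<bar>t - s\<bar> < r2 \<Longrightarrow> t \<in> I \<and> fst (\<gamma>2 t) \<in> chart_dom c"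
      using ic_near[OF oI \<gamma>(2) s c(1) c2] by blast
    define r where "r = min r1 r2"
    have r: "r > 0" "\<And>t. \<bar>t - s\<bar> < r \<Longrightarrow> t \<in> I \<and> fst (\<gamma>1 t) \<in> chart_dom c \<and> fst (\<gamma>2 t) \<in> chart_dom c"
      using r1 r2 by (auto simp: r_def)
    have "\<exists>r'>0. \<forall>t. \<bar>t - s\<bar> < r' \<longrightarrow> tangent_coord A c (\<gamma>1 t) = tangent_coord A c (\<gamma>2 t)"
      by (rule ode_local_unique[OF open_punct[OF c(1)] field_C1[OF c(1)] r(1)])
        (use r(2) ic_coord[OF \<gamma>(1)] ic_coord[OF \<gamma>(2)] c(1) True in auto)
    then obtain r' where r': "r' > 0" "\<And>t. \<bar>t - s\<bar> < r' \<Longrightarrow> tangent_coord A c (\<gamma>1 t) = tangent_coord A c (\<gamma>2 t)" by blast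
    have "\<gamma>1 t = \<gamma>2 t" if "\<bar>t - s\<bar> < min r r'" for t
      using that r(2)[of t] r'(2)[of t] tangent_point_coord[OF c(1)] by (metis min_less_iff_conj)
    then show ?thesis using r r'(1) by (intro exI[of _ "ball s (min r r')"]) (auto simp: dist_real_def abs_minus_commute)
  next
    case False
    have "\<exists>T. open T \<and> s \<in> T \<and> (\<forall>x\<in>T. \<gamma>1 x \<noteq> \<gamma>2 x)"
    proof (cases "fst (\<gamma>1 s) = fst (\<gamma>2 s)")
      case True
      then have c2: "fst (\<gamma>2 s) \<in> chart_dom c" using c by simp
      have "tangent_coord A c (\<gamma>1 s) \<noteq> tangent_coord A c (\<gamma>2 s)"
        using False tangent_point_coord[OF c] tangent_point_coord[OF c(1) c2] by metis
      moreover have "isCont (\<lambda>s. tangent_coord A c (\<gamma>1 s)) s" "isCont (\<lambda>s. tangent_coord A c (\<gamma>2 s)) s"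
        using ic_coord(2)[OF \<gamma>(1) s c] ic_coord(2)[OF \<gamma>(2) s c(1) c2] has_vector_derivative_continuous by blast+
      ultimately have "\<forall>\<^sub>F x in nhds s. tangent_coord A c (\<gamma>1 x) \<noteq> tangent_coord A c (\<gamma>2 x)"
        by (intro isCont_eventually_neq)
      then have "\<forall>\<^sub>F x in nhds s. \<gamma>1 x \<noteq> \<gamma>2 x"
        by (rule eventually_mono) auto
      then show ?thesis unfolding eventually_nhds by blast
    next
      case f: False
      have "isCont (\<lambda>s. fst (\<gamma>1 s)) s" "isCont (\<lambda>s. fst (\<gamma>2 s)) s" using \<gamma> s by (auto simp: ic_def)
      with f have "\<forall>\<^sub>F x in nhds s. fst (\<gamma>1 x) \<noteq> fst (\<gamma>2 x)"
        by (intro isCont_eventually_neq)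
      then have "\<forall>\<^sub>F x in nhds s. \<gamma>1 x \<noteq> \<gamma>2 x"
        by (rule eventually_mono) auto
      then show ?thesis unfolding eventually_nhds by blast
    qed
    then obtain T where "open T" "s \<in> T" "\<forall>x\<in>T. \<gamma>1 x \<noteq> \<gamma>2 x" by blast
    then show ?thesis using oI s by (intro exI[of _ "T \<inter> I"]) auto
  qed
  then obtain T where T: "open T" "s \<in> T" "T \<subseteq> I" "\<forall>x\<in>T. \<forall>y\<in>T. \<gamma>1 x = \<gamma>2 x \<longrightarrow> \<gamma>1 y = \<gamma>2 y" by blast
  then show "\<exists>T. openin (top_of_set I) T \<and> s \<in> T \<and> (\<forall>x\<in>T. \<forall>y\<in>T. \<gamma>1 x = \<gamma>2 x \<longrightarrow> \<gamma>1 y = \<gamma>2 y)"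
    using oI by (intro exI[of _ T]) (auto simp: openin_open_eq)
qed (use t0 t in auto)

lemma C1_B:
  assumes "c \<in> A" "C1_on S y" "C1_on S u" "C1_on S v" "\<And>x. x \<in> S \<Longrightarrow> y x \<in> chart_codom c"
  shows "C1_on S (\<lambda>x. B c (y x) (u x) (v x))"
  unfolding B_expand
  by (intro C1_on_add C1_on_mult C1_on_vec_nth assms
      C1_on_compose[OF assms(2) smooth_on_C1_on[OF metric_nth_smooth[OF assms(1)]] assms(5)])

lemma unit_vectors_bounds:
  assumes c: "c \<in> A" and K: "compact K" "K \<subseteq> chart_codom c" "K \<noteq> {}"
  shows "\<exists>\<mu>>0. \<exists>\<nu>>0. \<forall>y\<in>K. \<forall>w. \<mu> * (norm w)\<^sup>2 \<le> B c y w w \<and> B c y w w \<le> \<nu> * (norm w)\<^sup>2"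
proof -
  define C where "C = K \<times> sphere (0 :: real^2) 1"
  have "compact C" unfolding C_def by (intro compact_Times K compact_sphere)
  have "axis 1 1 \<in> sphere (0 :: real^2) 1" by simp
  then have "C \<noteq> {}" using K(3) by (auto simp: C_def)
  have "C1_on (chart_codom c \<times> UNIV) (\<lambda>u. B c (fst u) (snd u) (snd u))"
    by (intro C1_B[OF c] C1_on_fst C1_on_snd) (auto simp: mem_Times_iff)
  then have cont: "continuous_on C (\<lambda>u. B c (fst u) (snd u) (snd u))"
    by (rule continuous_on_subset[OF C1_on_continuous]) (use K in \<open>auto simp: C_def\<close>)
  obtain u1 where u1: "u1 \<in> C" "\<And>u. u \<in> C \<Longrightarrow> B c (fst u1) (snd u1) (snd u1) \<le> B c (fst u) (snd u) (snd u)"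
    using continuous_attains_inf[OF \<open>compact C\<close> \<open>C \<noteq> {}\<close> cont] by blast
  obtain u2 where u2: "u2 \<in> C" "\<And>u. u \<in> C \<Longrightarrow> B c (fst u) (snd u) (snd u) \<le> B c (fst u2) (snd u2) (snd u2)"
    using continuous_attains_sup[OF \<open>compact C\<close> \<open>C \<noteq> {}\<close> cont] by blast
  define \<mu> \<nu> where "\<mu> = B c (fst u1) (snd u1) (snd u1)" and "\<nu> = B c (fst u2) (snd u2) (snd u2)"
  have pos: "B c (fst u) (snd u) (snd u) > 0" if "u \<in> C" for u
    using that K by (intro B_pos[OF c]) (auto simp: C_def mem_Times_iff)
  have "\<mu> * (norm w)\<^sup>2 \<le> B c y w w \<and> B c y w w \<le> \<nu> * (norm w)\<^sup>2" if "y \<in> K" for y w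
  proof (cases "w = 0")
    case False
    define e where "e = (1 / norm w) *\<^sub>R w"
    have w: "w = norm w *\<^sub>R e" using False by (simp add: e_def)
    have "(y, e) \<in> C" using that False by (simp add: C_def e_def)
    then have e: "\<mu> \<le> B c y e e" "B c y e e \<le> \<nu>" using u1(2) u2(2) by (force simp: \<mu>_def \<nu>_def)+
    have "B c y w w = (norm w)\<^sup>2 * B c y e e" by (subst (1 2) w) (simp add: B_simps power2_eq_square)
    then show ?thesis using mult_left_mono[OF e(1), of "(norm w)\<^sup>2"] mult_left_mono[OF e(2), of "(norm w)\<^sup>2"] by (simp add: mult.commute)
  qed (simp add: B_simps)
  then show ?thesis using pos[OF u1(1)] pos[OF u2(1)] by (auto simp flip: \<mu>_def \<nu>_def)
qed

lemma local_existence: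
  "\<exists>e>0. \<exists>U. open U \<and> x \<in> U \<and> (\<forall>v\<in>unit_tangent g. fst v \<in> U \<longrightarrow> (\<exists>\<gamma>. \<gamma> 0 = v \<and> ic {-e<..<e} \<gamma>))"
proof -
  define c where "c = chart_at A x"
  have c: "c \<in> A" "x \<in> chart_dom c" using chart_at by (auto simp: c_def)
  obtain r where r: "r > 0" "cball (chart_map c x) r \<subseteq> chart_codom c"
    using open_contains_cball[of "chart_codom c"] open_chart_codom[OF c(1)] c(2) by auto
  define K where "K = cball (chart_map c x) r"
  obtain \<mu> \<nu> where \<mu>: "\<mu> > 0" "\<nu> > 0" "\<And>y w. y \<in> K \<Longrightarrow> \<mu> * (norm w)\<^sup>2 \<le> B c y w w \<and> B c y w w \<le> \<nu> * (norm w)\<^sup>2"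
    using unit_vectors_bounds[OF c(1), of K] r by (auto simp: K_def)
  define Q where "Q = K \<times> (cball (0 :: real^2) (sqrt (1 / \<mu>)) - ball 0 (sqrt (1 / \<nu>)))"
  have "compact Q" unfolding Q_def K_def by (intro compact_Times compact_diff) auto
  moreover have "Q \<subseteq> punct c" using r \<mu> by (auto simp: Q_def K_def)
  ultimately obtain e where e: "e > 0" "\<And>u. u \<in> Q \<Longrightarrow> \<exists>\<psi>. \<psi> 0 = u \<and> (\<forall>t\<in>{-e<..<e}. \<psi> t \<in> punct c \<and> (\<psi> has_vector_derivative F c (\<psi> t)) (at t))"
    using compact_uniform_existence[OF open_punct[OF c(1)] field_C1[OF c(1)]] by metis
  define U where "U = chart_dom c \<inter> chart_map c -` ball (chart_map c x) r"
  have "open U" unfolding U_def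
    by (rule continuous_open_preimage[OF chart_map_cont[OF c(1)] open_chart_dom[OF c(1)] open_ball])
  moreover have "x \<in> U" using c r by (simp add: U_def)
  moreover have "\<exists>\<gamma>. \<gamma> 0 = v \<and> ic {-e<..<e} \<gamma>" if v: "v \<in> unit_tangent g" "fst v \<in> U" for v
  proof -
    define u where "u = tangent_coord A c v"
    have vc: "fst v \<in> chart_dom c" using v by (simp add: U_def)
    note u = tangent_coord_unit[OF c(1) vc v(1) u_def]
    have fu: "fst u \<in> K" using v by (simp add: u_def fst_tangent_coord U_def K_def)
    have "\<mu> * (norm (snd u))\<^sup>2 \<le> 1" "1 \<le> \<nu> * (norm (snd u))\<^sup>2" using \<mu>(3)[OF fu, of "snd u"] u by auto
    then have "(norm (snd u))\<^sup>2 \<le> 1 / \<mu>" "1 / \<nu> \<le> (norm (snd u))\<^sup>2" using \<mu> by (auto simp: field_simps)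
    then have "norm (snd u) \<le> sqrt (1 / \<mu>)" "sqrt (1 / \<nu>) \<le> norm (snd u)"
      by (auto intro: real_le_rsqrt real_le_lsqrt)
    then have "u \<in> Q" using fu by (cases u) (auto simp: Q_def)
    then obtain \<psi> where \<psi>: "\<psi> 0 = u" "\<And>t. t \<in> {-e<..<e} \<Longrightarrow> \<psi> t \<in> punct c \<and> (\<psi> has_vector_derivative F c (\<psi> t)) (at t)"
      using e(2) by blast
    have "ic {-e<..<e} (\<lambda>t. tangent_point A c (\<psi> t))"
      by (rule solution_unit[OF c(1) \<psi>(2), of _ _ 0]) (use e(1) \<psi>(1) u in auto)
    moreover have "tangent_point A c (\<psi> 0) = v" using \<psi>(1) tangent_point_coord[OF c(1) vc] by (simp add: u_def)
    ultimately show ?thesis by (intro exI[of _ "\<lambda>t. tangent_point A c (\<psi> t)"]) simp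
  qed
  ultimately show ?thesis using e(1) by blast
qed

definition flow_on :: "real \<Rightarrow> bool" where
  "flow_on a \<longleftrightarrow> (\<forall>v\<in>unit_tangent g. \<exists>\<gamma>. \<gamma> 0 = v \<and> ic {-a<..<a} \<gamma>)"

lemma uniform_existence: "\<exists>e>0. flow_on e"
proof -
  obtain e U where eU: "\<And>x. e x > 0" "\<And>x. open (U x)" "\<And>x. x \<in> U x"
    "\<And>x v. v \<in> unit_tangent g \<Longrightarrow> fst v \<in> U x \<Longrightarrow> \<exists>\<gamma>. \<gamma> 0 = v \<and> ic {-e x<..<e x} \<gamma>"
    using local_existence by metis
  have "UNIV \<subseteq> (\<Union>x\<in>UNIV. U x)" using eU(3) by blast
  then obtain D where D: "finite D" "UNIV \<subseteq> (\<Union>x\<in>D. U x)"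
    using compactE_image[OF compact_UNIV_surface, of UNIV U] eU(2) by metis
  define \<epsilon> where "\<epsilon> = Min (insert 1 (e ` D))"
  have \<epsilon>: "\<epsilon> > 0" "\<And>x. x \<in> D \<Longrightarrow> \<epsilon> \<le> e x" using D eU(1) by (auto simp: \<epsilon>_def)
  have "flow_on \<epsilon>" unfolding flow_on_def
  proof
    fix v assume v: "v \<in> unit_tangent g"
    obtain x where x: "x \<in> D" "fst v \<in> U x" using D(2) by blast
    obtain \<gamma> where "\<gamma> 0 = v" "ic {-e x<..<e x} \<gamma>" using eU(4)[OF v x(2)] by blast
    then show "\<exists>\<gamma>. \<gamma> 0 = v \<and> ic {-\<epsilon><..<\<epsilon>} \<gamma>"
      using \<epsilon>(2)[OF x(1)] by (intro exI[of _ \<gamma>]) (auto elim!: ic_subset)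
  qed
  then show ?thesis using \<epsilon>(1) by blast
qed

lemma flow_on_extend:
  assumes a: "a > 0" "flow_on a"
  shows "flow_on (3/2 * a)"
  unfolding flow_on_def
proof
  fix v assume v: "v \<in> unit_tangent g"
  obtain \<gamma> where \<gamma>: "\<gamma> 0 = v" "ic {-a<..<a} \<gamma>" using a v by (auto simp: flow_on_def)
  have "\<gamma> (a/2) \<in> unit_tangent g" "\<gamma> (-a/2) \<in> unit_tangent g" using \<gamma>(2) a by (auto simp: ic_def)
  then obtain \<gamma>1 \<gamma>2 where \<gamma>1: "\<gamma>1 0 = \<gamma> (a/2)" "ic {-a<..<a} \<gamma>1" and \<gamma>2: "\<gamma>2 0 = \<gamma> (-a/2)" "ic {-a<..<a} \<gamma>2"
    using a by (metis flow_on_def)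
  have s1: "ic {-a/2<..<3/2*a} (\<lambda>t. \<gamma>1 (t - a/2))" by (rule ic_shift[OF \<gamma>1(2)]) auto
  have s2: "ic {-3/2*a<..<a/2} (\<lambda>t. \<gamma>2 (t - (-a/2)))" by (rule ic_shift[OF \<gamma>2(2)]) auto
  have e1: "\<gamma>1 (t - a/2) = \<gamma> t" if "t \<in> {-a/2<..<a}" for t
    by (rule ic_unique[OF disjI1[OF refl] ic_subset[OF s1] ic_subset[OF \<gamma>(2)] _ _ that, of "a/2"]) (use a \<gamma>1 in auto)
  have e2: "\<gamma>2 (t - (-a/2)) = \<gamma> t" if "t \<in> {-a<..<a/2}" for t
    by (rule ic_unique[OF disjI1[OF refl] ic_subset[OF s2] ic_subset[OF \<gamma>(2)] _ _ that, of "-a/2"]) (use a \<gamma>2 in auto)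
  define G where "G t = (if t \<ge> a/2 then \<gamma>1 (t - a/2) else if t \<le> -a/2 then \<gamma>2 (t - (-a/2)) else \<gamma> t)" for t
  have "ic {-a/2<..<3/2*a} G"
    by (rule ic_cong[OF _ _ s1]) (use e1 a in \<open>auto simp: G_def\<close>)
  moreover have "ic {-3/2*a<..<a/2} G"
    by (rule ic_cong[OF _ _ s2]) (use e2 a in \<open>auto simp: G_def\<close>)
  ultimately have "ic ({-a/2<..<3/2*a} \<union> {-3/2*a<..<a/2}) G" by (rule ic_Un)
  then have "ic {-(3/2*a)<..<3/2*a} G" by (rule ic_subset) (use a in auto)
  moreover have "G 0 = v" using a \<gamma> by (simp add: G_def)
  ultimately show "\<exists>\<gamma>. \<gamma> 0 = v \<and> ic {-(3/2 * a)<..<3/2 * a} \<gamma>" by blast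
qed

lemma global_existence:
  assumes v: "v \<in> unit_tangent g"
  shows "\<exists>\<gamma>. \<gamma> 0 = v \<and> ic UNIV \<gamma>"
proof -
  obtain e where e: "e > 0" "flow_on e" using uniform_existence by blast
  define a where "a n = (3/2) ^ n * e" for n :: nat
  have a: "a n > 0" for n using e by (simp add: a_def)
  have "flow_on (a n)" for n
  proof (induction n)
    case (Suc n)
    from flow_on_extend[OF a this] show ?case by (simp add: a_def mult.assoc)
  qed (use e in \<open>simp add: a_def\<close>)
  then have "\<forall>n. \<exists>\<gamma>. \<gamma> 0 = v \<and> ic {-a n<..<a n} \<gamma>" using v unfolding flow_on_def by blast
  from choice[OF this] obtain \<gamma> where \<gamma>: "\<And>n. \<gamma> n 0 = v" "\<And>n. ic {-a n<..<a n} (\<gamma> n)" by blast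
  have ex: "\<exists>n. \<bar>t\<bar> < a n" for t
    using real_arch_pow[of "3/2" "\<bar>t\<bar> / e"] e by (auto simp: a_def field_simps)
  define N where "N t = (LEAST n. \<bar>t\<bar> < a n)" for t
  have N: "\<bar>t\<bar> < a (N t)" for t unfolding N_def by (rule LeastI_ex[OF ex])
  define G where "G t = \<gamma> (N t) t" for t
  have G: "G t = \<gamma> n t" if "t \<in> {-a n<..<a n}" for n t
  proof -
    define b where "b = min (a n) (a (N t))"
    have b: "b > 0" "t \<in> {-b<..<b}" using that N[of t] a by (auto simp: b_def)
    show ?thesis unfolding G_def
      by (rule ic_unique[OF disjI1[OF refl] ic_subset[OF \<gamma>(2)] ic_subset[OF \<gamma>(2)] _ _ b(2), of _ _ 0]) (use b \<gamma>(1) in \<open>auto simp: b_def\<close>)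
  qed
  have "ic UNIV G" unfolding ic_def
  proof
    fix t
    have "ic {-a (N t)<..<a (N t)} G"
      by (rule ic_cong[OF _ _ \<gamma>(2)]) (use G in auto)
    moreover have "t \<in> {-a (N t)<..<a (N t)}" using N[of t] by auto
    ultimately show "G t \<in> unit_tangent g \<and> isCont (\<lambda>t. fst (G t)) t \<and>
       (\<forall>c\<in>A. fst (G t) \<in> chart_dom c \<longrightarrow>
         ((\<lambda>s. tangent_coord A c (G s)) has_vector_derivative F c (tangent_coord A c (G t))) (at t))"
      unfolding ic_def by blast
  qed
  moreover have "G 0 = v" using G[of 0 0] a \<gamma> by auto
  ultimately show ?thesis by blast
qed

abbreviation "\<Phi> t v \<equiv> thermostat_flow A g lam t v"

lemma flow:
  assumes v: "v \<in> unit_tangent g"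
  shows flow_ic: "ic UNIV (\<lambda>t. \<Phi> t v)" and flow_0: "\<Phi> 0 v = v"
proof -
  obtain \<gamma> where \<gamma>: "\<gamma> 0 = v" "ic UNIV \<gamma>" using global_existence[OF v] by blast
  have "(THE \<gamma>. integral_curve A g F \<gamma> \<and> \<gamma> 0 = v) = \<gamma>"
  proof (rule the_equality)
    fix \<gamma>' assume "integral_curve A g F \<gamma>' \<and> \<gamma>' 0 = v"
    then show "\<gamma>' = \<gamma>" using \<gamma> ic_unique[of UNIV 0 0 \<gamma>' \<gamma> 0] by (auto simp: integral_curve_iff fun_eq_iff)
  qed (use \<gamma> integral_curve_iff in auto)
  then have "thermostat_flow A g lam t v = \<gamma> t" for t by (simp add: thermostat_flow_def)
  then show "ic UNIV (\<lambda>t. \<Phi> t v)" "\<Phi> 0 v = v" using \<gamma> by auto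
qed

lemma flow_unit: "v \<in> unit_tangent g \<Longrightarrow> \<Phi> t v \<in> unit_tangent g"
  using flow_ic[of v] by (simp add: ic_def)

lemma ic_eq_flow:
  assumes "ic {a<..<b} \<gamma>" "0 \<in> {a<..<b}" "t \<in> {a<..<b}"
  shows "\<gamma> t = \<Phi> t (\<gamma> 0)"
proof -
  have u: "\<gamma> 0 \<in> unit_tangent g" using assms by (simp add: ic_def)
  show ?thesis
    by (rule ic_unique[OF disjI1[OF refl] assms(1) ic_subset[OF flow_ic[OF u]] assms(2) _ assms(3)]) (use flow_0[OF u] in auto)
qed

lemma flow_add:
  assumes v: "v \<in> unit_tangent g"
  shows "\<Phi> (s + t) v = \<Phi> s (\<Phi> t v)"
proof -
  have "ic UNIV (\<lambda>s. \<Phi> (s - (-t)) v)" by (rule ic_shift[OF flow_ic[OF v]]) auto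
  from ic_unique[OF disjI2[OF refl] this flow_ic[OF flow_unit[OF v, of t]], of 0 s]
  show ?thesis using flow_0[OF flow_unit[OF v]] by simp
qed

end

section \<open>Differentiability of the flow\<close>

lemma positive_solution:
  fixes x z m p \<kappa> :: "real \<Rightarrow> real"
  assumes x: "\<And>t. (x has_real_derivative z t + p t * x t) (at t)"
    and z: "\<And>t. (z has_real_derivative m t * z t - \<kappa> t * x t) (at t)"
    and \<kappa>: "\<And>t. \<kappa> t \<le> 0" and mp: "\<And>t. isCont m t" "\<And>t. isCont p t"
    and 0: "x 0 = 0" "z 0 = 1" and T: "T > 0"
  shows "x T > 0"
proof -
  have anti: "\<exists>M. \<forall>t\<in>{0..T}. (M has_real_derivative m t) (at t)" if "\<And>t. isCont m t" for m :: "real \<Rightarrow> real"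
  proof -
    have "continuous_on {-1..T+1} m" using that by (simp add: continuous_at_imp_continuous_on)
    then obtain M where M: "\<And>t. t \<in> {-1..T+1} \<Longrightarrow> (M has_vector_derivative m t) (at t within {-1..T+1})"
      using antiderivative_continuous by blast
    have "(M has_real_derivative m t) (at t)" if "t \<in> {0..T}" for t
    proof -
      have "at t within {-1..T+1} = at t" using that by (intro at_within_interior) auto
      then show ?thesis using M[of t] that by (simp add: has_real_derivative_iff_has_vector_derivative)
    qed
    then show ?thesis by blast
  qed
  obtain M P where M: "\<And>t. t \<in> {0..T} \<Longrightarrow> (M has_real_derivative m t) (at t)"
    and P: "\<And>t. t \<in> {0..T} \<Longrightarrow> (P has_real_derivative p t) (at t)"
    using anti[of m, OF mp(1)] anti[of p, OF mp(2)] by blast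
  define \<xi> where "\<xi> t = x t * exp (- P t)" for t
  define \<zeta> where "\<zeta> t = z t * exp (- M t)" for t
  have \<xi>d: "(\<xi> has_real_derivative z t * exp (- P t)) (at t)" if "t \<in> {0..T}" for t
    unfolding \<xi>_def[abs_def] by (auto intro!: derivative_eq_intros x P that simp: algebra_simps)
  have \<zeta>d: "(\<zeta> has_real_derivative - \<kappa> t * x t * exp (- M t)) (at t)" if "t \<in> {0..T}" for t
    unfolding \<zeta>_def[abs_def] by (auto intro!: derivative_eq_intros z M that simp: algebra_simps)
  have c\<xi>: "continuous_on {0..t} \<xi>" and c\<zeta>: "continuous_on {0..t} \<zeta>" if "t \<le> T" for t
    using DERIV_isCont[OF \<xi>d] DERIV_isCont[OF \<zeta>d] that by (auto intro!: continuous_at_imp_continuous_on)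
  have \<xi>_mono: "\<xi> t \<ge> 0" if t: "t \<in> {0..T}" and "\<And>s. 0 \<le> s \<Longrightarrow> s < t \<Longrightarrow> \<zeta> s > 0" for t
  proof -
    have "\<xi> 0 \<le> \<xi> t"
    proof (rule DERIV_nonneg_imp_increasing_open[where f=\<xi> and a=0 and b=t])
      fix r assume r: "0 < r" "r < t"
      then have "0 \<le> z r * exp (- P r)" using that(2)[of r] by (simp add: \<zeta>_def zero_less_mult_iff)
      then show "\<exists>y. DERIV \<xi> r :> y \<and> 0 \<le> y" using \<xi>d[of r] r t by auto
    qed (use t c\<xi> in auto)
    then show ?thesis by (simp add: \<xi>_def 0)
  qed
  have pos: "\<zeta> t > 0" if t: "t \<in> {0..T}" for t
  proof (rule ccontr)
    assume neg: "\<not> \<zeta> t > 0"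
    define S where "S = {0..T} \<inter> \<zeta> -` {..0}"
    have "closed S" unfolding S_def
      by (rule continuous_closed_preimage[OF c\<zeta>]) auto
    moreover have "S \<noteq> {}" using neg t by (auto simp: S_def)
    moreover have "bdd_below S" by (auto simp: S_def bdd_below_def)
    ultimately have s: "Inf S \<in> S" by (intro closed_contains_Inf)
    define s where "s = Inf S"
    have sS: "s \<in> {0..T}" "\<zeta> s \<le> 0" using s by (auto simp: s_def S_def)
    have lt: "\<zeta> r > 0" if "0 \<le> r" "r < s" for r
    proof (rule ccontr)
      assume "\<not> \<zeta> r > 0"
      then have "r \<in> S" using that sS by (auto simp: S_def)
      then have "s \<le> r" unfolding s_def using \<open>bdd_below S\<close> by (rule cInf_lower)
      then show False using that by simp
    qed
    have "x r \<ge> 0" if "r \<in> {0..s}" for r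
      using \<xi>_mono[of r] lt that sS by (auto simp: \<xi>_def zero_le_mult_iff)
    then have nn: "0 \<le> - \<kappa> r * x r * exp (- M r)" if "r \<in> {0..s}" for r
      using that \<kappa>[of r] by (simp add: mult_nonpos_nonneg)
    have "\<zeta> 0 \<le> \<zeta> s"
    proof (rule DERIV_nonneg_imp_increasing_open[where f=\<zeta> and a=0 and b=s])
      fix r assume r: "0 < r" "r < s"
      then show "\<exists>y. DERIV \<zeta> r :> y \<and> 0 \<le> y"
        using \<zeta>d[of r] nn[of r] sS by (intro exI[of _ "- \<kappa> r * x r * exp (- M r)"]) simp
    qed (use sS c\<zeta> in auto)
    moreover have "\<zeta> 0 > 0" by (simp add: \<zeta>_def 0)
    ultimately show False using sS by simp
  qed
  have "\<xi> 0 < \<xi> T"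
  proof (rule DERIV_pos_imp_increasing_open[where f=\<xi>, OF T])
    fix r assume r: "0 < r" "r < T"
    then have "0 < z r * exp (- P r)" using pos[of r] by (simp add: \<zeta>_def zero_less_mult_iff)
    then show "\<exists>y. DERIV \<xi> r :> y \<and> 0 < y" using \<xi>d[of r] r by auto
  qed (use c\<xi> in auto)
  then show ?thesis by (simp add: \<xi>_def 0 zero_less_mult_iff)
qed

context thermo begin

lemma local_flow_tangent_point:
  assumes c: "c \<in> A" and d: "d > 0" and \<psi>: "\<And>t. t \<in> {-d<..<d} \<Longrightarrow> \<psi> t \<in> punct c \<and> (\<psi> has_vector_derivative F c (\<psi> t)) (at t)"
    and u: "B c (fst (\<psi> 0)) (snd (\<psi> 0)) (snd (\<psi> 0)) = 1" and t: "t \<in> {-d<..<d}"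
  shows "\<Phi> t (tangent_point A c (\<psi> 0)) = tangent_point A c (\<psi> t)"
proof -
  have "ic {-d<..<d} (\<lambda>t. tangent_point A c (\<psi> t))"
    by (rule solution_unit[OF c \<psi> _ u]) (use d in auto)
  from ic_eq_flow[OF this _ t] show ?thesis using d by simp
qed

end

locale flow_family = thermo A g lam for A :: "'m::t2_space chart set" and g :: "'m metric" and lam :: "'m \<times> (real^2) \<Rightarrow> real" +
  fixes v :: "'q::euclidean_space \<Rightarrow> 'm \<times> (real^2)" and q0 :: 'q
  assumes v: "v q \<in> unit_tangent g"
    and v_C1: "\<exists>c W. c \<in> A \<and> open W \<and> q0 \<in> W \<and> (\<forall>q\<in>W. fst (v q) \<in> chart_dom c) \<and> C1_on W (\<lambda>q. tangent_coord A c (v q))"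
begin

abbreviation "Y c t q \<equiv> tangent_coord A c (\<Phi> t (v q))"

definition smooth_at :: "'m chart \<Rightarrow> real \<Rightarrow> 'q set \<Rightarrow> bool" where
  "smooth_at c t W \<longleftrightarrow> c \<in> A \<and> open W \<and> q0 \<in> W \<and> (\<forall>q\<in>W. fst (\<Phi> t (v q)) \<in> chart_dom c) \<and> C1_on W (Y c t)"

lemma Y_coord:
  assumes "c \<in> A" "fst (\<Phi> t (v q)) \<in> chart_dom c"
  shows "Y c t q \<in> punct c" "((\<lambda>t. Y c t q) has_vector_derivative F c (Y c t q)) (at t)"
    "B c (fst (Y c t q)) (snd (Y c t q)) (snd (Y c t q)) = 1" "fst (Y c t q) \<in> chart_codom c"
    "tangent_point A c (Y c t q) = \<Phi> t (v q)"
  using ic_coord[OF flow_ic[OF v] _ assms] tangent_point_coord[OF assms] by (auto simp: mem_Times_iff)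

lemma smooth_at_change:
  assumes s: "smooth_at c t W" and d: "d \<in> A" "fst (\<Phi> t (v q0)) \<in> chart_dom d"
  shows "\<exists>W'. smooth_at d t W'"
proof -
  have c: "c \<in> A" "open W" "q0 \<in> W" "\<And>q. q \<in> W \<Longrightarrow> fst (\<Phi> t (v q)) \<in> chart_dom c" "C1_on W (Y c t)"
    using s by (auto simp: smooth_at_def)
  define W' where "W' = W \<inter> Y c t -` (overlap c d \<times> UNIV)"
  have "open W'" unfolding W'_def
    by (rule continuous_open_preimage[OF C1_on_continuous[OF c(5)] c(2) open_overlap_UNIV[OF c(1) d(1)]])
  moreover have "q0 \<in> W'" using c d by (auto simp: W'_def mem_Times_iff fst_tangent_coord overlapI)
  moreover have fd: "fst (\<Phi> t (v q)) \<in> chart_dom d" if "q \<in> W'" for q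
    using that c(4)[of q] by (auto simp: W'_def mem_Times_iff fst_tangent_coord mem_overlap[OF c(1)] chart_inv_map[OF c(1)])
  moreover have "C1_on W' (Y d t)"
  proof (rule C1_on_cong[OF \<open>open W'\<close>])
    show "C1_on W' (\<lambda>q. btrans c d (Y c t q))"
      by (rule C1_on_compose[OF C1_on_subset[OF c(5)] btrans_C1[OF c(1) d(1)]]) (auto simp: W'_def)
    show "btrans c d (Y c t q) = Y d t q" if "q \<in> W'" for q
      using tangent_coord_trans[OF c(1) d(1) c(4) fd[OF that]] that by (simp add: W'_def)
  qed
  ultimately show ?thesis using d(1) by (auto simp: smooth_at_def)
qed

definition smooth_near :: "'m chart \<Rightarrow> real \<Rightarrow> real \<Rightarrow> 'q set \<Rightarrow> (real \<Rightarrow> 'q \<Rightarrow> 'q \<Rightarrow>\<^sub>L ((real^2) \<times> (real^2))) \<Rightarrow> bool" where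
  "smooth_near c t1 \<delta> W Z \<longleftrightarrow> \<delta> > 0 \<and> open W \<and> q0 \<in> W \<and>
    (\<forall>t\<in>{t1-\<delta><..<t1+\<delta>}. \<forall>q\<in>W. fst (\<Phi> t (v q)) \<in> chart_dom c \<and>
      ((\<lambda>(t, q). Y c t q) has_derivative (\<lambda>(s, k). s *\<^sub>R F c (Y c t q) + Z t q k)) (at (t, q)) \<and>
      (\<forall>k. ((\<lambda>t. Z t q k) has_vector_derivative Df (F c) (Y c t q) (Z t q k)) (at t))) \<and>
    continuous_on ({t1-\<delta><..<t1+\<delta>} \<times> W) (\<lambda>(t, q). Z t q)"

lemma smooth_near_slice:
  assumes "smooth_near c t1 \<delta> W Z" "t \<in> {t1-\<delta><..<t1+\<delta>}" "q \<in> W"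
  shows "(Y c t has_derivative Z t q) (at q)"
proof -
  have D: "((\<lambda>(t, q). Y c t q) has_derivative (\<lambda>(s, k). s *\<^sub>R F c (Y c t q) + Z t q k)) (at (t, q))"
    using assms by (simp add: smooth_near_def)
  have "((\<lambda>q. (t, q)) has_derivative (\<lambda>k. (0, k))) (at q)"
    by (intro has_derivative_Pair has_derivative_const has_derivative_ident)
  from has_derivative_compose[OF this D] show ?thesis by simp
qed

lemma smooth_near_smooth_at:
  assumes s: "smooth_near c t1 \<delta> W Z" and c: "c \<in> A" and t: "t \<in> {t1-\<delta><..<t1+\<delta>}"
  shows "smooth_at c t W"
  unfolding smooth_at_def
proof (intro conjI)
  show "C1_on W (Y c t)"
  proof (rule C1_onI[OF smooth_near_slice[OF s t]])
    have "continuous_on ({t1-\<delta><..<t1+\<delta>} \<times> W) (\<lambda>(t, q). Z t q)" using s by (simp add: smooth_near_def)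
    moreover have "continuous_on W (\<lambda>q. (t, q))" by (intro continuous_intros)
    ultimately have "continuous_on W (\<lambda>q. case (t, q) of (t, q) \<Rightarrow> Z t q)"
      by (rule continuous_on_compose2) (use t in auto)
    then show "continuous_on W (Z t)" by simp
  qed
qed (use s c t in \<open>auto simp: smooth_near_def\<close>)

text \<open>The interval does not depend on the time \<open>t'\<close> at which smoothness is known, so smoothness spreads
  along the whole orbit by connectedness of the time axis.\<close>

lemma smooth_step:
  assumes c: "c \<in> A" "fst (\<Phi> t1 (v q0)) \<in> chart_dom c"
  shows "\<exists>\<delta>>0. \<forall>t'\<in>{t1-\<delta><..<t1+\<delta>}. (\<exists>d W. smooth_at d t' W) \<longrightarrow> (\<exists>W Z. smooth_near c t1 \<delta> W Z)"
proof -
  define u1 where "u1 = Y c t1 q0"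
  note Y1 = Y_coord[OF c, folded u1_def]
  obtain d r \<psi> and Z :: "real \<Rightarrow> _ \<Rightarrow> _ \<Rightarrow>\<^sub>L _" where d: "d > 0" "r > 0" "ball u1 r \<subseteq> punct c"
    and \<psi>: "\<And>u. u \<in> ball u1 r \<Longrightarrow> \<psi> 0 u = u"
      "\<And>u t. u \<in> ball u1 r \<Longrightarrow> t \<in> {-d<..<d} \<Longrightarrow> \<psi> t u \<in> punct c"
      "\<And>u t. u \<in> ball u1 r \<Longrightarrow> t \<in> {-d<..<d} \<Longrightarrow> ((\<lambda>t. \<psi> t u) has_vector_derivative F c (\<psi> t u)) (at t)"
      "\<And>u t h. u \<in> ball u1 r \<Longrightarrow> t \<in> {-d<..<d} \<Longrightarrow> ((\<lambda>t. Z t u h) has_vector_derivative Df (F c) (\<psi> t u) (Z t u h)) (at t)"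
      "\<And>u t. u \<in> ball u1 r \<Longrightarrow> t \<in> {-d<..<d} \<Longrightarrow> ((\<lambda>(t, u). \<psi> t u) has_derivative (\<lambda>(s, h). s *\<^sub>R F c (\<psi> t u) + Z t u h)) (at (t, u))"
    and Zc: "continuous_on ({-d<..<d} \<times> ball u1 r) (\<lambda>(t, u). Z t u)"
    using local_flow[OF open_punct[OF c(1)] field_C1[OF c(1)] Y1(1)] by blast
  have ev: "\<forall>\<^sub>F t in nhds t1. Y c t q0 \<in> ball u1 r"
    by (rule isCont_eventually_in_open[where f="\<lambda>t. Y c t q0"])
      (use has_vector_derivative_continuous[OF Y_coord(2)[OF c]] d in \<open>auto simp: u1_def\<close>)
  obtain r' where r': "r' > 0" "\<And>t. \<bar>t - t1\<bar> < r' \<Longrightarrow> fst (\<Phi> t (v q0)) \<in> chart_dom c"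
    using ic_near[OF open_UNIV flow_ic[OF v] _ c] by auto
  obtain e where e: "e > 0" "\<And>t. \<bar>t - t1\<bar> < e \<Longrightarrow> Y c t q0 \<in> ball u1 r"
    using ev unfolding eventually_nhds_metric dist_real_def by blast
  define \<delta> where "\<delta> = min (d / 2) (min r' e)"
  have \<delta>: "\<delta> > 0" "\<delta> \<le> d / 2" "\<delta> \<le> r'" "\<delta> \<le> e" using d r' e by (auto simp: \<delta>_def)
  have "\<exists>W Z. smooth_near c t1 \<delta> W Z" if t': "t' \<in> {t1-\<delta><..<t1+\<delta>}" and sm: "smooth_at d' t' W0" for t' d' W0
  proof -
    have t'1: "\<bar>t' - t1\<bar> < \<delta>" using t' by auto
    obtain W1 where W1: "smooth_at c t' W1"
      using smooth_at_change[OF sm c(1)] r'(2)[of t'] t'1 \<delta> by auto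
    then have W1': "open W1" "q0 \<in> W1" "\<And>q. q \<in> W1 \<Longrightarrow> fst (\<Phi> t' (v q)) \<in> chart_dom c" "C1_on W1 (Y c t')"
      by (auto simp: smooth_at_def)
    define W where "W = W1 \<inter> Y c t' -` ball u1 r"
    have W: "open W" unfolding W_def
      by (rule continuous_open_preimage[OF C1_on_continuous[OF W1'(4)] W1'(1) open_ball])
    have q0W: "q0 \<in> W" using W1'(2) e(2)[of t'] t'1 \<delta> by (auto simp: W_def)
    let ?I = "{t1-\<delta><..<t1+\<delta>}"
    have tt: "t - t' \<in> {-d<..<d}" if "t \<in> ?I" for t using that t'1 \<delta> by auto
    have b: "Y c t' q \<in> ball u1 r" if "q \<in> W" for q using that by (simp add: W_def)
    have eq: "\<Phi> t (v q) = tangent_point A c (\<psi> (t - t') (Y c t' q))" if "t \<in> ?I" "q \<in> W" for t q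
    proof -
      have q: "fst (\<Phi> t' (v q)) \<in> chart_dom c" using that W1'(3) by (simp add: W_def)
      note Yq = Y_coord[OF c(1) q]
      have p0: "\<psi> 0 (Y c t' q) = Y c t' q" by (rule \<psi>(1)[OF b[OF that(2)]])
      have "\<Phi> (t - t') (tangent_point A c (\<psi> 0 (Y c t' q))) = tangent_point A c (\<psi> (t - t') (Y c t' q))"
        by (rule local_flow_tangent_point[OF c(1) d(1) _ _ tt[OF that(1)]])
          (use \<psi>(2,3)[OF b[OF that(2)]] Yq p0 in auto)
      then show ?thesis using p0 Yq flow_add[OF v, of "t - t'" t' q] by simp
    qed
    have pc: "fst (\<psi> (t - t') (Y c t' q)) \<in> chart_codom c" if "t \<in> ?I" "q \<in> W" for t q
      using \<psi>(2)[OF b[OF that(2)] tt[OF that(1)]] by (simp add: mem_Times_iff)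
    have Yeq: "Y c t q = \<psi> (t - t') (Y c t' q)" if "t \<in> ?I" "q \<in> W" for t q
      using eq[OF that] tangent_coord_point[OF c(1) pc[OF that]] by simp
    have dom: "fst (\<Phi> t (v q)) \<in> chart_dom c" if "t \<in> ?I" "q \<in> W" for t q
      using eq[OF that] pc[OF that] chart_inv_in[OF c(1)] by (simp add: fst_tangent_point)
    define Z' where "Z' t q = Z (t - t') (Y c t' q) o\<^sub>L Df (Y c t') q" for t q
    have sub: "W \<subseteq> W1" by (auto simp: W_def)
    have "smooth_near c t1 \<delta> W Z'"
      unfolding smooth_near_def
    proof (intro conjI ballI allI)
      fix t q assume t: "t \<in> ?I" and q: "q \<in> W"
      show "fst (\<Phi> t (v q)) \<in> chart_dom c" by (rule dom[OF t q])
      have D1: "((\<lambda>p. (fst p - t', Y c t' (snd p))) has_derivative (\<lambda>p. (fst p, Df (Y c t') q (snd p)))) (at (t, q))"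
      proof (intro has_derivative_Pair)
        show "((\<lambda>p. fst p - t') has_derivative fst) (at (t, q))" by (auto intro!: derivative_eq_intros)
        have "(Y c t' has_derivative Df (Y c t') q) (at (snd (t, q)))" using C1_on_D[OF W1'(4)] q sub by auto
        from has_derivative_compose[OF has_derivative_snd[OF has_derivative_ident] this]
        show "((\<lambda>p. Y c t' (snd p)) has_derivative (\<lambda>p. Df (Y c t') q (snd p))) (at (t, q))" .
      qed
      have D2: "((\<lambda>(t, u). \<psi> t u) has_derivative (\<lambda>(s, h). s *\<^sub>R F c (\<psi> (t - t') (Y c t' q)) + Z (t - t') (Y c t' q) h))
          (at (fst (t, q) - t', Y c t' (snd (t, q))))"
        using \<psi>(5)[OF b[OF q] tt[OF t]] by simp
      from has_derivative_compose[OF D1 D2]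
      have "((\<lambda>p. \<psi> (fst p - t') (Y c t' (snd p))) has_derivative
         (\<lambda>p. fst p *\<^sub>R F c (\<psi> (t - t') (Y c t' q)) + Z (t - t') (Y c t' q) (Df (Y c t') q (snd p)))) (at (t, q))"
        by simp
      then have "((\<lambda>(t, q). Y c t q) has_derivative
         (\<lambda>p. fst p *\<^sub>R F c (\<psi> (t - t') (Y c t' q)) + Z (t - t') (Y c t' q) (Df (Y c t') q (snd p)))) (at (t, q))"
        by (rule has_derivative_transform_within_open[OF _ open_Times[OF open_greaterThanLessThan W]]) (use t q in \<open>auto simp: Yeq\<close>)
      then show "((\<lambda>(t, q). Y c t q) has_derivative (\<lambda>(s, k). s *\<^sub>R F c (Y c t q) + Z' t q k)) (at (t, q))"
        by (simp add: Yeq[OF t q] Z'_def case_prod_unfold blinfun_compose.rep_eq)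
      fix k
      have "((\<lambda>t. t - t') has_vector_derivative 1) (at t)"
        using has_vector_derivative_diff[OF has_vector_derivative_id has_vector_derivative_const] by simp
      from vector_diff_chain_at[OF this \<psi>(4)[OF b[OF q] tt[OF t]], of "Df (Y c t') q k"]
      show "((\<lambda>t. Z' t q k) has_vector_derivative Df (F c) (Y c t q) (Z' t q k)) (at t)"
        by (simp add: Yeq[OF t q] Z'_def o_def blinfun_compose.rep_eq)
    next
      have "continuous_on (?I \<times> W) (\<lambda>p. case (fst p - t', Y c t' (snd p)) of (t, u) \<Rightarrow> Z t u)"
        by (rule continuous_on_compose2[OF Zc])
          (use tt b in \<open>auto intro!: continuous_intros continuous_on_compose2[OF continuous_on_subset[OF C1_on_continuous[OF W1'(4)] sub]]\<close>)
      moreover have "continuous_on (?I \<times> W) (\<lambda>p. Df (Y c t') (snd p))"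
        by (rule continuous_on_compose2[OF continuous_on_subset[OF C1_on_cont_Df[OF W1'(4)] sub] continuous_on_snd]) auto
      ultimately show "continuous_on (?I \<times> W) (\<lambda>(t, q). Z' t q)"
        by (simp add: Z'_def case_prod_unfold bounded_bilinear.continuous_on[OF bounded_bilinear_blinfun_compose])
    qed (use \<delta> W q0W in auto)
    then show ?thesis by blast
  qed
  then show ?thesis using \<delta>(1) by blast
qed

lemma smooth_all: "\<exists>d W. smooth_at d t W"
proof (rule connected_induction_simple[where S=UNIV and a=0 and P="\<lambda>t. \<exists>d W. smooth_at d t W"])
  show "\<exists>d W. smooth_at d 0 W" using v_C1 flow_0[OF v] by (simp add: smooth_at_def)
  fix t1 :: real
  define c where "c = chart_at A (fst (\<Phi> t1 (v q0)))"
  have c: "c \<in> A" "fst (\<Phi> t1 (v q0)) \<in> chart_dom c" using chart_at by (auto simp: c_def)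
  obtain \<delta> where \<delta>: "\<delta> > 0" "\<And>t'. t' \<in> {t1-\<delta><..<t1+\<delta>} \<Longrightarrow> (\<exists>d W. smooth_at d t' W) \<Longrightarrow> (\<exists>W Z. smooth_near c t1 \<delta> W Z)"
    using smooth_step[OF c] by blast
  show "\<exists>T. openin (top_of_set UNIV) T \<and> t1 \<in> T \<and> (\<forall>x\<in>T. \<forall>y\<in>T. (\<exists>d W. smooth_at d x W) \<longrightarrow> (\<exists>d W. smooth_at d y W))"
  proof (intro exI[of _ "{t1-\<delta><..<t1+\<delta>}"] conjI ballI impI)
    fix x y assume x: "x \<in> {t1-\<delta><..<t1+\<delta>}" and y: "y \<in> {t1-\<delta><..<t1+\<delta>}" and "\<exists>d W. smooth_at d x W"
    then obtain W Z where "smooth_near c t1 \<delta> W Z" using \<delta>(2)[OF x] by blast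
    from smooth_near_smooth_at[OF this c(1) y] show "\<exists>d W. smooth_at d y W" by blast
  qed (use \<delta>(1) in auto)
qed auto

lemma smooth_everywhere:
  assumes "c \<in> A" "fst (\<Phi> t (v q0)) \<in> chart_dom c"
  shows "\<exists>\<delta> W Z. smooth_near c t \<delta> W Z"
proof -
  obtain \<delta> where "\<delta> > 0" "\<And>t'. t' \<in> {t-\<delta><..<t+\<delta>} \<Longrightarrow> (\<exists>d W. smooth_at d t' W) \<Longrightarrow> (\<exists>W Z. smooth_near c t \<delta> W Z)"
    using smooth_step[OF assms] by blast
  moreover have "t \<in> {t-\<delta><..<t+\<delta>}" using \<open>\<delta> > 0\<close> by simp
  ultimately show ?thesis using smooth_all[of t] by meson
qed

end

section \<open>Jacobi fields do not vanish\<close>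

lemma DERIV_transform_eventually:
  assumes "(f has_real_derivative D) (at t)" "open I" "t \<in> I" "\<And>s. s \<in> I \<Longrightarrow> f s = h s"
  shows "(h has_real_derivative D) (at t)"
  using has_derivative_transform_within_open[OF assms(1)[unfolded has_field_derivative_def] assms(2,3,4)]
  by (simp add: has_field_derivative_def)

context flow_family begin

definition jac :: "'m chart \<Rightarrow> real \<Rightarrow> 'q \<Rightarrow> (real^2) \<times> (real^2)" where
  "jac c t k = Df (Y c t) q0 k"

definition normal :: "'m chart \<Rightarrow> real \<Rightarrow> 'q \<Rightarrow> real" where
  "normal c t k = B c (fst (Y c t q0)) (fst (jac c t k)) (J c (fst (Y c t q0)) (snd (Y c t q0)))"

lemma Y_differentiable:
  assumes "c \<in> A" "fst (\<Phi> t (v q0)) \<in> chart_dom c"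
  shows "(Y c t has_derivative jac c t) (at q0)"
proof -
  obtain \<delta> W Z where s: "smooth_near c t \<delta> W Z" using smooth_everywhere[OF assms] by blast
  have "(Y c t has_derivative Z t q0) (at q0)"
    by (rule smooth_near_slice[OF s]) (use s in \<open>auto simp: smooth_near_def\<close>)
  then show ?thesis unfolding jac_def[abs_def] by (simp add: Df_eqI)
qed

lemma normal_change:
  assumes c: "c \<in> A" "fst (\<Phi> t (v q0)) \<in> chart_dom c" and d: "d \<in> A" "fst (\<Phi> t (v q0)) \<in> chart_dom d"
  shows "normal d t k = normal c t k"
proof -
  have o: "fst (Y c t q0) \<in> overlap c d" using c d by (simp add: fst_tangent_coord overlapI)
  obtain \<delta> W Z where "smooth_near c t \<delta> W Z" using smooth_everywhere[OF c] by blast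
  then have W: "open W" "q0 \<in> W" "\<And>q. q \<in> W \<Longrightarrow> fst (\<Phi> t (v q)) \<in> chart_dom c" by (auto simp: smooth_near_def)
  obtain \<delta>' W' Z' where "smooth_near d t \<delta>' W' Z'" using smooth_everywhere[OF d] by blast
  then have W': "open W'" "q0 \<in> W'" "\<And>q. q \<in> W' \<Longrightarrow> fst (\<Phi> t (v q)) \<in> chart_dom d" by (auto simp: smooth_near_def)
  have "((\<lambda>q. btrans c d (Y c t q)) has_derivative (\<lambda>k. dbtrans c d (Y c t q0) (jac c t k))) (at q0)"
    by (rule has_derivative_compose[OF Y_differentiable[OF c] btrans_has_derivative[OF c(1) d(1) o]])
  then have "(Y d t has_derivative (\<lambda>k. dbtrans c d (Y c t q0) (jac c t k))) (at q0)"
    by (rule has_derivative_transform_within_open[OF _ open_Int[OF W(1) W'(1)]])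
      (use W W' tangent_coord_trans[OF c(1) d(1)] in auto)
  from fun_cong[OF has_derivative_unique[OF Y_differentiable[OF d] this], of k]
  have "fst (jac d t k) = dtrans c d (fst (Y c t q0)) (fst (jac c t k))" by (simp add: dbtrans_def)
  moreover have "Y d t q0 = btrans c d (Y c t q0)" using tangent_coord_trans[OF c(1) d(1) c(2) d(2)] .
  ultimately show ?thesis
    unfolding normal_def by (simp add: btrans_def J_trans[OF c(1) d(1) o] B_trans[OF c(1) d(1) o])
qed

definition normal_comp :: "real \<Rightarrow> 'q \<Rightarrow> real" where
  "normal_comp t k = normal (chart_at A (fst (\<Phi> t (v q0)))) t k"

lemma normal_comp_eq: "c \<in> A \<Longrightarrow> fst (\<Phi> t (v q0)) \<in> chart_dom c \<Longrightarrow> normal_comp t k = normal c t k"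
  unfolding normal_comp_def by (rule normal_change) (auto simp: chart_at)

definition tang :: "'m chart \<Rightarrow> real \<Rightarrow> 'q \<Rightarrow> real" where
  "tang c t k = B c (fst (Y c t q0)) (fst (jac c t k)) (snd (Y c t q0))"

definition vert :: "'m chart \<Rightarrow> real \<Rightarrow> 'q \<Rightarrow> real" where
  "vert c t k = B c (fst (Y c t q0)) (snd (jac c t k) + Gam c (fst (Y c t q0)) (snd (Y c t q0)) (fst (jac c t k)))
      (J c (fst (Y c t q0)) (snd (Y c t q0)))"

lemma vertical_orthogonal:
  assumes c: "c \<in> A" "fst (\<Phi> t (v q0)) \<in> chart_dom c"
  shows "B c (fst (Y c t q0)) (snd (Y c t q0)) (snd (jac c t k) + Gam c (fst (Y c t q0)) (snd (Y c t q0)) (fst (jac c t k))) = 0"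
proof -
  obtain \<delta> W Z where "smooth_near c t \<delta> W Z" using smooth_everywhere[OF c] by blast
  then have W: "open W" "q0 \<in> W" "\<And>q. q \<in> W \<Longrightarrow> fst (\<Phi> t (v q)) \<in> chart_dom c" by (auto simp: smooth_near_def)
  note Y0 = Y_coord[OF c]
  note D = Y_differentiable[OF c]
  let ?y = "fst (Y c t q0)" let ?w = "snd (Y c t q0)"
  have "((\<lambda>q. B c (fst (Y c t q)) (snd (Y c t q)) (snd (Y c t q))) has_derivative
    (\<lambda>k. B c ?y (snd (jac c t k) + Gam c ?y (fst (jac c t k)) ?w) ?w + B c ?y ?w (snd (jac c t k) + Gam c ?y (fst (jac c t k)) ?w))) (at q0)"
    by (rule B_has_derivative[where y="\<lambda>q. fst (Y c t q)" and x=q0, OF c(1) Y0(4) has_derivative_fst[OF D] has_derivative_snd[OF D] has_derivative_snd[OF D]])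
  then have "((\<lambda>q. 1) has_derivative
    (\<lambda>k. B c ?y (snd (jac c t k) + Gam c ?y (fst (jac c t k)) ?w) ?w + B c ?y ?w (snd (jac c t k) + Gam c ?y (fst (jac c t k)) ?w))) (at q0)"
    by (rule has_derivative_transform_within_open[OF _ W(1,2)]) (use Y_coord(3)[OF c(1) W(3)] in auto)
  from fun_cong[OF has_derivative_unique[OF this has_derivative_const], of k] show ?thesis
    by (simp add: B_sym[OF c(1) Y0(4), of _ ?w] Gam_sym[OF c(1) Y0(4), of _ ?w])
qed

lemma local_jacobi:
  assumes c: "c \<in> A" "fst (\<Phi> t1 (v q0)) \<in> chart_dom c"
  shows "\<exists>\<delta>>0. \<forall>t\<in>{t1-\<delta><..<t1+\<delta>}. fst (\<Phi> t (v q0)) \<in> chart_dom c \<and>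
    ((\<lambda>t. normal_comp t k) has_real_derivative vert c t k - L c (Y c t q0) * tang c t k) (at t) \<and>
    ((\<lambda>t. tang c t k) has_real_derivative L c (Y c t q0) * normal_comp t k) (at t) \<and>
    ((\<lambda>t. vert c t k) has_real_derivative - curv c (fst (Y c t q0)) * normal_comp t k + Df (L c) (Y c t q0) (jac c t k)) (at t)"
proof -
  obtain \<delta> W Z where s: "smooth_near c t1 \<delta> W Z" using smooth_everywhere[OF c] by blast
  let ?I = "{t1-\<delta><..<t1+\<delta>}"
  have \<delta>: "\<delta> > 0" and q0: "q0 \<in> W" and dom: "\<And>t. t \<in> ?I \<Longrightarrow> fst (\<Phi> t (v q0)) \<in> chart_dom c"
    and Zd: "\<And>t k. t \<in> ?I \<Longrightarrow> ((\<lambda>t. Z t q0 k) has_vector_derivative Df (F c) (Y c t q0) (Z t q0 k)) (at t)"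
    using s by (auto simp: smooth_near_def)
  have jZ: "jac c t k = Z t q0 k" if "t \<in> ?I" for t k
    using Df_eqI[OF smooth_near_slice[OF s that q0]] by (simp add: jac_def)
  have jd: "((\<lambda>t. jac c t k) has_vector_derivative Df (F c) (Y c t q0) (jac c t k)) (at t)" if t: "t \<in> ?I" for t
    unfolding jZ[OF t] by (rule has_vector_derivative_transform_within_open[OF Zd[OF t] open_greaterThanLessThan t]) (simp add: jZ)
  have "((\<lambda>t. normal_comp t k) has_real_derivative vert c t k - L c (Y c t q0) * tang c t k) (at t) \<and>
    ((\<lambda>t. tang c t k) has_real_derivative L c (Y c t q0) * normal_comp t k) (at t) \<and>
    ((\<lambda>t. vert c t k) has_real_derivative - curv c (fst (Y c t q0)) * normal_comp t k + Df (L c) (Y c t q0) (jac c t k)) (at t)"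
    if t: "t \<in> ?I" for t
  proof -
    note Y = Y_coord[OF c(1) dom[OF t]]
    let ?y = "fst (Y c t q0)" let ?w = "snd (Y c t q0)" let ?e = "fst (jac c t k)" let ?z = "snd (jac c t k)"
    have yd: "((\<lambda>t. fst (Y c t q0)) has_vector_derivative ?w) (at t)"
      using bounded_linear.has_vector_derivative[OF bounded_linear_fst Y(2)] by (simp add: field_eq)
    have wd: "((\<lambda>t. snd (Y c t q0)) has_vector_derivative - Gam c ?y ?w ?w + L c (Y c t q0) *\<^sub>R J c ?y ?w) (at t)"
      using bounded_linear.has_vector_derivative[OF bounded_linear_snd Y(2)] by (simp add: field_eq)
    have "(?y, ?w) \<in> punct c" using Y(1) by simp
    note fd = field_Df[OF c(1) this, of ?e ?z, unfolded prod.collapse]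
    have ed: "((\<lambda>t. fst (jac c t k)) has_vector_derivative ?z) (at t)"
      using bounded_linear.has_vector_derivative[OF bounded_linear_fst jd[OF t]] by (simp add: fd)
    have zd: "((\<lambda>t. snd (jac c t k)) has_vector_derivative - (dGam c ?y ?e ?w ?w + Gam c ?y ?z ?w + Gam c ?y ?w ?z)
        + Df (L c) (Y c t q0) (jac c t k) *\<^sub>R J c ?y ?w
        + L c (Y c t q0) *\<^sub>R (J c ?y (?z + Gam c ?y ?e ?w) - Gam c ?y ?e (J c ?y ?w))) (at t)"
      using bounded_linear.has_vector_derivative[OF bounded_linear_snd jd[OF t]] by (simp add: fd)
    note J = jacobi_derivatives[where y="\<lambda>t. fst (Y c t q0)" and w="\<lambda>t. snd (Y c t q0)" and \<eta>="\<lambda>t. fst (jac c t k)" and \<zeta>="\<lambda>t. snd (jac c t k)" and t=t,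
        OF c(1) Y(4,3) vertical_orthogonal[OF c(1) dom[OF t]] yd wd ed zd]
    have n: "normal_comp t k = normal c t k" if "t \<in> ?I" for t by (rule normal_comp_eq[OF c(1) dom[OF that]])
    have "((\<lambda>t. normal_comp t k) has_real_derivative vert c t k - L c (Y c t q0) * tang c t k) (at t)"
      by (rule DERIV_transform_eventually[OF _ open_greaterThanLessThan t, where f="\<lambda>t. normal c t k"])
        (use J(1) n in \<open>auto simp: normal_def vert_def tang_def\<close>)
    then show ?thesis using J(2,3) by (simp add: n[OF t] normal_def vert_def tang_def)
  qed
  then show ?thesis using \<delta> dom by blast
qed

lemma vertical_deriv_eq:
  assumes c: "c \<in> A" "fst (\<Phi> t (v q0)) \<in> chart_dom c"
  shows "vertical_deriv A g lam (\<Phi> t (v q0)) = Df (L c) (Y c t q0) (Ver c (Y c t q0))"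
  by (rule field_deriv_eq[OF lam vertical_field_invariant c flow_unit[OF v]])

lemma vertical_deriv_cont: "isCont (\<lambda>t. vertical_deriv A g lam (\<Phi> t (v q0))) t1"
proof -
  define c where "c = chart_at A (fst (\<Phi> t1 (v q0)))"
  have c: "c \<in> A" "fst (\<Phi> t1 (v q0)) \<in> chart_dom c" using chart_at by (auto simp: c_def)
  obtain r where r: "r > 0" "\<And>t. \<bar>t - t1\<bar> < r \<Longrightarrow> fst (\<Phi> t (v q0)) \<in> chart_dom c"
    using ic_near[OF open_UNIV flow_ic[OF v] _ c] by auto
  note Y1 = Y_coord[OF c]
  have Yc: "isCont (\<lambda>t. Y c t q0) t1" using has_vector_derivative_continuous[OF Y1(2)] .
  have "C1_on (punct c) (Ver c)"
    unfolding vertical_field_eq[abs_def]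
    by (intro C1_on_Pair C1_on_const J_C1[OF c(1)] C1_on_fst C1_on_snd) (auto simp: mem_Times_iff)
  then have "continuous_on (punct c) (\<lambda>u. Df (L c) u (Ver c u))"
    by (intro continuous_intros C1_on_cont_Df L_C1[OF c(1)] C1_on_continuous)
  from bspec[OF this[unfolded continuous_on_eq_continuous_at[OF open_punct[OF c(1)]]] Y1(1)]
  have "isCont (\<lambda>u. Df (L c) u (Ver c u)) (Y c t1 q0)" .
  then have "isCont (\<lambda>t. Df (L c) (Y c t q0) (Ver c (Y c t q0))) t1"
    using isCont_o2[OF Yc, of "\<lambda>u. Df (L c) u (Ver c u)"] by simp
  moreover have "\<forall>\<^sub>F t in nhds t1. vertical_deriv A g lam (\<Phi> t (v q0)) = Df (L c) (Y c t q0) (Ver c (Y c t q0))"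
    unfolding eventually_nhds_metric dist_real_def using r vertical_deriv_eq[OF c(1)] by blast
  ultimately show ?thesis using isCont_cong by fast
qed

lemma normal_pos:
  assumes p: "C1_along_flow A g lam p" and \<kappa>: "\<forall>v\<in>unit_tangent g. kappa A g lam p v \<le> 0"
    and c: "c \<in> A" "fst (v q0) \<in> chart_dom c"
    and k: "jac c 0 k = (0, J c (fst (Y c 0 q0)) (snd (Y c 0 q0)))"
    and T: "T > 0" and d: "d \<in> A" "fst (\<Phi> T (v q0)) \<in> chart_dom d"
  shows "normal d T k > 0"
proof -
  define pt where "pt t = p (\<Phi> t (v q0))" for t
  obtain D where D: "\<And>t. (pt has_vector_derivative D t) (at t)"
    using p v unfolding C1_along_flow_def C1_differentiable_on_def pt_def[abs_def] by blast
  then have pd: "(pt has_real_derivative D t) (at t)" for t by (simp add: has_real_derivative_iff_has_vector_derivative)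
  have flow_deriv: "flow_deriv A g lam p (\<Phi> t (v q0)) = D t" for t
  proof -
    have "((\<lambda>s. pt (s + t)) has_real_derivative D t) (at 0)" using pd[of t] DERIV_shift[of pt "D t" 0 t] by simp
    then show ?thesis unfolding flow_deriv_def pt_def flow_add[OF v] by (rule DERIV_imp_deriv)
  qed
  define x where "x t = normal_comp t k" for t
  define z where "z t = deriv x t - pt t * x t" for t
  define m where "m t = vertical_deriv A g lam (\<Phi> t (v q0)) - pt t" for t
  define \<kappa>t where "\<kappa>t t = kappa A g lam p (\<Phi> t (v q0))" for t
  have main: "(x has_real_derivative z t1 + pt t1 * x t1) (at t1) \<and>
    (z has_real_derivative m t1 * z t1 - \<kappa>t t1 * x t1) (at t1)" for t1
  proof -
    define c where "c = chart_at A (fst (\<Phi> t1 (v q0)))"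
    have c: "c \<in> A" "fst (\<Phi> t1 (v q0)) \<in> chart_dom c" using chart_at by (auto simp: c_def)
    obtain \<delta> where \<delta>: "\<delta> > 0" and
      xd: "\<And>t. t \<in> {t1-\<delta><..<t1+\<delta>} \<Longrightarrow> (x has_real_derivative vert c t k - L c (Y c t q0) * tang c t k) (at t)" and
      ad: "\<And>t. t \<in> {t1-\<delta><..<t1+\<delta>} \<Longrightarrow> ((\<lambda>t. tang c t k) has_real_derivative L c (Y c t q0) * x t) (at t)" and
      qd: "\<And>t. t \<in> {t1-\<delta><..<t1+\<delta>} \<Longrightarrow> ((\<lambda>t. vert c t k) has_real_derivative - curv c (fst (Y c t q0)) * x t + Df (L c) (Y c t q0) (jac c t k)) (at t)"
      using local_jacobi[OF c, of k] unfolding x_def[abs_def] by blast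
    let ?I = "{t1-\<delta><..<t1+\<delta>}"
    have t1: "t1 \<in> ?I" using \<delta> by simp
    have dx: "deriv x t = vert c t k - L c (Y c t q0) * tang c t k" if "t \<in> ?I" for t
      using xd[OF that] by (rule DERIV_imp_deriv)
    note Y1 = Y_coord[OF c]
    define u where "u = Y c t1 q0"
    define y w where "y = fst u" and "w = snd u"
    have uyw: "u = (y, w)" by (simp add: y_def w_def)
    have cy: "c \<in> A" "y \<in> chart_codom c" and w1: "B c y w w = 1" and up: "u \<in> punct c"
      using c Y1 by (auto simp: y_def w_def u_def)
    define l where "l = L c u"
    have ld: "((\<lambda>t. L c (Y c t q0)) has_real_derivative Df (L c) u (F c u)) (at t1)"
    proof -
      have "(L c has_derivative Df (L c) u) (at (Y c t1 q0))" using C1_on_D[OF L_C1[OF c(1)] up] by (simp add: u_def)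
      from vector_derivative_diff_chain_within[where f="\<lambda>t. Y c t q0" and x=t1, OF Y1(2) has_derivative_at_withinI[OF this]]
      show ?thesis by (simp add: has_real_derivative_iff_has_vector_derivative o_def u_def)
    qed
    define X0 H0 V0 where "X0 = Df (L c) u (X c u)" and "H0 = Df (L c) u (J c y w, - Gam c y w (J c y w))" and "V0 = Df (L c) u (Ver c u)"
    define a q where "a = tang c t1 k" and "q = vert c t1 k"
    have Fu: "Df (L c) u (F c u) = X0 + l * V0"
      by (simp add: thermostat_field_def X0_def V0_def l_def blinfun.bilinear_simps)
    define \<eta> \<zeta> where "\<eta> = fst (jac c t1 k)" and "\<zeta> = snd (jac c t1 k)"
    have xn: "x t1 = B c y \<eta> (J c y w)"
      by (simp add: x_def normal_comp_eq[OF c] normal_def y_def w_def u_def \<eta>_def)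
    have an: "a = B c y \<eta> w" by (simp add: a_def tang_def y_def w_def u_def \<eta>_def)
    have \<eta>: "\<eta> = a *\<^sub>R w + x t1 *\<^sub>R J c y w"
      using orthonormal_expand[OF cy w1, of \<eta>] by (simp add: xn an)
    have "B c y (\<zeta> + Gam c y w \<eta>) w = 0"
      using vertical_orthogonal[OF c, of k] B_sym[OF cy] by (simp add: y_def w_def u_def \<eta>_def \<zeta>_def)
    moreover have "q = B c y (\<zeta> + Gam c y w \<eta>) (J c y w)" by (simp add: q_def vert_def y_def w_def u_def \<eta>_def \<zeta>_def)
    ultimately have "\<zeta> + Gam c y w \<eta> = q *\<^sub>R J c y w"
      using orthonormal_expand[OF cy w1, of "\<zeta> + Gam c y w \<eta>"] by simp
    then have \<zeta>: "\<zeta> = q *\<^sub>R J c y w - Gam c y w \<eta>" by (simp add: algebra_simps)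
    have "jac c t1 k = a *\<^sub>R X c u + x t1 *\<^sub>R (J c y w, - Gam c y w (J c y w)) + q *\<^sub>R Ver c u"
    proof (rule prod_eqI)
      show "fst (jac c t1 k) = fst (a *\<^sub>R X c u + x t1 *\<^sub>R (J c y w, - Gam c y w (J c y w)) + q *\<^sub>R Ver c u)"
        using \<eta> by (simp add: \<eta>_def geodesic_field_eq vertical_field_eq uyw)
      show "snd (jac c t1 k) = snd (a *\<^sub>R X c u + x t1 *\<^sub>R (J c y w, - Gam c y w (J c y w)) + q *\<^sub>R Ver c u)"
        using \<zeta> unfolding \<zeta>_def[symmetric] by (subst (asm) \<eta>) (simp add: geodesic_field_eq vertical_field_eq uyw Gam_simps algebra_simps)
    qed
    then have jL: "Df (L c) u (jac c t1 k) = a * X0 + x t1 * H0 + q * V0"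
      by (simp only: X0_def H0_def V0_def blinfun.add_right blinfun.scaleR_right real_scaleR_def)
    have vd: "vertical_deriv A g lam (\<Phi> t1 (v q0)) = V0" using vertical_deriv_eq[OF c] by (simp add: V0_def u_def)
    have hd: "horizontal_deriv A g lam (\<Phi> t1 (v q0)) = H0"
      unfolding H0_def uyw by (rule horizontal_deriv_eq[OF lam flow_unit[OF v] c_def]) (simp add: u_def[symmetric] uyw)
    have ll: "lam (\<Phi> t1 (v q0)) = l" using local_rep_unit[OF c flow_unit[OF v]] by (simp add: l_def u_def)
    have kk: "gauss_curvature A g (fst (\<Phi> t1 (v q0))) = curv c y"
      by (simp add: gauss_curvature_eq y_def u_def fst_tangent_coord flip: c_def)
    have \<kappa>t1: "\<kappa>t t1 = curv c y - H0 + l\<^sup>2 + D t1 + pt t1 * (pt t1 - V0)"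
      by (simp add: \<kappa>t_def kappa_def kk hd ll flow_deriv vd pt_def[symmetric])
    have z1: "z t1 = q - l * a - pt t1 * x t1" by (simp add: z_def dx[OF t1] q_def l_def a_def u_def)
    have "((\<lambda>t. vert c t k - L c (Y c t q0) * tang c t k - pt t * x t) has_real_derivative
       (- curv c y * x t1 + Df (L c) u (jac c t1 k)) - (Df (L c) u (F c u) * a + l * (l * x t1)) - (D t1 * x t1 + pt t1 * (q - l * a))) (at t1)"
      using qd[OF t1] ad[OF t1] xd[OF t1] ld pd[of t1]
      by (auto intro!: derivative_eq_intros simp: u_def y_def l_def a_def q_def)
    also have "(- curv c y * x t1 + Df (L c) u (jac c t1 k)) - (Df (L c) u (F c u) * a + l * (l * x t1)) - (D t1 * x t1 + pt t1 * (q - l * a)) =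
      m t1 * z t1 - \<kappa>t t1 * x t1"
      by (simp add: jL Fu m_def vd z1 \<kappa>t1 algebra_simps power2_eq_square)
    finally have "(z has_real_derivative m t1 * z t1 - \<kappa>t t1 * x t1) (at t1)"
      by (rule DERIV_transform_eventually[OF _ open_greaterThanLessThan t1]) (simp add: z_def dx)
    moreover have "(x has_real_derivative z t1 + pt t1 * x t1) (at t1)"
      using xd[OF t1] by (simp add: z1 q_def l_def a_def u_def)
    ultimately show ?thesis by blast
  qed
  have c0: "fst (\<Phi> 0 (v q0)) \<in> chart_dom c" using c flow_0[OF v] by simp
  note Y0 = Y_coord[OF c(1) c0]
  have "\<exists>\<delta>>0. \<forall>t\<in>{0-\<delta><..<0+\<delta>}. ((\<lambda>t. normal_comp t k) has_real_derivative vert c t k - L c (Y c t q0) * tang c t k) (at t)"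
    using local_jacobi[OF c(1) c0, of k] by blast
  then have dx0: "(x has_real_derivative vert c 0 k - L c (Y c 0 q0) * tang c 0 k) (at 0)"
    unfolding x_def[abs_def] by force
  have x0: "x 0 = 0" by (simp add: x_def normal_comp_eq[OF c(1) c0] normal_def k B_simps)
  have "deriv x 0 = vert c 0 k - L c (Y c 0 q0) * tang c 0 k" using dx0 by (rule DERIV_imp_deriv)
  also have "\<dots> = 1" using Y0 by (simp add: vert_def tang_def k B_simps Gam_simps B_J_J[OF c(1) Y0(4)])
  finally have z0: "z 0 = 1" by (simp add: z_def x0)
  have "x T > 0"
  proof (rule positive_solution[where x=x and z=z and m=m and p=pt and \<kappa>=\<kappa>t])
    show "isCont pt t" for t using pd DERIV_isCont by blast
    then show "isCont m t" for t unfolding m_def[abs_def] using vertical_deriv_cont by (intro continuous_intros)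
    show "\<kappa>t t \<le> 0" for t using \<kappa> flow_unit[OF v] by (simp add: \<kappa>t_def)
  qed (use main x0 z0 T in auto)
  then show ?thesis by (simp add: x_def normal_comp_eq[OF d])
qed

end

section \<open>Local inverses\<close>

lemma C1_local_inverse:
  fixes f :: "'a::euclidean_space \<Rightarrow> 'a"
  assumes W: "open W" "x0 \<in> W" and f: "C1_on W f" and inj: "inj (blinfun_apply (Df f x0))"
  obtains U V h where "open U" "U \<subseteq> W" "x0 \<in> U" "open V" "homeomorphism U V f h" "C1_on V h"
proof -
  obtain l where l: "linear l" "l \<circ> blinfun_apply (Df f x0) = id"
    using linear_injective_left_inverse[OF _ inj] blinfun.bounded_linear_right bounded_linear.linear by metis
  have "Blinfun l o\<^sub>L Df f x0 = id_blinfun"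
    using l by (intro blinfun_eqI) (auto simp: bounded_linear_Blinfun_apply linear_conv_bounded_linear o_def fun_eq_iff)
  from inverse_function_theorem[OF W(1) C1_on_D[OF f] C1_on_cont_Df[OF f] W(2) this]
  obtain U V h h' where U: "open U" "U \<subseteq> W" "x0 \<in> U" "open V" "f x0 \<in> V" and hom: "homeomorphism U V f h"
    and h': "\<And>y. y \<in> V \<Longrightarrow> (h has_derivative h' y) (at y)" "\<And>y. y \<in> V \<Longrightarrow> h' y = inv (blinfun_apply (Df f (h y)))"
      "\<And>y. y \<in> V \<Longrightarrow> bij (blinfun_apply (Df f (h y)))"
    by blast
  have "C1_on V h" unfolding C1_on_def
  proof (intro conjI ballI)
    show "h differentiable at y" if "y \<in> V" for y using h'(1)[OF that] by (rule differentiableI)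
    show "continuous_on V (Df h)"
    proof (rule continuous_on_blinfun_componentwise)
      fix b :: 'a assume "b \<in> Basis"
      define M where "M y = Df f (h y)" for y
      define s where "s y = Df h y b" for y
      have s: "M y (s y) = b" if "y \<in> V" for y
        using Df_apply_eq[OF h'(1)[OF that]] h'(2,3)[OF that] by (simp add: M_def s_def bij_is_surj surj_f_inv_f)
      have hV: "h y \<in> U" if "y \<in> V" for y using hom that by (auto simp: homeomorphism_def)
      have cM: "continuous_on V M" unfolding M_def
        by (rule continuous_on_compose2[OF C1_on_cont_Df[OF f]]) (use hom hV U in \<open>auto simp: homeomorphism_def\<close>)
      show "continuous_on V (\<lambda>y. Df h y b)"
        unfolding s_def[symmetric] continuous_on_eq_continuous_at[OF U(4)]
      proof
        fix y0 assume y0: "y0 \<in> V"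
        obtain m where m: "m > 0" "\<And>x. m * norm x \<le> norm (M y0 x)"
          using linear_inj_bounded_below_pos[of "blinfun_apply (M y0)"] h'(3)[OF y0] blinfun.bounded_linear_right bounded_linear.linear
          by (metis M_def bij_is_inj)
        have "isCont M y0" using cM continuous_on_eq_continuous_at[OF U(4)] y0 by blast
        then have lim: "((\<lambda>y. norm (M y0 - M y)) \<longlongrightarrow> 0) (at y0)"
          unfolding isCont_def by (auto intro!: tendsto_eq_intros)
        have "\<forall>\<^sub>F y in at y0. norm (M y0 - M y) < m / 2" using order_tendstoD(2)[OF lim, of "m / 2"] m by simp
        moreover have "\<forall>\<^sub>F y in at y0. y \<in> V" using U(4) y0 by (rule eventually_at_in_open')
        ultimately have "\<forall>\<^sub>F y in at y0. norm (s y - s y0) \<le> norm (M y0 - M y) * (2 / m * norm (s y0))"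
        proof eventually_elim
          case (elim y)
          have "m * norm (s y - s y0) \<le> norm (M y0 (s y - s y0))" by (rule m)
          also have "M y0 (s y - s y0) = (M y0 - M y) (s y - s y0) + (M y0 - M y) (s y0)"
            by (simp add: blinfun.bilinear_simps s[OF y0] s[OF elim(2)])
          also have "norm \<dots> \<le> norm (M y0 - M y) * norm (s y - s y0) + norm (M y0 - M y) * norm (s y0)"
            by (intro norm_triangle_mono norm_blinfun)
          also have "norm (M y0 - M y) * norm (s y - s y0) \<le> m / 2 * norm (s y - s y0)"
            using elim(1) by (intro mult_right_mono) auto
          finally have "m / 2 * norm (s y - s y0) \<le> norm (M y0 - M y) * norm (s y0)" by simp
          then show ?case using m(1) by (simp add: field_simps)
        qed
        moreover have "((\<lambda>y. norm (M y0 - M y) * (2 / m * norm (s y0))) \<longlongrightarrow> 0) (at y0)"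
          using tendsto_mult_right[OF lim] by (rule tendsto_eq_rhs) simp
        ultimately have "((\<lambda>y. s y - s y0) \<longlongrightarrow> 0) (at y0)"
          by (rule Lim_null_comparison)
        then show "isCont s y0" unfolding isCont_def by (simp add: LIM_zero_iff)
      qed
    qed
  qed
  then show ?thesis using that U hom by blast
qed

context surface begin

lemma local_diffeomorphism_at:
  fixes f :: "real^2 \<Rightarrow> 'm"
  assumes d: "d \<in> A" and W: "open W" "\<xi> \<in> W" "\<And>q. q \<in> W \<Longrightarrow> f q \<in> chart_dom d"
    and C1: "C1_on W (\<lambda>q. chart_map d (f q))" and inj: "inj (blinfun_apply (Df (\<lambda>q. chart_map d (f q)) \<xi>))"
  shows "\<exists>U h. open U \<and> \<xi> \<in> U \<and> open (f ` U) \<and> homeomorphism U (f ` U) f h \<and>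
        (\<forall>c\<in>A. Ck_on 1 (U \<inter> f -` chart_dom c) (chart_map c \<circ> f) \<and>
               Ck_on 1 (chart_map c ` (chart_dom c \<inter> f ` U)) (h \<circ> chart_inv c))"
proof -
  obtain U V h where U: "open U" "U \<subseteq> W" "\<xi> \<in> U" "open V" and hom: "homeomorphism U V (\<lambda>q. chart_map d (f q)) h" and h: "C1_on V h"
    using C1_local_inverse[OF W(1,2) C1 inj] by blast
  have V: "V = (\<lambda>q. chart_map d (f q)) ` U" using hom by (simp add: homeomorphism_def)
  have fd: "f q \<in> chart_dom d" if "q \<in> U" for q using W(3) U(2) that by blast
  have finv: "chart_inv d (chart_map d (f q)) = f q" if "q \<in> U" for q using chart_inv_map[OF d fd[OF that]] .
  have Vd: "V \<subseteq> chart_codom d" using V fd by auto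
  have fU: "f ` U = chart_dom d \<inter> chart_map d -` V"
  proof
    show "f ` U \<subseteq> chart_dom d \<inter> chart_map d -` V" using fd V by auto
    show "chart_dom d \<inter> chart_map d -` V \<subseteq> f ` U"
    proof
      fix x assume "x \<in> chart_dom d \<inter> chart_map d -` V"
      then obtain q where "q \<in> U" "chart_map d x = chart_map d (f q)" "x \<in> chart_dom d" using V by auto
      then have "x = f q" using chart_inv_map[OF d] fd finv by metis
      then show "x \<in> f ` U" using \<open>q \<in> U\<close> by blast
    qed
  qed
  have ofU: "open (f ` U)" unfolding fU
    by (rule continuous_open_preimage[OF chart_map_cont[OF d] open_chart_dom[OF d] U(4)])
  have cf: "continuous_on U f"
  proof -
    have "continuous_on U (\<lambda>q. chart_inv d (chart_map d (f q)))"
      by (rule continuous_on_compose2[OF chart_inv_cont[OF d]]) (use hom Vd V in \<open>auto simp: homeomorphism_def\<close>)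
    then show ?thesis by (rule continuous_on_eq) (use finv in auto)
  qed
  have hom': "homeomorphism U (f ` U) f (\<lambda>x. h (chart_map d x))"
    unfolding homeomorphism_def
  proof (intro conjI ballI)
    show "continuous_on (f ` U) (\<lambda>x. h (chart_map d x))"
      by (rule continuous_on_compose2[OF C1_on_continuous[OF h] continuous_on_subset[OF chart_map_cont[OF d]]]) (use fU in auto)
    show "(\<lambda>x. h (chart_map d x)) ` f ` U = U" using hom by (auto simp: homeomorphism_def image_image)
  qed (use cf hom in \<open>auto simp: homeomorphism_def\<close>)
  have 1: "C1_on (U \<inter> f -` chart_dom c) (chart_map c \<circ> f)" if c: "c \<in> A" for c
  proof (rule C1_on_cong)
    show "open (U \<inter> f -` chart_dom c)" by (rule continuous_open_preimage[OF cf U(1) open_chart_dom[OF c]])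
    show "C1_on (U \<inter> f -` chart_dom c) (\<lambda>q. transition d c (chart_map d (f q)))"
    proof (rule C1_on_compose[OF C1_on_subset[OF C1] smooth_on_C1_on[OF transition_smooth[OF d c]]])
      show "U \<inter> f -` chart_dom c \<subseteq> W" using U(2) by auto
      show "chart_map d (f q) \<in> overlap d c" if "q \<in> U \<inter> f -` chart_dom c" for q using that fd by (auto intro: overlapI)
    qed
    show "transition d c (chart_map d (f q)) = (chart_map c \<circ> f) q" if "q \<in> U \<inter> f -` chart_dom c" for q
      using that finv by (simp add: transition_eq)
  qed
  have 2: "C1_on (chart_map c ` (chart_dom c \<inter> f ` U)) ((\<lambda>x. h (chart_map d x)) \<circ> chart_inv c)" if c: "c \<in> A" for c
  proof (rule C1_on_cong)
    let ?S = "chart_map c ` (chart_dom c \<inter> f ` U)"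
    have S: "?S = chart_codom c \<inter> chart_inv c -` (f ` U)"
    proof
      show "?S \<subseteq> chart_codom c \<inter> chart_inv c -` (f ` U)" using chart_inv_map[OF c] by auto
      show "chart_codom c \<inter> chart_inv c -` (f ` U) \<subseteq> ?S"
      proof
        fix y assume y: "y \<in> chart_codom c \<inter> chart_inv c -` (f ` U)"
        then have "chart_map c (chart_inv c y) = y" "chart_inv c y \<in> chart_dom c" using chart_map_inv[OF c] chart_inv_in[OF c] by auto
        then show "y \<in> ?S" using y by (metis IntD2 IntI image_eqI vimageD)
      qed
    qed
    show "open ?S" unfolding S by (rule continuous_open_preimage[OF chart_inv_cont[OF c] open_chart_codom[OF c] ofU])
    show "C1_on ?S (\<lambda>y. h (transition c d y))"
    proof (rule C1_on_compose[OF C1_on_subset[OF smooth_on_C1_on[OF transition_smooth[OF c d]]] h])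
      show "?S \<subseteq> overlap c d" using fd by (auto intro: overlapI)
      fix y assume "y \<in> ?S"
      then have "chart_inv c y \<in> f ` U" unfolding S by blast
      then show "transition c d y \<in> V" unfolding fU by (simp add: transition_eq)
    qed
    show "h (transition c d y) = ((\<lambda>x. h (chart_map d x)) \<circ> chart_inv c) y" for y by (simp add: transition_eq)
  qed
  show ?thesis
    by (intro exI[of _ U] exI[of _ "\<lambda>x. h (chart_map d x)"] conjI ballI)
      (use U(1,3) ofU hom' 1[unfolded C1_on_eq_Ck_on_1] 2[unfolded C1_on_eq_Ck_on_1] in blast)+
qed

end

context flow_family begin

lemma smooth_near_C1:
  assumes s: "smooth_near c t1 \<delta> W Z" and c: "c \<in> A"
  shows "C1_on ({t1-\<delta><..<t1+\<delta>} \<times> W) (\<lambda>(t, q). Y c t q)"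
proof (rule C1_onI)
  let ?S = "{t1-\<delta><..<t1+\<delta>} \<times> W"
  have D: "((\<lambda>(t, q). Y c t q) has_derivative (\<lambda>(s, k). s *\<^sub>R F c (Y c t q) + Z t q k)) (at (t, q))"
    and dom: "fst (\<Phi> t (v q)) \<in> chart_dom c" if "(t, q) \<in> ?S" for t q
    using s that by (auto simp: smooth_near_def)
  fix p assume "p \<in> ?S"
  then obtain t q where p: "p = (t, q)" "(t, q) \<in> ?S" by (cases p) auto
  show "((\<lambda>(t, q). Y c t q) has_derivative
     ((blinfun_scaleR_left (F c (Y c (fst p) (snd p))) o\<^sub>L fst_blinfun) + (Z (fst p) (snd p) o\<^sub>L snd_blinfun))) (at p)"
    using D[OF p(2)] by (simp add: p case_prod_unfold blinfun_compose.rep_eq plus_blinfun.rep_eq)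
next
  let ?S = "{t1-\<delta><..<t1+\<delta>} \<times> W"
  have D: "((\<lambda>(t, q). Y c t q) has_derivative (\<lambda>(s, k). s *\<^sub>R F c (Y c t q) + Z t q k)) (at (t, q))"
    and dom: "fst (\<Phi> t (v q)) \<in> chart_dom c" if "(t, q) \<in> ?S" for t q
    using s that by (auto simp: smooth_near_def)
  have "continuous_on ?S (\<lambda>(t, q). Y c t q)"
    using D has_derivative_continuous by (intro continuous_at_imp_continuous_on) blast
  then have "continuous_on ?S (\<lambda>p. Y c (fst p) (snd p))" by (simp add: case_prod_unfold)
  moreover have "(\<lambda>p. Y c (fst p) (snd p)) ` ?S \<subseteq> punct c"
    using Y_coord(1)[OF c dom] by (intro image_subsetI) (metis prod.collapse)
  ultimately have "continuous_on ?S (\<lambda>p. F c (Y c (fst p) (snd p)))"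
    by (rule continuous_on_compose2[OF C1_on_continuous[OF field_C1[OF c]]])
  moreover have "continuous_on ?S (\<lambda>p. Z (fst p) (snd p))" using s by (simp add: smooth_near_def case_prod_unfold)
  ultimately show "continuous_on ?S (\<lambda>p. (blinfun_scaleR_left (F c (Y c (fst p) (snd p))) o\<^sub>L fst_blinfun) + (Z (fst p) (snd p) o\<^sub>L snd_blinfun))"
    by (intro continuous_intros bounded_linear.continuous_on[OF bounded_linear_blinfun_scaleR_left])
qed

end

section \<open>The exponential map away from the origin\<close>

context thermo begin

lemma tangent_point_chart_at:
  assumes "c = chart_at A x" "y = chart_map c x"
  shows "tangent_point A c (y, w) = (x, w)"
proof -
  have c: "c \<in> A" "x \<in> chart_dom c" using chart_at assms by auto
  then show ?thesis using assms dtrans_self[OF c(1), of y w] by (simp add: tangent_point_eq chart_inv_map)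
qed

lemma g_eq_B:
  assumes "c = chart_at A x" "y = chart_map c x"
  shows "g x u w = B c y u w"
proof -
  have c: "c \<in> A" "x \<in> chart_dom c" using chart_at assms by auto
  show ?thesis using B_tangent_point[OF c(1), of y u w] c assms tangent_point_chart_at[OF assms]
    by (simp add: chart_inv_map)
qed

lemma normalize_tangent_unit: "\<xi> \<noteq> 0 \<Longrightarrow> normalize_tangent g (x, \<xi>) \<in> unit_tangent g"
  using g_pos[of \<xi> x] by (simp add: normalize_tangent_def unit_tangent_def bilinear_lmul[OF g_bilinear] bilinear_rmul[OF g_bilinear])

lemma tangent_coord_normalize:
  assumes "c = chart_at A x" "y = chart_map c x"
  shows "tangent_coord A c (normalize_tangent g (x, \<xi>)) = (y, (1 / sqrt (B c y \<xi> \<xi>)) *\<^sub>R \<xi>)"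
proof -
  have c: "c \<in> A" "y \<in> chart_codom c" using chart_at assms by auto
  have "normalize_tangent g (x, \<xi>) = tangent_point A c (y, (1 / sqrt (B c y \<xi> \<xi>)) *\<^sub>R \<xi>)"
    by (simp add: normalize_tangent_def g_eq_B[OF assms] tangent_point_chart_at[OF assms])
  then show ?thesis using tangent_coord_point[OF c(1), of "(y, (1 / sqrt (B c y \<xi> \<xi>)) *\<^sub>R \<xi>)"] c by simp
qed

lemma exp_nonzero:
  fixes \<xi> :: "real^2"
  assumes p: "C1_along_flow A g lam p" and \<kappa>: "\<forall>v\<in>unit_tangent g. kappa A g lam p v \<le> 0" and \<xi>: "\<xi> \<noteq> 0"
  shows "\<exists>d W. d \<in> A \<and> open W \<and> \<xi> \<in> W \<and> (\<forall>q\<in>W. thermostat_exp A g lam x q \<in> chart_dom d) \<and>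
    C1_on W (\<lambda>q. chart_map d (thermostat_exp A g lam x q)) \<and>
    inj (blinfun_apply (Df (\<lambda>q. chart_map d (thermostat_exp A g lam x q)) \<xi>))"
proof -
  define c where "c = chart_at A x"
  define y where "y = chart_map c x"
  have c: "c \<in> A" "x \<in> chart_dom c" "y \<in> chart_codom c" using chart_at by (auto simp: c_def y_def)
  define vv where "vv q = normalize_tangent g (x, if q = 0 then \<xi> else q)" for q
  define n where "n q = sqrt (B c y q q)" for q
  have B_q: "B c y q q > 0" if "q \<noteq> 0" for q using B_pos[OF c(1,3) that] .
  have n_pos: "n q > 0" if "q \<noteq> 0" for q using B_q[OF that] by (simp add: n_def)
  have vv: "tangent_coord A c (vv q) = (y, (1 / n q) *\<^sub>R q)" if "q \<noteq> 0" for q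
    using that tangent_coord_normalize[OF c_def y_def] by (simp add: vv_def n_def)
  have C1B: "C1_on S (\<lambda>q. B c y q q)" for S
    by (intro C1_B[OF c(1)] C1_on_const C1_on_ident) (use c in auto)
  have C1n: "C1_on (- {0}) n" unfolding n_def[abs_def] by (intro C1_on_sqrt C1B) (use B_q in auto)
  interpret fl: flow_family A g lam vv \<xi>
  proof
    show "vv q \<in> unit_tangent g" for q unfolding vv_def by (rule normalize_tangent_unit) (use \<xi> in auto)
    have "C1_on (- {0}) (\<lambda>q. tangent_coord A c (vv q))"
    proof (rule C1_on_cong)
      show "C1_on (- {0}) (\<lambda>q. (y, (1 / n q) *\<^sub>R q))"
        by (intro C1_on_Pair C1_on_const C1_on_scaleR C1_on_divide C1n C1_on_ident) (use n_pos in force)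
    qed (use vv in auto)
    moreover have "fst (vv q) \<in> chart_dom c" for q using c by (simp add: vv_def normalize_tangent_def)
    ultimately show "\<exists>c W. c \<in> A \<and> open W \<and> \<xi> \<in> W \<and> (\<forall>q\<in>W. fst (vv q) \<in> chart_dom c) \<and> C1_on W (\<lambda>q. tangent_coord A c (vv q))"
      using c(1) \<xi> by (intro exI[of _ c] exI[of _ "- {0}"]) auto
  qed
  have ex: "thermostat_exp A g lam x q = fst (\<Phi> (n q) (vv q))" if "q \<noteq> 0" for q
    using that by (simp add: thermostat_exp_def vv_def n_def g_eq_B[OF c_def y_def])
  define T where "T = n \<xi>"
  have T: "T > 0" using n_pos \<xi> by (simp add: T_def)
  define d where "d = chart_at A (fst (\<Phi> T (vv \<xi>)))"
  have d: "d \<in> A" "fst (\<Phi> T (vv \<xi>)) \<in> chart_dom d" using chart_at by (auto simp: d_def)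
  obtain \<delta> W Z where s: "fl.smooth_near d T \<delta> W Z" using fl.smooth_everywhere[OF d] by blast
  have W: "open W" "\<xi> \<in> W" "\<delta> > 0" and dom: "\<And>t q. t \<in> {T-\<delta><..<T+\<delta>} \<Longrightarrow> q \<in> W \<Longrightarrow> fst (\<Phi> t (vv q)) \<in> chart_dom d"
    using s by (auto simp: fl.smooth_near_def)
  define N where "N = W \<inter> (- {0} \<inter> n -` {T-\<delta><..<T+\<delta>})"
  have N: "open N" unfolding N_def
    by (intro open_Int W continuous_open_preimage C1_on_continuous C1n) auto
  have \<xi>N: "\<xi> \<in> N" using W \<xi> by (auto simp: N_def T_def)
  have exN: "thermostat_exp A g lam x q \<in> chart_dom d" "chart_map d (thermostat_exp A g lam x q) = fst (fl.Y d (n q) q)" if "q \<in> N" for q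
    using that ex[of q] dom[of "n q" q] by (auto simp: N_def fst_tangent_coord)
  define f where "f q = chart_map d (thermostat_exp A g lam x q)" for q
  have fC1: "C1_on N f"
  proof (rule C1_on_cong[OF N])
    have "C1_on N (\<lambda>q. case (n q, q) of (t, q) \<Rightarrow> fl.Y d t q)"
      by (rule C1_on_compose[OF _ fl.smooth_near_C1[OF s d(1)]])
        (auto simp: N_def intro!: C1_on_Pair C1_on_ident C1_on_subset[OF C1n])
    then show "C1_on N (\<lambda>q. fst (fl.Y d (n q) q))"
      using C1_on_linear_compose[OF bounded_linear_fst] by force
  qed (use exN f_def in auto)
  note Y = fl.Y_coord[OF d]
  define w where "w = snd (fl.Y d T \<xi>)"
  define e where "e k = fst (fl.jac d T k)" for k
  have B\<xi>: "((\<lambda>q. B c y q q) has_derivative (\<lambda>k. 2 * B c y \<xi> k)) (at \<xi>)"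
  proof -
    have "((\<lambda>q. B c y q q) has_derivative (\<lambda>k. B c y (k + Gam c y 0 \<xi>) \<xi> + B c y \<xi> (k + Gam c y 0 \<xi>))) (at \<xi>)"
      by (rule B_has_derivative[where y="\<lambda>_. y" and x=\<xi>, OF c(1,3)]) (auto intro!: derivative_eq_intros)
    moreover have "B c y k \<xi> + B c y \<xi> k = 2 * B c y \<xi> k" for k using B_sym[OF c(1,3), of k \<xi>] by simp
    ultimately show ?thesis by (simp only: Gam_simps add_0_right)
  qed
  have n\<xi>: "(n has_derivative (\<lambda>k. B c y \<xi> k / T)) (at \<xi>)"
    using has_derivative_real_sqrt[OF B_q[OF \<xi>] B\<xi>] unfolding T_def n_def[abs_def]
    by (rule back_subst[of "\<lambda>f. (_ has_derivative f) _"]) (simp add: fun_eq_iff field_simps)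
  have f': "Df f \<xi> k = (B c y \<xi> k / T) *\<^sub>R w + e k" for k
  proof -
    have "((\<lambda>(t, q). fl.Y d t q) has_derivative (\<lambda>(s, k). s *\<^sub>R F d (fl.Y d T \<xi>) + Z T \<xi> k)) (at (n \<xi>, \<xi>))"
      using s W by (simp add: fl.smooth_near_def T_def)
    from has_derivative_compose[where f="\<lambda>q. (n q, q)" and x=\<xi>, OF has_derivative_Pair[OF n\<xi> has_derivative_ident] this]
    have "((\<lambda>q. fl.Y d (n q) q) has_derivative (\<lambda>k. (B c y \<xi> k / T) *\<^sub>R F d (fl.Y d T \<xi>) + Z T \<xi> k)) (at \<xi>)"
      by simp
    then have "((\<lambda>q. fst (fl.Y d (n q) q)) has_derivative (\<lambda>k. fst ((B c y \<xi> k / T) *\<^sub>R F d (fl.Y d T \<xi>) + Z T \<xi> k))) (at \<xi>)"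
      by (rule has_derivative_fst)
    then have fD: "(f has_derivative (\<lambda>k. fst ((B c y \<xi> k / T) *\<^sub>R F d (fl.Y d T \<xi>) + Z T \<xi> k))) (at \<xi>)"
      by (rule has_derivative_transform_within_open[OF _ N \<xi>N]) (simp add: f_def exN)
    have "Z T \<xi> = Df (fl.Y d T) \<xi>"
      by (rule Df_eqI[symmetric, OF fl.smooth_near_slice[OF s]]) (use W in auto)
    then show ?thesis unfolding Df_apply_eq[OF fD] by (simp add: w_def e_def fl.jac_def field_eq)
  qed
  have e\<xi>: "e \<xi> = 0"
  proof -
    have "((\<lambda>r. fl.Y d T (r *\<^sub>R \<xi>)) has_derivative (\<lambda>h. fl.jac d T (h *\<^sub>R \<xi>))) (at 1)"
      by (rule has_derivative_compose[where f="\<lambda>r. r *\<^sub>R \<xi>"])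
        (use fl.Y_differentiable[OF d] in \<open>auto intro!: derivative_eq_intros\<close>)
    then have "((\<lambda>r. fl.Y d T \<xi>) has_derivative (\<lambda>h. fl.jac d T (h *\<^sub>R \<xi>))) (at 1)"
    proof (rule has_derivative_transform_within_open[OF _ open_greaterThan[of 0]])
      fix r :: real assume r: "r \<in> {0<..}"
      have "sqrt (r * (r * g x \<xi> \<xi>)) = r * sqrt (g x \<xi> \<xi>)" using r by (simp add: real_sqrt_mult flip: mult.assoc)
      then have "vv (r *\<^sub>R \<xi>) = vv \<xi>"
        using r \<xi> by (simp add: vv_def normalize_tangent_def bilinear_lmul[OF g_bilinear] bilinear_rmul[OF g_bilinear])
      then show "fl.Y d T (r *\<^sub>R \<xi>) = fl.Y d T \<xi>" by simp
    qed simp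
    from fun_cong[OF has_derivative_unique[OF this has_derivative_const], of 1] show ?thesis by (simp add: e_def)
  qed
  define k0 where "k0 = J c y \<xi>"
  have cw: "cross w (e k0) \<noteq> 0"
  proof -
    have "fst (vv \<xi>) \<in> chart_dom c" using c by (simp add: vv_def normalize_tangent_def)
    have Y0: "fl.Y c 0 q = (y, (1 / n q) *\<^sub>R q)" if "q \<noteq> 0" for q
      using vv[OF that] flow_0[OF fl.v] by simp
    have "((\<lambda>q. 1 / n q) has_derivative (\<lambda>k. - (B c y \<xi> k / T) / (T * T))) (at \<xi>)"
      using has_derivative_divide[OF has_derivative_const n\<xi>, of 1] T by (simp add: T_def divide_inverse mult_ac)
    then have "((\<lambda>q. (y, (1 / n q) *\<^sub>R q)) has_derivative (\<lambda>k. (0, (1 / n \<xi>) *\<^sub>R k + (- (B c y \<xi> k / T) / (T * T)) *\<^sub>R \<xi>))) (at \<xi>)"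
      by (intro has_derivative_Pair has_derivative_const has_derivative_scaleR has_derivative_ident)
    then have "(fl.Y c 0 has_derivative (\<lambda>k. (0, (1 / n \<xi>) *\<^sub>R k + (- (B c y \<xi> k / T) / (T * T)) *\<^sub>R \<xi>))) (at \<xi>)"
      by (rule has_derivative_transform_within_open[where s="- {0}"]) (use \<xi> Y0 in auto)
    from Df_apply_eq[OF this] have "fl.jac c 0 k0 = (0, (1 / n \<xi>) *\<^sub>R k0)"
      by (simp add: fl.jac_def k0_def B_J_self[OF c(1,3)])
    then have "fl.jac c 0 k0 = (0, J c (fst (fl.Y c 0 \<xi>)) (snd (fl.Y c 0 \<xi>)))"
      by (simp add: Y0[OF \<xi>] k0_def J_simps)
    from fl.normal_pos[OF p \<kappa> c(1) \<open>fst (vv \<xi>) \<in> chart_dom c\<close> this T d]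
    have "B d (fst (fl.Y d T \<xi>)) (e k0) (J d (fst (fl.Y d T \<xi>)) w) > 0" by (simp add: fl.normal_def e_def w_def)
    then show ?thesis by (auto simp: B_J[OF d(1) Y(4)])
  qed
  have "inj (blinfun_apply (Df f \<xi>))"
    unfolding linear_injective_0[OF bounded_linear.linear[OF blinfun.bounded_linear_right]]
  proof (intro allI impI)
    fix k assume k: "Df f \<xi> k = 0"
    have unit: "B c y ((1 / T) *\<^sub>R \<xi>) ((1 / T) *\<^sub>R \<xi>) = 1"
      using B_q[OF \<xi>] by (simp add: B_simps T_def n_def)
    define a b where "a = B c y k ((1 / T) *\<^sub>R \<xi>) / T" and "b = B c y k (J c y ((1 / T) *\<^sub>R \<xi>)) / T"
    have kab: "k = a *\<^sub>R \<xi> + b *\<^sub>R k0"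
      using orthonormal_expand[OF c(1,3) unit, of k] by (simp add: a_def b_def k0_def J_simps)
    have "Df f \<xi> \<xi> = T *\<^sub>R w" using B_q[OF \<xi>] by (simp add: f' e\<xi> T_def n_def real_div_sqrt)
    moreover have "Df f \<xi> k0 = e k0" by (simp add: f' k0_def B_J_self[OF c(1,3)])
    ultimately have 0: "(a * T) *\<^sub>R w + b *\<^sub>R e k0 = 0"
      using k unfolding kab by (simp add: blinfun.bilinear_simps)
    then have "cross w ((a * T) *\<^sub>R w + b *\<^sub>R e k0) = 0" by simp
    then have "b * cross w (e k0) = 0" by (simp add: algebra_simps)
    then have b: "b = 0" using cw by simp
    moreover have "w \<noteq> 0" using cw by auto
    ultimately have "a = 0" using 0 T by simp
    then show "k = 0" using b kab by simp
  qed
  then show ?thesis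
    using d(1) N \<xi>N exN(1) fC1 unfolding f_def[abs_def] by blast
qed

end

section \<open>The exponential map at the origin\<close>

lemma homogeneous_C1:
  fixes h :: "'a::euclidean_space \<times> 'b::euclidean_space \<Rightarrow> 'c::real_normed_vector"
  assumes S: "open S" and reg: "C1_on (S \<times> (- {0})) h"
    and hom: "\<And>y w s. y \<in> S \<Longrightarrow> s > 0 \<Longrightarrow> h (y, s *\<^sub>R w) = s\<^sup>2 *\<^sub>R h (y, w)"
    and zero: "\<And>y. h (y, 0) = 0"
  shows "C1_on (S \<times> UNIV) h" and "y \<in> S \<Longrightarrow> Df h (y, 0) = 0"
proof -
  have oS: "open (S \<times> (UNIV :: 'b set))" "open (S \<times> (- {0 :: 'b}))" using S by (auto intro!: open_Times)
  have bounds: "\<exists>r C. r > 0 \<and> C > 0 \<and> ball y r \<subseteq> S \<and> (\<forall>z\<in>ball y r. \<forall>w. norm (h (z, w)) \<le> C * (norm w)\<^sup>2) \<and>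
     (\<forall>z\<in>ball y r. \<forall>w. w \<noteq> 0 \<longrightarrow> norm (Df h (z, w)) \<le> C * ((norm w)\<^sup>2 + norm w))" if y: "y \<in> S" for y
  proof -
    obtain r where r: "r > 0" "cball y r \<subseteq> S" using S y open_contains_cball by blast
    define K where "K = cball y r \<times> sphere (0 :: 'b) 1"
    have K: "compact K" "K \<subseteq> S \<times> (- {0})" using r by (auto simp: K_def intro!: compact_Times)
    obtain C1 where C1: "C1 > 0" "\<And>u. u \<in> K \<Longrightarrow> norm (h u) \<le> C1"
      using compact_imp_bounded[OF compact_continuous_image[OF continuous_on_subset[OF C1_on_continuous[OF reg] K(2)] K(1)]]
      by (auto simp: bounded_pos)
    obtain C2 where C2: "C2 > 0" "\<And>u. u \<in> K \<Longrightarrow> norm (Df h u) \<le> C2"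
      using compact_imp_bounded[OF compact_continuous_image[OF continuous_on_subset[OF C1_on_cont_Df[OF reg] K(2)] K(1)]]
      by (auto simp: bounded_pos)
    have hb: "norm (h u) \<le> C1 + C2" "norm (Df h u) \<le> C1 + C2" if "u \<in> K" for u
      using C1(2)[OF that] C2(2)[OF that] C1(1) C2(1) by auto
    have "norm (h (z, w)) \<le> (C1 + C2) * (norm w)\<^sup>2" if z: "z \<in> ball y r" for z w
    proof (cases "w = 0")
      case False
      define e where "e = (1 / norm w) *\<^sub>R w"
      have w: "w = norm w *\<^sub>R e" using False by (simp add: e_def)
      have "(z, e) \<in> K" using z False by (simp add: K_def e_def)
      have "h (z, norm w *\<^sub>R e) = (norm w)\<^sup>2 *\<^sub>R h (z, e)" using z r False by (intro hom) auto
      then have "norm (h (z, w)) = (norm w)\<^sup>2 * norm (h (z, e))" using w by simp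
      also have "\<dots> \<le> (norm w)\<^sup>2 * (C1 + C2)" using hb(1)[OF \<open>(z, e) \<in> K\<close>] by (intro mult_left_mono) auto
      finally show ?thesis by (simp add: mult.commute)
    qed (simp add: zero)
    moreover have "norm (Df h (z, w)) \<le> (C1 + C2) * ((norm w)\<^sup>2 + norm w)" if z: "z \<in> ball y r" and w0: "w \<noteq> 0" for z w
    proof -
      define s where "s = norm w"
      have s: "s > 0" using w0 by (simp add: s_def)
      define e where "e = (1 / s) *\<^sub>R w"
      have K': "(z, e) \<in> K" using z w0 by (simp add: K_def e_def s_def)
      have zS: "z \<in> S" using z r by auto
      have "((\<lambda>u. h (fst u, (1 / s) *\<^sub>R snd u)) has_derivative (\<lambda>k. Df h (z, e) (fst k, (1 / s) *\<^sub>R snd k))) (at (z, w))"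
      proof (rule has_derivative_compose[where f="\<lambda>u. (fst u, (1 / s) *\<^sub>R snd u)"])
        show "((\<lambda>u. (fst u, (1 / s) *\<^sub>R snd u)) has_derivative (\<lambda>k. (fst k, (1 / s) *\<^sub>R snd k))) (at (z, w))"
          by (auto intro!: derivative_eq_intros)
        show "(h has_derivative Df h (z, e)) (at (fst (z, w), (1 / s) *\<^sub>R snd (z, w)))"
          using C1_on_D[OF reg subsetD[OF K(2) K']] by (simp add: e_def)
      qed
      then have "((\<lambda>u. s\<^sup>2 *\<^sub>R h (fst u, (1 / s) *\<^sub>R snd u)) has_derivative (\<lambda>k. s\<^sup>2 *\<^sub>R Df h (z, e) (fst k, (1 / s) *\<^sub>R snd k))) (at (z, w))"
        by (rule has_derivative_scaleR_right)
      then have "(h has_derivative (\<lambda>k. s\<^sup>2 *\<^sub>R Df h (z, e) (fst k, (1 / s) *\<^sub>R snd k))) (at (z, w))"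
      proof (rule has_derivative_transform_within_open[OF _ oS(1)])
        fix u assume "u \<in> S \<times> (UNIV :: 'b set)"
        then have "h (fst u, s *\<^sub>R ((1 / s) *\<^sub>R snd u)) = s\<^sup>2 *\<^sub>R h (fst u, (1 / s) *\<^sub>R snd u)" using s by (intro hom) auto
        then show "s\<^sup>2 *\<^sub>R h (fst u, (1 / s) *\<^sub>R snd u) = h u" using s by simp
      qed (use zS in auto)
      from Df_apply_eq[OF this] have D: "Df h (z, w) k = s\<^sup>2 *\<^sub>R Df h (z, e) (fst k, (1 / s) *\<^sub>R snd k)" for k by simp
      have "norm (Df h (z, w)) \<le> (s\<^sup>2 + s) * (C1 + C2)"
      proof (rule norm_blinfun_bound)
        fix k :: "'a \<times> 'b"
        have "norm (fst k, (1 / s) *\<^sub>R snd k) \<le> norm (fst k) + norm ((1 / s) *\<^sub>R snd k)" by (rule norm_Pair_le)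
        also have "\<dots> \<le> norm k + (1 / s) * norm k"
          using s norm_fst_le[of "fst k" "snd k"] norm_snd_le[of "snd k" "fst k"] by (auto intro!: add_mono mult_left_mono simp: divide_right_mono)
        finally have "norm (Df h (z, e) (fst k, (1 / s) *\<^sub>R snd k)) \<le> (C1 + C2) * (norm k + (1 / s) * norm k)"
          using C1(1) C2(1) hb(2)[OF K'] by (intro order_trans[OF norm_blinfun] mult_mono) auto
        then have "norm (Df h (z, w) k) \<le> s\<^sup>2 * ((C1 + C2) * (norm k + (1 / s) * norm k))"
          by (simp add: D mult_left_mono)
        also have "\<dots> = (s\<^sup>2 + s) * (C1 + C2) * norm k" using s by (simp add: field_simps power2_eq_square)
        finally show "norm (Df h (z, w) k) \<le> (s\<^sup>2 + s) * (C1 + C2) * norm k" .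
      qed (use s C1(1) C2(1) in auto)
      then show ?thesis by (simp add: s_def mult.commute)
    qed
    moreover have "ball y r \<subseteq> S" using r by auto
    ultimately show ?thesis using r(1) C1(1) C2(1) by (intro exI[of _ r] exI[of _ "C1 + C2"]) auto
  qed
  have D0: "(h has_derivative blinfun_apply 0) (at (y, 0))" if y: "y \<in> S" for y
  proof -
    obtain r C where r: "r > 0" "C > 0" "ball y r \<subseteq> S" "\<And>z w. z \<in> ball y r \<Longrightarrow> norm (h (z, w)) \<le> C * (norm w)\<^sup>2"
      using bounds[OF y] by blast
    show ?thesis unfolding has_derivative_at_alt
    proof (intro conjI allI impI)
      fix e :: real assume e: "e > 0"
      have "norm (h u - h (y, 0) - blinfun_apply 0 (u - (y, 0))) \<le> e * norm (u - (y, 0))" if u: "norm (u - (y, 0)) < min r (e / C)" for u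
      proof -
        let ?n = "norm (u - (y, 0))"
        have "u - (y, 0) = (fst u - y, snd u)" by (simp add: prod_eq_iff)
        then have "norm (fst u - y) \<le> ?n" "norm (snd u) \<le> ?n" by (simp_all only: norm_fst_le norm_snd_le)
        then have f: "fst u \<in> ball y r" and s: "norm (snd u) \<le> ?n" using u by (auto simp: dist_norm norm_minus_commute)
        have "norm (h u) \<le> C * (norm (snd u))\<^sup>2" using r(4)[OF f, of "snd u"] by simp
        also have "\<dots> \<le> C * ?n\<^sup>2" using s r by (intro mult_left_mono power_mono) auto
        also have "\<dots> = (C * ?n) * ?n" by (simp add: power2_eq_square)
        also have "\<dots> \<le> e * ?n" using u r(2) by (intro mult_right_mono) (auto simp: field_simps)
        finally show ?thesis by (simp add: zero zero_blinfun.rep_eq)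
      qed
      then show "\<exists>d>0. \<forall>u. norm (u - (y, 0)) < d \<longrightarrow> norm (h u - h (y, 0) - blinfun_apply 0 (u - (y, 0))) \<le> e * norm (u - (y, 0))"
        using r e by (intro exI[of _ "min r (e / C)"]) auto
    qed (simp add: blinfun.bounded_linear_right)
  qed
  then show "y \<in> S \<Longrightarrow> Df h (y, 0) = 0" using Df_eqI by blast
  have Dall: "(h has_derivative Df h u) (at u)" if "u \<in> S \<times> UNIV" for u
  proof (cases "snd u = 0")
    case True
    then show ?thesis using D0[of "fst u"] Df_eqI[OF D0[of "fst u"]] that by (cases u) auto
  next
    case False
    then show ?thesis using that by (intro C1_on_D[OF reg]) (auto simp: mem_Times_iff)
  qed
  show "C1_on (S \<times> UNIV) h"
  proof (rule C1_onI[OF Dall])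
    show "continuous_on (S \<times> UNIV) (Df h)" unfolding continuous_on_eq_continuous_at[OF oS(1)]
    proof
      fix u assume u: "u \<in> S \<times> (UNIV :: 'b set)"
      show "isCont (Df h) u"
      proof (cases "snd u = 0")
        case False
        then have "u \<in> S \<times> (- {0})" using u by (auto simp: mem_Times_iff)
        then show ?thesis using C1_on_cont_Df[OF reg] continuous_on_eq_continuous_at[OF oS(2)] by blast
      next
        case True
        then obtain y where y: "u = (y, 0)" "y \<in> S" using u by (cases u) auto
        obtain r C where r: "r > 0" "C > 0" "ball y r \<subseteq> S"
          "\<And>z w. z \<in> ball y r \<Longrightarrow> w \<noteq> 0 \<Longrightarrow> norm (Df h (z, w)) \<le> C * ((norm w)\<^sup>2 + norm w)"
          using bounds[OF y(2)] by blast
        have D00: "Df h (z, 0) = 0" if "z \<in> S" for z using D0[OF that] by (rule Df_eqI)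
        have bd: "norm (Df h p) \<le> C * ((norm (snd p))\<^sup>2 + norm (snd p))" if "fst p \<in> ball y r" for p
          using r(4)[OF that, of "snd p"] D00[of "fst p"] that r(2,3) by (cases "snd p = 0") (auto simp: subset_iff prod_eq_iff, metis norm_zero order_refl prod.collapse)
        have "\<forall>\<^sub>F p in nhds (y, 0 :: 'b). fst p \<in> ball y r"
          by (rule isCont_eventually_in_open[where f=fst]) (use r in auto)
        then have "\<forall>\<^sub>F p in at (y, 0). norm (Df h p - Df h (y, 0)) \<le> C * ((norm (snd p))\<^sup>2 + norm (snd p))"
          using bd D00[OF y(2)] by (auto simp: eventually_at_filter elim!: eventually_mono)
        moreover have "isCont (\<lambda>p :: 'a \<times> 'b. C * ((norm (snd p))\<^sup>2 + norm (snd p))) (y, 0)"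
          by (intro continuous_intros)
        then have "((\<lambda>p. C * ((norm (snd p))\<^sup>2 + norm (snd p))) \<longlongrightarrow> 0) (at (y, 0 :: 'b))" by (simp add: isCont_def)
        ultimately have "((\<lambda>p. Df h p - Df h (y, 0)) \<longlongrightarrow> 0) (at (y, 0))"
          by (rule Lim_null_comparison)
        then show ?thesis unfolding isCont_def y by (simp add: LIM_zero_iff)
      qed
    qed
  qed
qed

context thermo begin

text \<open>The flow of the unit-speed field, run with arbitrary constant speed, is the flow of a field
  that is homogeneous of degree two in the velocity and hence continuously differentiable across the
  zero section. Its time-one map is the exponential map.\<close>

definition hfield :: "'m chart \<Rightarrow> (real^2) \<times> (real^2) \<Rightarrow> (real^2) \<times> (real^2)" where
  "hfield c u = (snd u, - Gam c (fst u) (snd u) (snd u) + (sqrt (B c (fst u) (snd u) (snd u)) * L c u) *\<^sub>R J c (fst u) (snd u))"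

lemma hfield_C1:
  assumes c: "c \<in> A"
  shows "C1_on (chart_codom c \<times> UNIV) (hfield c)"
    and "y \<in> chart_codom c \<Longrightarrow> Df (hfield c) (y, 0) h = (snd h, 0)"
proof -
  define N where "N u = - Gam c (fst u) (snd u) (snd u) + (sqrt (B c (fst u) (snd u) (snd u)) * L c u) *\<^sub>R J c (fst u) (snd u)" for u
  have C1N: "C1_on (punct c) N"
    unfolding N_def[abs_def]
    by (intro C1_on_add C1_on_minus C1_on_scaleR C1_on_mult C1_on_sqrt C1_B[OF c] L_C1[OF c] C1_on_snd Gam_C1[OF c] J_C1[OF c] C1_on_fst)
      (use B_pos[OF c] in \<open>auto simp: mem_Times_iff\<close>)
  have hom: "N (y, s *\<^sub>R w) = s\<^sup>2 *\<^sub>R N (y, w)" if "y \<in> chart_codom c" "s > 0" for y w s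
  proof (cases "w = 0")
    case False
    have "sqrt (s * (s * B c y w w)) = s * sqrt (B c y w w)" using that(2) by (simp add: real_sqrt_mult flip: mult.assoc)
    then show ?thesis using local_rep_scale[OF c that(1) False that(2)]
      by (simp add: N_def B_simps Gam_simps J_simps power2_eq_square algebra_simps)
  qed (simp add: N_def Gam_simps J_simps)
  have N0: "N (y, 0) = 0" for y by (simp add: N_def Gam_simps J_simps)
  have N: "C1_on (chart_codom c \<times> UNIV) N" "\<And>y. y \<in> chart_codom c \<Longrightarrow> Df N (y, 0) = 0"
    by (rule homogeneous_C1[OF open_chart_codom[OF c] C1N]; use hom N0 in blast)+
  have hf: "hfield c = (\<lambda>u. (snd u, N u))" by (simp add: fun_eq_iff hfield_def N_def)
  show "C1_on (chart_codom c \<times> UNIV) (hfield c)" unfolding hf by (intro C1_on_Pair C1_on_snd N(1))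
  assume y: "y \<in> chart_codom c"
  have "(N has_derivative blinfun_apply 0) (at (y, 0))"
    using C1_on_D[OF N(1), of "(y, 0)"] N(2)[OF y] y by simp
  then have "((\<lambda>u. (snd u, N u)) has_derivative (\<lambda>h. (snd h, 0))) (at (y, 0))"
    by (intro has_derivative_Pair) (auto intro!: derivative_eq_intros simp: zero_blinfun.rep_eq)
  from Df_apply_eq[OF this] show "Df (hfield c) (y, 0) h = (snd h, 0)" by (simp add: hf)
qed

lemma hfield_exp:
  fixes \<psi> :: "real \<Rightarrow> (real^2) \<times> (real^2)"
  assumes c: "c = chart_at A x" "y = chart_map c x" and \<xi>: "\<xi> \<noteq> 0" and e: "0 < e" "e < d"
    and \<psi>0: "\<psi> 0 = (y, (1 / e) *\<^sub>R \<xi>)"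
    and \<psi>: "\<And>t. t \<in> {-d<..<d} \<Longrightarrow> fst (\<psi> t) \<in> chart_codom c \<and> (\<psi> has_vector_derivative hfield c (\<psi> t)) (at t)"
  shows "thermostat_exp A g lam x \<xi> = chart_inv c (fst (\<psi> e))"
proof -
  have cA: "c \<in> A" "y \<in> chart_codom c" using chart_at c by auto
  define n where "n = sqrt (B c y \<xi> \<xi>)"
  have n: "n > 0" using B_pos[OF cA \<xi>] by (simp add: n_def)
  define r where "r = n / e"
  have r: "r > 0" using n e by (simp add: r_def)
  have speed: "B c (fst (\<psi> t)) (snd (\<psi> t)) (snd (\<psi> t)) = r\<^sup>2" if t: "t \<in> {-d<..<d}" for t
  proof -
    have "B c (fst (\<psi> t)) (snd (\<psi> t)) (snd (\<psi> t)) = B c (fst (\<psi> 0)) (snd (\<psi> 0)) (snd (\<psi> 0))"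
      by (rule speed_constant[OF cA(1) _ _ _ t, where l="\<lambda>t. sqrt (B c (fst (\<psi> t)) (snd (\<psi> t)) (snd (\<psi> t))) * L c (\<psi> t)"])
        (use \<psi> e in \<open>auto simp: hfield_def\<close>)
    also have "\<dots> = B c y \<xi> \<xi> / e\<^sup>2" by (simp add: \<psi>0 B_simps power2_eq_square)
    also have "\<dots> = r\<^sup>2" using B_pos[OF cA \<xi>] by (simp add: r_def n_def power_divide)
    finally show ?thesis .
  qed
  define \<gamma> where "\<gamma> s = (fst (\<psi> (s / r)), (1 / r) *\<^sub>R snd (\<psi> (s / r)))" for s
  have in_d: "s / r \<in> {-d<..<d}" if "s \<in> {-(r*d)<..<r*d}" for s
    using that r by (auto simp: field_simps)
  have \<gamma>: "\<gamma> s \<in> punct c \<and> (\<gamma> has_vector_derivative F c (\<gamma> s)) (at s)" if s: "s \<in> {-(r*d)<..<r*d}" for s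
  proof -
    let ?u = "\<psi> (s / r)" let ?y = "fst ?u" let ?w = "snd ?u"
    note t = in_d[OF s]
    have u: "?y \<in> chart_codom c" "(\<psi> has_vector_derivative hfield c ?u) (at (s / r))" using \<psi>[OF t] by auto
    have w: "?w \<noteq> 0" using speed[OF t] r by (auto simp: B_simps)
    have sq: "sqrt (B c ?y ?w ?w) = r" using speed[OF t] r by simp
    have "((\<lambda>s. s / r) has_vector_derivative 1 / r) (at s)"
      unfolding has_real_derivative_iff_has_vector_derivative[symmetric] using r by (auto intro!: derivative_eq_intros)
    from vector_diff_chain_at[OF this u(2)]
    have D: "((\<lambda>s. \<psi> (s / r)) has_vector_derivative (1 / r) *\<^sub>R hfield c ?u) (at s)" by (simp add: o_def)
    have "((\<lambda>s. (fst (\<psi> (s / r)), (1 / r) *\<^sub>R snd (\<psi> (s / r)))) has_vector_derivative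
       (fst ((1 / r) *\<^sub>R hfield c ?u), (1 / r) *\<^sub>R snd ((1 / r) *\<^sub>R hfield c ?u))) (at s)"
      by (intro has_vector_derivative_Pair
        bounded_linear.has_vector_derivative[OF bounded_linear_fst D]
        bounded_linear.has_vector_derivative[OF bounded_linear_compose[OF bounded_linear_scaleR_right bounded_linear_snd] D])
    moreover have "(fst ((1 / r) *\<^sub>R hfield c ?u), (1 / r) *\<^sub>R snd ((1 / r) *\<^sub>R hfield c ?u)) = F c (\<gamma> s)"
    proof -
      have "L c (?y, (1 / r) *\<^sub>R ?w) = L c ?u" using local_rep_scale[OF cA(1) u(1) w, of "1 / r" lam] r by simp
      then show ?thesis using r
        by (simp add: \<gamma>_def hfield_def field_eq sq Gam_simps J_simps algebra_simps)
    qed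
    ultimately show ?thesis using u(1) w r by (simp add: \<gamma>_def[abs_def] mem_Times_iff)
  qed
  have rd: "r * d > 0" using r e by simp
  have \<gamma>0: "\<gamma> 0 = (y, (1 / n) *\<^sub>R \<xi>)" using e n by (simp add: \<gamma>_def \<psi>0 r_def)
  have "n < r * d" using n e by (simp add: r_def pos_less_divide_eq)
  then have nr: "n \<in> {-(r*d)<..<r*d}" using n rd by auto
  have "\<Phi> n (tangent_point A c (\<gamma> 0)) = tangent_point A c (\<gamma> n)"
  proof (rule local_flow_tangent_point[OF cA(1) rd \<gamma> _ nr])
    show "B c (fst (\<gamma> 0)) (snd (\<gamma> 0)) (snd (\<gamma> 0)) = 1"
      using B_pos[OF cA \<xi>] by (simp add: \<gamma>0 B_simps n_def)
  qed
  moreover have "tangent_point A c (\<gamma> 0) = normalize_tangent g (x, \<xi>)"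
    by (simp add: \<gamma>0 tangent_point_chart_at[OF c] normalize_tangent_def g_eq_B[OF c] n_def)
  ultimately have "thermostat_exp A g lam x \<xi> = fst (tangent_point A c (\<gamma> n))"
    using \<xi> by (simp add: thermostat_exp_def g_eq_B[OF c] n_def)
  also have "n / r = e" using n e by (simp add: r_def)
  then have "fst (tangent_point A c (\<gamma> n)) = chart_inv c (fst (\<psi> e))" by (simp add: fst_tangent_point \<gamma>_def)
  finally show ?thesis .
qed

lemma exp_zero:
  "\<exists>d W. d \<in> A \<and> open W \<and> 0 \<in> W \<and> (\<forall>q\<in>W. thermostat_exp A g lam x q \<in> chart_dom d) \<and>
    C1_on W (\<lambda>q. chart_map d (thermostat_exp A g lam x q)) \<and>
    inj (blinfun_apply (Df (\<lambda>q. chart_map d (thermostat_exp A g lam x q)) 0))"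
proof -
  define c where "c = chart_at A x"
  define y where "y = chart_map c x"
  have c: "c \<in> A" "x \<in> chart_dom c" "y \<in> chart_codom c" using chart_at by (auto simp: c_def y_def)
  let ?S = "chart_codom c \<times> (UNIV :: (real^2) set)"
  have oS: "open ?S" by (intro open_Times open_chart_codom c) auto
  define u0 where "u0 = (y, 0 :: real^2)"
  have u0: "u0 \<in> ?S" using c by (simp add: u0_def)
  obtain d r \<psi> and Z :: "real \<Rightarrow> _ \<Rightarrow> _ \<Rightarrow>\<^sub>L _" where d: "d > 0" "r > 0"
    and \<psi>: "\<And>u. u \<in> ball u0 r \<Longrightarrow> \<psi> 0 u = u" "\<And>u. u \<in> ball u0 r \<Longrightarrow> Z 0 u = id_blinfun"
      "\<And>u t. u \<in> ball u0 r \<Longrightarrow> t \<in> {-d<..<d} \<Longrightarrow> \<psi> t u \<in> ?S"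
      "\<And>u t. u \<in> ball u0 r \<Longrightarrow> t \<in> {-d<..<d} \<Longrightarrow> ((\<lambda>t. \<psi> t u) has_vector_derivative hfield c (\<psi> t u)) (at t)"
      "\<And>u t h. u \<in> ball u0 r \<Longrightarrow> t \<in> {-d<..<d} \<Longrightarrow> ((\<lambda>t. Z t u h) has_vector_derivative Df (hfield c) (\<psi> t u) (Z t u h)) (at t)"
      "\<And>u t. u \<in> ball u0 r \<Longrightarrow> t \<in> {-d<..<d} \<Longrightarrow> ((\<lambda>(t, u). \<psi> t u) has_derivative (\<lambda>(s, h). s *\<^sub>R hfield c (\<psi> t u) + Z t u h)) (at (t, u))"
    and Zc: "continuous_on ({-d<..<d} \<times> ball u0 r) (\<lambda>(t, u). Z t u)"
    using local_flow[OF oS hfield_C1(1)[OF c(1)] u0] by blast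
  have u0b: "u0 \<in> ball u0 r" using d by simp
  have "hfield c u0 = 0" by (simp add: hfield_def u0_def Gam_simps J_simps zero_prod_def)
  then have const: "((\<lambda>t. u0) has_vector_derivative hfield c u0) (at t)" for t by simp
  have "\<exists>r'>0. \<forall>t. \<bar>t - 0\<bar> < r' \<longrightarrow> \<psi> t u0 = u0"
  proof (rule ode_local_unique[OF oS hfield_C1(1)[OF c(1)] d(1)])
    fix t :: real assume "\<bar>t - 0\<bar> < d"
    then have "t \<in> {-d<..<d}" by auto
    then show "\<psi> t u0 \<in> ?S \<and> ((\<lambda>t. \<psi> t u0) has_vector_derivative hfield c (\<psi> t u0)) (at t)"
      using \<psi>(3,4)[OF u0b] by blast
    show "u0 \<in> ?S \<and> ((\<lambda>t. u0) has_vector_derivative hfield c u0) (at t)" using u0 const by blast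
  qed (rule \<psi>(1)[OF u0b])
  then obtain r' where r': "r' > 0" "\<And>t. \<bar>t\<bar> < r' \<Longrightarrow> \<psi> t u0 = u0" by auto
  define e where "e = min d r' / 2"
  have e: "0 < e" "e < d" "e < r'" using d r' by (auto simp: e_def min_def)
  have eI: "e \<in> {-d<..<d}" using e by auto
  define i where "i q = (y, (1 / e) *\<^sub>R q)" for q :: "real^2"
  have i_deriv: "(i has_derivative (\<lambda>k. (0, (1 / e) *\<^sub>R k))) (at q)" for q
    unfolding i_def by (auto intro!: derivative_eq_intros)
  define W where "W = ball (0 :: real^2) (e * r)"
  have iW: "i q \<in> ball u0 r" if "q \<in> W" for q
  proof -
    have "dist u0 (i q) = norm q / e" using e by (simp add: i_def u0_def dist_Pair_Pair dist_norm)
    then show ?thesis using that e by (simp add: W_def pos_divide_less_eq mult.commute)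
  qed
  have W: "open W" "0 \<in> W" using e d by (auto simp: W_def)
  have exp: "thermostat_exp A g lam x q = chart_inv c (fst (\<psi> e (i q)))" if "q \<in> W" for q
  proof (cases "q = 0")
    case True
    have "i q = u0" using True by (simp add: i_def u0_def)
    then show ?thesis using True r'(2)[of e] e c by (simp add: thermostat_exp_def u0_def y_def chart_inv_map)
  next
    case False
    show ?thesis
    proof (rule hfield_exp[where \<psi>="\<lambda>t. \<psi> t (i q)", OF c_def y_def False e(1,2)])
      show "\<psi> 0 (i q) = (y, (1 / e) *\<^sub>R q)" using \<psi>(1)[OF iW[OF that]] by (simp add: i_def)
      show "fst (\<psi> t (i q)) \<in> chart_codom c \<and> ((\<lambda>t. \<psi> t (i q)) has_vector_derivative hfield c (\<psi> t (i q))) (at t)"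
        if "t \<in> {-d<..<d}" for t
        using \<psi>(3,4)[OF iW[OF \<open>q \<in> W\<close>] that] by (simp add: mem_Times_iff)
    qed
  qed
  have fc: "fst (\<psi> e (i q)) \<in> chart_codom c" if "q \<in> W" for q
    using \<psi>(3)[OF iW[OF that] eI] by (simp add: mem_Times_iff)
  have dom: "thermostat_exp A g lam x q \<in> chart_dom c" and
    eq: "chart_map c (thermostat_exp A g lam x q) = fst (\<psi> e (i q))" if "q \<in> W" for q
    using exp[OF that] chart_inv_in[OF c(1) fc[OF that]] chart_map_inv[OF c(1) fc[OF that]] by auto
  define f where "f q = chart_map c (thermostat_exp A g lam x q)" for q
  define f' where "f' q = fst_blinfun o\<^sub>L (Z e (i q) o\<^sub>L Blinfun (\<lambda>k. (0, (1 / e) *\<^sub>R k)))" for q :: "real^2"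
  have bl: "bounded_linear (\<lambda>k :: real^2. (0 :: real^2, (1 / e) *\<^sub>R k))"
    by (intro bounded_linear_Pair bounded_linear_zero bounded_linear_scaleR_right)
  have f'_apply: "f' q k = fst (Z e (i q) (0, (1 / e) *\<^sub>R k))" for q k
    by (simp add: f'_def blinfun_compose.rep_eq bounded_linear_Blinfun_apply[OF bl])
  have fd: "(f has_derivative blinfun_apply (f' q)) (at q)" if q: "q \<in> W" for q
  proof -
    have "((\<lambda>q. (e, i q)) has_derivative (\<lambda>k. (0, (0, (1 / e) *\<^sub>R k)))) (at q)"
      by (intro has_derivative_Pair has_derivative_const i_deriv)
    from has_derivative_compose[where f="\<lambda>q. (e, i q)" and x=q, OF this \<psi>(6)[OF iW[OF q] eI]]
    have "((\<lambda>q. \<psi> e (i q)) has_derivative (\<lambda>k. Z e (i q) (0, (1 / e) *\<^sub>R k))) (at q)" by simp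
    from has_derivative_fst[OF this]
    have "((\<lambda>q. fst (\<psi> e (i q))) has_derivative blinfun_apply (f' q)) (at q)"
      by (rule back_subst[of "\<lambda>f. (_ has_derivative f) _"]) (simp add: fun_eq_iff f'_apply)
    then show ?thesis
      by (rule has_derivative_transform_within_open[OF _ W(1) q]) (simp add: f_def eq)
  qed
  have "continuous_on W (\<lambda>q. case (e, i q) of (t, u) \<Rightarrow> Z t u)"
    by (rule continuous_on_compose2[OF Zc]) (use eI iW in \<open>auto simp: i_def intro!: continuous_intros\<close>)
  then have "continuous_on W f'"
    unfolding f'_def[abs_def] by (intro continuous_intros) simp
  with fd have C1f: "C1_on W f" by (rule C1_onI)
  have "f' 0 k = k" for k
  proof -
    define h where "h = (0 :: real^2, (1 / e) *\<^sub>R k)"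
    have i0: "i 0 = u0" by (simp add: i_def u0_def)
    have Zd: "((\<lambda>t. Z t u0 h) has_vector_derivative (snd (Z t u0 h), 0)) (at t within {0..e})" if "t \<in> {0..e}" for t
    proof -
      have "((\<lambda>t. Z t u0 h) has_vector_derivative Df (hfield c) (\<psi> t u0) (Z t u0 h)) (at t)"
        by (rule \<psi>(5)[OF u0b]) (use that e in auto)
      moreover have "\<psi> t u0 = (y, 0)" using r'(2)[of t] that e by (simp add: u0_def)
      ultimately show ?thesis using hfield_C1(2)[OF c(1,3)] by (simp add: has_vector_derivative_at_within)
    qed
    have Z0: "Z 0 u0 h = h" using \<psi>(2)[OF u0b] by simp
    have sn: "snd (Z t u0 h) = snd h" if "t \<in> {0..e}" for t
    proof -
      have "((\<lambda>t. snd (Z t u0 h)) has_vector_derivative 0) (at t within {0..e})" if "t \<in> {0..e}" for t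
        using bounded_linear.has_vector_derivative[OF bounded_linear_snd Zd[OF that]] by simp
      from vector_derivative_bound[of "{0..e}" "\<lambda>t. snd (Z t u0 h)" "\<lambda>_. 0" 0 0 t, OF _ this]
      show ?thesis using that e Z0 by simp
    qed
    have "((\<lambda>t. fst (Z t u0 h) - t *\<^sub>R snd h) has_vector_derivative 0) (at t within {0..e})" if "t \<in> {0..e}" for t
    proof -
      have "((\<lambda>t. fst (Z t u0 h)) has_vector_derivative snd h) (at t within {0..e})"
        using bounded_linear.has_vector_derivative[OF bounded_linear_fst Zd[OF that]] sn[OF that] by simp
      moreover have "((\<lambda>t. t *\<^sub>R snd h) has_vector_derivative (t *\<^sub>R 0 + 1 *\<^sub>R snd h)) (at t within {0..e})"
        by (rule has_vector_derivative_scaleR[OF DERIV_ident has_vector_derivative_const])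
      ultimately show ?thesis using has_vector_derivative_diff by fastforce
    qed
    from vector_derivative_bound[of "{0..e}" "\<lambda>t. fst (Z t u0 h) - t *\<^sub>R snd h" "\<lambda>_. 0" 0 0 e, OF _ this]
    have "fst (Z e u0 h) = e *\<^sub>R snd h" using e Z0 by (simp add: h_def)
    then show ?thesis using e by (simp add: f'_apply i0 flip: h_def) (simp add: h_def)
  qed
  then have "inj (blinfun_apply (f' 0))" by (simp add: inj_def)
  then have "inj (blinfun_apply (Df f 0))" using Df_eqI[OF fd[OF W(2)]] by simp
  then show ?thesis using c(1) W dom C1f unfolding f_def[abs_def] by blast
qed

end

theorem theorem1p1:
  fixes A :: "'m::t2_space chart set"
    and g :: "'m metric"
    and lam p :: "'m \<times> (real^2) \<Rightarrow> real"
  assumes "thermostat A g lam"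
    and "C1_along_flow A g lam p"
    and "\<forall>v\<in>unit_tangent g. kappa A g lam p v \<le> 0"
  shows "no_conjugate_points A g lam"
proof -
  interpret thermo A g lam
    using assms(1) by unfold_locales (auto simp: thermostat_def)
  show ?thesis
    unfolding no_conjugate_points_def local_diffeomorphism_def
  proof (intro allI)
    fix x \<xi>
    have "\<exists>d W. d \<in> A \<and> open W \<and> \<xi> \<in> W \<and> (\<forall>q\<in>W. thermostat_exp A g lam x q \<in> chart_dom d) \<and>
      C1_on W (\<lambda>q. chart_map d (thermostat_exp A g lam x q)) \<and>
      inj (blinfun_apply (Df (\<lambda>q. chart_map d (thermostat_exp A g lam x q)) \<xi>))"
      using exp_zero exp_nonzero[OF assms(2,3)] by (cases "\<xi> = 0") blast+
    then obtain d W where "d \<in> A" "open W" "\<xi> \<in> W" "\<And>q. q \<in> W \<Longrightarrow> thermostat_exp A g lam x q \<in> chart_dom d"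
      "C1_on W (\<lambda>q. chart_map d (thermostat_exp A g lam x q))"
      "inj (blinfun_apply (Df (\<lambda>q. chart_map d (thermostat_exp A g lam x q)) \<xi>))" by blast
    from local_diffeomorphism_at[OF this]
    show "\<exists>U h. open U \<and> \<xi> \<in> U \<and> open (thermostat_exp A g lam x ` U) \<and>
      homeomorphism U (thermostat_exp A g lam x ` U) (thermostat_exp A g lam x) h \<and>
      (\<forall>c\<in>A. Ck_on 1 (U \<inter> thermostat_exp A g lam x -` chart_dom c) (chart_map c \<circ> thermostat_exp A g lam x) \<and>
             Ck_on 1 (chart_map c ` (chart_dom c \<inter> thermostat_exp A g lam x ` U)) (h \<circ> chart_inv c))" .
  qed
qed

end
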